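(* Let $N\ge0$ be an integer, $z\in\mathbb{C}\setminus\{0\}$ and $k,j\in\{0,\dots,N\}$. The matrix elements $t^N_{kj}(\mu,z)\in\mathcal{F}_R(U(2))$, $$\begin{aligned} t^N_{kj}(\mu,z)=\sum_{l=\max(0,k+j-N)}^{\min(k,j)}&\begin{bmatrix}k\\ l\end{bmatrix}\begin{bmatrix}N-k\\ j-l\end{bmatrix}\frac{(q^{2(\mu+N-k-2j+l+2)})_l}{(q^{2(\mu+N-2j+2)})_l}\,\frac{(q^{2(\mu+l-j+2)})_{j-l}}{(q^{2(\mu+N-2j-k+2l+2)})_{j-l}}\\ &\times\gamma(q^{2(N-k-1)}z)\cdots\gamma(q^{2(N-j-k+l)}z)\;\delta(q^{2(N-j-k+l-1)}z)\cdots\delta(z)\\ &\times\alpha(q^{2(N-1)}z)\cdots\alpha(q^{2(N-l)}z)\;\beta(q^{2(N-l-1)}z)\cdots\beta(q^{2(N-k)}z), \end{aligned}$$ satisfy $$\Gamma_k(\mu)\,S\big(t^N_{kj}(\mu,z)\big)^*=\Gamma_j(\lambda)\,t^N_{jk}\big(\mu,q^{-2(N-2)}/\overline z\big)\prod_{i=0}^{N-1}\det{}^{-1}(q^{-2i}/\overline z),$$ where $$\Gamma_k(\mu)=\begin{bmatrix}N\\ k\end{bmatrix}\frac{(q^{2(\mu-k+2)})_k}{(q^{2(\mu+N-2k+2)})_k}\prod_{i=0}^{N-k-1}\frac{q^{-(\mu+N-2k-i)}}{\theta(q^{-2(\mu+N-2k-i+1)})}\prod_{i=0}^{k-1}\frac{q^{-(\mu-k+i)}}{\theta(q^{-2(\mu-k+i+1)})}.$$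 (In each string of generators in $t^N_{kj}$ the exponent of $q$ changes by steps of $2$: $j-l$ factors $\gamma$, $N-k-j+l$ factors $\delta$, $l$ factors $\alpha$, $k-l$ factors $\beta$; empty products equal $1$.)
   Context: Notation. $0<p,q<1$ are fixed and algebraically independent over $\mathbb{Q}$; $q^x=\exp(x\log q)$. $\theta(z)=\prod_{j\ge0}(1-zp^j)(1-p^{j+1}/z)$, $(a)_n=\prod_{i=0}^{n-1}\theta(aq^{2i})$, $\begin{bmatrix}k\\ l\end{bmatrix}=\prod_{i=1}^l\frac{\theta(q^{2(k-l+i)})}{\theta(q^{2i})}$. Identify $\mathfrak{h}=\mathfrak{h}^*=\mathbb{C}$; $M_{\mathfrak{h}^*}$ is the field of meromorphic functions on $\mathbb{C}$, $(T_\alpha f)(\lambda)=f(\lambda+\alpha)$, $\overline f(\lambda)=\overline{f(\overline\lambda)}$. The algebra $\mathcal{F}_R(M(2))$. Put $$a(\lambda,z)=\tfrac{\theta(z)\theta(q^{2(\lambda+2)})}{\theta(q^2z)\theta(q^{2(\lambda+1)})},\quad b(\lambda,z)=\tfrac{\theta(q^2)\theta(q^{-2(\lambda+1)}z)}{\theta(q^2z)\theta(q^{-2(\lambda+1)})},\quad c(\lambda,z)=\tfrac{\theta(q^2)\theta(q^{2(\lambda+1)}z)}{\theta(q^2z)\theta(q^{2(\lambda+1)})},\quad d(\lambda,z)=\tfrac{\theta(z)\theta(q^{-2\lambda})}{\theta(q^2z)\theta(q^{-2(\lambda+1)})}.$$ $\mathcal{F}_R(M(2))$ is the unital complex algebra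 generated by $\alpha(z),\beta(z),\gamma(z),\delta(z)$ ($z\in\mathbb{C}\setminus\{0\}$) and two commuting copies of $M_{\mathfrak{h}^*}$ (embedded as subalgebras), whose elements are written $f(\lambda)$ and $f(\mu)$. The generators have bidegrees $\alpha(z):(1,1)$, $\beta(z):(1,-1)$, $\gamma(z):(-1,1)$, $\delta(z):(-1,-1)$, $f(\lambda),f(\mu):(0,0)$, and $f(\lambda)x=xf(\lambda+m)$, $f(\mu)x=xf(\mu+n)$ for a generator $x$ of bidegree $(m,n)$. The remaining relations are, with $z_{12}=z_1/z_2$: each of $\alpha(z_1)\alpha(z_2)$, $\beta(z_1)\beta(z_2)$, $\gamma(z_1)\gamma(z_2)$, $\delta(z_1)\delta(z_2)$ is symmetric in $z_1,z_2$; for $(x,y)=(\alpha,\beta)$ and $(x,y)=(\gamma,\delta)$: $x(z_1)y(z_2)=a(\mu,z_{12})y(z_2)x(z_1)+c(\mu,z_{12})x(z_2)y(z_1)$, $\;y(z_1)x(z_2)=b(\mu,z_{12})y(z_2)x(z_1)+d(\mu,z_{12})x(z_2)y(z_1)$; for $(x,y)=(\alpha,\gamma)$ and $(x,y)=(\beta,\delta)$: $a(\lambda,z_{12})x(z_1)y(z_2)+b(\lambda,z_{12})y(z_1)x(z_2)=y(z_2)x(z_1)$, $\;c(\lambda,z_{12})x(z_1)y(z_2)+d(\lambda,z_{12})y(z_1)x(z_2)=x(z_2)y(z_1)$; and $a(\lambda,z_{12})\alpha(z_1)\delta(z_2)+b(\lambda,z_{12})\gamma(z_1)\beta(z_2)=a(\mu,z_{12})\delta(z_2)\alpha(z_1)+c(\mu,z_{12})\gamma(z_2)\beta(z_1)$,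 $c(\lambda,z_{12})\alpha(z_1)\delta(z_2)+d(\lambda,z_{12})\gamma(z_1)\beta(z_2)=a(\mu,z_{12})\beta(z_2)\gamma(z_1)+c(\mu,z_{12})\alpha(z_2)\delta(z_1)$, $a(\lambda,z_{12})\beta(z_1)\gamma(z_2)+b(\lambda,z_{12})\delta(z_1)\alpha(z_2)=b(\mu,z_{12})\delta(z_2)\alpha(z_1)+d(\mu,z_{12})\gamma(z_2)\beta(z_1)$, $c(\lambda,z_{12})\beta(z_1)\gamma(z_2)+d(\lambda,z_{12})\delta(z_1)\alpha(z_2)=b(\mu,z_{12})\beta(z_2)\gamma(z_1)+d(\mu,z_{12})\alpha(z_2)\delta(z_1)$. When $\theta(q^2z_{12})=0$, where $a,b,c,d$ have a simple pole in $z_{12}$, relations involving them are understood as residual relations (multiply by $\theta(q^2z_{12})$ and then specialize the coefficients to this value of $z_{12}$). With $F(\mu)=q^\mu\theta(q^{-2(\mu+1)})$, the element $\det(z)=\frac{F(\mu)}{F(\lambda)}[\alpha(z)\delta(q^2z)-\gamma(z)\beta(q^2z)]$ is central. $\mathcal{F}_R(U(2))$ is obtained by adjoining central inverses $\det^{-1}(z)$ for all $z$, and carries: the antipode $S$, the $\mathbb{C}$-linear algebra antihomomorphism with $S(f(\lambda))=f(\mu)$, $S(f(\mu))=f(\lambda)$, $S(\det^{-1}(z))=\det(z)$ and $S(\alpha(z))=\frac{F(\mu)}{F(\lambda)}\det^{-1}(q^{-2}z)\delta(q^{-2}z)$, $S(\beta(z))=-\frac{F(\mu)}{F(\lambda)}\det^{-1}(q^{-2}z)\beta(q^{-2}z)$,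 $S(\gamma(z))=-\frac{F(\mu)}{F(\lambda)}\det^{-1}(q^{-2}z)\gamma(q^{-2}z)$, $S(\delta(z))=\frac{F(\mu)}{F(\lambda)}\det^{-1}(q^{-2}z)\alpha(q^{-2}z)$; the $*$-structure, the $\mathbb{C}$-antilinear antimultiplicative involution with $\alpha(z)^*=\delta(1/\overline z)$, $\beta(z)^*=-\gamma(1/\overline z)$, $\gamma(z)^*=-\beta(1/\overline z)$, $\delta(z)^*=\alpha(1/\overline z)$, $\det^{-1}(z)^*=\det^{-1}(q^{-2}/\overline z)$, $f(\lambda)^*=\overline f(\lambda)$, $f(\mu)^*=\overline f(\mu)$. The comultiplication of $\mathcal{F}_R(U(2))$ (given by $\Delta\alpha=\alpha\otimes\alpha+\beta\otimes\gamma$, $\Delta\beta=\alpha\otimes\beta+\beta\otimes\delta$, $\Delta\gamma=\gamma\otimes\alpha+\delta\otimes\gamma$, $\Delta\delta=\gamma\otimes\beta+\delta\otimes\delta$, $\Delta f(\lambda)=f(\lambda)\otimes1$, $\Delta f(\mu)=1\otimes f(\mu)$, all at the same $z$, with values in the tensor product modulo $f(\mu)x\otimes y=x\otimes f(\lambda)y$) satisfies $\Delta(v_k(z))=\sum_jt^N_{kj}(\mu,z)\otimes v_j(z)$ with $v_k(z)=\gamma(z)\cdots\gamma(q^{2(N-k-1)}z)\alpha(q^{2(N-k)}z)\cdots\alpha(q^{2(N-1)}z)$; thus the $t^N_{kj}$ are the matrix elements of a corepresentation. *)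

theory Defs
  imports "HOL-Complex_Analysis.Complex_Analysis" "HOL-Library.Poly_Mapping" "HOL-Algebra.QuotRing"
begin

section \<open>Parameters and theta functions\<close>

text \<open>Algebraic independence over the rationals: no nonzero polynomial
  $\sum c_{ij} X^i Y^j$ with rational coefficients vanishes at $(p,q)$.\<close>

definition alg_indep_Q :: "real \<Rightarrow> real \<Rightarrow> bool" where
  "alg_indep_Q p q \<longleftrightarrow>
     (\<forall>(c :: nat \<Rightarrow> nat \<Rightarrow> rat) n. (\<Sum>i\<le>n. \<Sum>j\<le>n. of_rat (c i j) * p ^ i * q ^ j) = 0
        \<longrightarrow> (\<forall>i\<le>n. \<forall>j\<le>n. c i j = 0))"

definition qpow :: "real \<Rightarrow> complex \<Rightarrow> complex" where
  "qpow q x = exp (x * of_real (ln q))"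

definition theta :: "real \<Rightarrow> complex \<Rightarrow> complex" where
  "theta p z = prodinf (\<lambda>j. (1 - z * of_real p ^ j) * (1 - of_real p ^ Suc j / z))"

definition epoch :: "real \<Rightarrow> real \<Rightarrow> complex \<Rightarrow> nat \<Rightarrow> complex" where
  "epoch p q a n = (\<Prod>i<n. theta p (a * of_real q ^ (2 * i)))"

definition ebinom :: "real \<Rightarrow> real \<Rightarrow> nat \<Rightarrow> nat \<Rightarrow> complex" where
  "ebinom p q k l =
     (\<Prod>i=1..l. theta p (of_real q powi (2 * (int k - int l + int i))) / theta p (of_real q ^ (2 * i)))"


section \<open>The field of meromorphic functions on the complex plane\<close>

text \<open>Library functions that are \<^const>\<open>meromorphic_on\<close> the plane carry junk values at poles (and
  possibly on any sparse set), so they are identified when they agree off a sparse set.\<close>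

definition mero_rel :: "(complex \<Rightarrow> complex) \<Rightarrow> (complex \<Rightarrow> complex) \<Rightarrow> bool" where
  "mero_rel f g \<longleftrightarrow> f meromorphic_on UNIV \<and> g meromorphic_on UNIV \<and>
     eventually (\<lambda>x. f x = g x) (cosparse UNIV)"

lemma mero_rel_I:
  assumes "f meromorphic_on UNIV" "g meromorphic_on UNIV" "\<And>x. f x = g x"
  shows "mero_rel f g"
  using assms by (simp add: mero_rel_def)

lemma part_equivp_mero_rel: "part_equivp mero_rel"
proof (rule part_equivpI)
  show "\<exists>f. mero_rel f f"
    by (rule exI[of _ "\<lambda>_. 0"]) (auto simp: mero_rel_def)
  show "symp mero_rel"
    by (auto simp: symp_def mero_rel_def eq_commute)
  show "transp mero_rel"
  proof (rule transpI)
    fix f g h assume *: "mero_rel f g" "mero_rel g h"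
    have "eventually (\<lambda>x. f x = g x) (cosparse UNIV)" "eventually (\<lambda>x. g x = h x) (cosparse UNIV)"
      using * by (auto simp: mero_rel_def)
    then have "eventually (\<lambda>x. f x = h x) (cosparse UNIV)"
      by eventually_elim auto
    then show "mero_rel f h"
      using * by (auto simp: mero_rel_def)
  qed
qed

quotient_type mero = "complex \<Rightarrow> complex" / partial: mero_rel
  by (rule part_equivp_mero_rel)

lemma mero_rel_binop:
  assumes "mero_rel f f'" "mero_rel g g'"
    and "\<And>f g. f meromorphic_on UNIV \<Longrightarrow> g meromorphic_on UNIV \<Longrightarrow> (\<lambda>x. h (f x) (g x)) meromorphic_on UNIV"
  shows "mero_rel (\<lambda>x. h (f x) (g x)) (\<lambda>x. h (f' x) (g' x))"
proof -
  have "eventually (\<lambda>x. f x = f' x) (cosparse UNIV)" "eventually (\<lambda>x. g x = g' x) (cosparse UNIV)"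
    using assms by (auto simp: mero_rel_def)
  then have "eventually (\<lambda>x. h (f x) (g x) = h (f' x) (g' x)) (cosparse UNIV)"
    by eventually_elim auto
  then show ?thesis using assms by (auto simp: mero_rel_def)
qed

instantiation mero :: field
begin

lift_definition zero_mero :: mero is "\<lambda>_. 0" by (auto simp: mero_rel_def)
lift_definition one_mero :: mero is "\<lambda>_. 1" by (auto simp: mero_rel_def)
lift_definition plus_mero :: "mero \<Rightarrow> mero \<Rightarrow> mero" is "\<lambda>f g x. f x + g x"
  by (rule mero_rel_binop) (auto intro: meromorphic_intros)
lift_definition minus_mero :: "mero \<Rightarrow> mero \<Rightarrow> mero" is "\<lambda>f g x. f x - g x"
  by (rule mero_rel_binop) (auto intro: meromorphic_intros)
lift_definition times_mero :: "mero \<Rightarrow> mero \<Rightarrow> mero" is "\<lambda>f g x. f x * g x"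
  by (rule mero_rel_binop) (auto intro: meromorphic_intros)
lift_definition divide_mero :: "mero \<Rightarrow> mero \<Rightarrow> mero" is "\<lambda>f g x. f x / g x"
  by (rule mero_rel_binop) (auto intro: meromorphic_intros)
lift_definition uminus_mero :: "mero \<Rightarrow> mero" is "\<lambda>f x. - f x"
  by (rule mero_rel_binop[where h = "\<lambda>x _. - x"]) (auto intro: meromorphic_intros)
lift_definition inverse_mero :: "mero \<Rightarrow> mero" is "\<lambda>f x. inverse (f x)"
  by (rule mero_rel_binop[where h = "\<lambda>x _. inverse x"]) (auto intro: meromorphic_intros)

instance
proof
  fix a b c :: mero
  show "a + b + c = a + (b + c)"
    by transfer (auto intro!: mero_rel_I meromorphic_intros simp: mero_rel_def)
  show "a + b = b + a"
    by transfer (auto intro!: mero_rel_I meromorphic_intros simp: mero_rel_def)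
  show "0 + a = a"
    by transfer (auto intro!: mero_rel_I meromorphic_intros simp: mero_rel_def)
  show "- a + a = 0"
    by transfer (auto intro!: mero_rel_I meromorphic_intros simp: mero_rel_def)
  show "a - b = a + - b"
    by transfer (auto intro!: mero_rel_I meromorphic_intros simp: mero_rel_def)
  show "a * b * c = a * (b * c)"
    by transfer (auto intro!: mero_rel_I meromorphic_intros simp: mero_rel_def)
  show "a * b = b * a"
    by transfer (auto intro!: mero_rel_I meromorphic_intros simp: mero_rel_def)
  show "1 * a = a"
    by transfer (auto intro!: mero_rel_I meromorphic_intros simp: mero_rel_def)
  show "(a + b) * c = a * c + b * c"
    by transfer (auto intro!: mero_rel_I meromorphic_intros simp: mero_rel_def algebra_simps)
  show "(0::mero) \<noteq> 1"
    by transfer (auto simp: mero_rel_def)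
  show "a div b = a * inverse b"
    by transfer (auto intro!: mero_rel_I meromorphic_intros simp: mero_rel_def field_simps)
  show "inverse (0::mero) = 0"
    by transfer (auto intro!: mero_rel_I meromorphic_intros simp: mero_rel_def)
  show "inverse a * a = 1" if "a \<noteq> 0"
    using that
  proof transfer
    fix f :: "complex \<Rightarrow> complex"
    assume f: "mero_rel f f" and nz: "\<not> mero_rel f (\<lambda>_. 0)"
    have mero: "f meromorphic_on UNIV" using f by (simp add: mero_rel_def)
    have "eventually (\<lambda>z. f z = 0) (cosparse UNIV) \<or> eventually (\<lambda>z. f z \<noteq> 0) (cosparse UNIV)"
      by (rule meromorphic_imp_constant_or_avoid) (use mero in auto)
    moreover have "\<not> eventually (\<lambda>z. f z = 0) (cosparse UNIV)"
      using nz mero by (auto simp: mero_rel_def)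
    ultimately have "eventually (\<lambda>z. f z \<noteq> 0) (cosparse UNIV)" by blast
    then have "eventually (\<lambda>z. inverse (f z) * f z = 1) (cosparse UNIV)"
      by eventually_elim auto
    then show "mero_rel (\<lambda>x. inverse (f x) * f x) (\<lambda>_. 1)"
      using mero by (auto simp: mero_rel_def intro!: meromorphic_intros)
  qed
qed

end

lemma eventually_cosparse_UNIV_compose:
  assumes "eventually P (cosparse (UNIV :: complex set))"
    and "continuous_on UNIV h" "inj h"
  shows "eventually (\<lambda>x. P (h x)) (cosparse (UNIV :: complex set))"
proof -
  have P: "eventually P (at y)" for y
    using assms(1) by (simp add: eventually_cosparse_open_eq)
  have "eventually (\<lambda>x. P (h x)) (at x)" for x
  proof -
    have "filterlim h (at (h x)) (at x)"
      unfolding filterlim_at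
    proof
      show "(h \<longlongrightarrow> h x) (at x)"
        using assms(2) by (simp add: continuous_on_def)
      show "\<forall>\<^sub>F y in at x. h y \<in> UNIV \<and> h y \<noteq> h x"
        using assms(3) by (auto simp: eventually_at_filter inj_eq)
    qed
    then show ?thesis using P by (simp add: filterlim_iff)
  qed
  then show ?thesis by (simp add: eventually_cosparse_open_eq)
qed

lemma meromorphic_on_UNIV_cnj_cnj:
  assumes "f meromorphic_on UNIV"
  shows "(\<lambda>x. cnj (f (cnj x))) meromorphic_on UNIV"
proof -
  have "isolated_singularity_at (\<lambda>x. cnj (f (cnj x))) z" for z
  proof -
    have "isolated_singularity_at f (cnj z)"
      using assms by (simp add: meromorphic_on_altdef)
    then obtain r where r: "r > 0" "f analytic_on ball (cnj z) r - {cnj z}"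
      by (auto simp: isolated_singularity_at_def)
    then have "f holomorphic_on ball (cnj z) r - {cnj z}"
      by (simp add: analytic_imp_holomorphic)
    moreover have "ball (cnj z) r - {cnj z} = cnj ` (ball z r - {z})"
    proof (intro equalityI subsetI)
      fix x assume x: "x \<in> ball (cnj z) r - {cnj z}"
      have "dist z (cnj x) = dist (cnj z) x"
        by (metis complex_cnj_cnj complex_cnj_diff complex_mod_cnj dist_norm)
      then show "x \<in> cnj ` (ball z r - {z})"
        using x by (intro image_eqI[of _ _ "cnj x"]) auto
    next
      fix x assume "x \<in> cnj ` (ball z r - {z})"
      then show "x \<in> ball (cnj z) r - {cnj z}"
        by (auto simp: dist_norm simp flip: complex_cnj_diff)
    qed
    ultimately have "(cnj \<circ> f \<circ> cnj) holomorphic_on (ball z r - {z})"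
      by (intro holomorphic_on_compose_cnj_cnj) (auto simp: open_delete)
    then have "(\<lambda>x. cnj (f (cnj x))) analytic_on (ball z r - {z})"
      by (subst analytic_on_open) (auto simp: open_delete o_def)
    then show ?thesis
      using r by (auto simp: isolated_singularity_at_def)
  qed
  moreover have "not_essential (\<lambda>x. cnj (f (cnj x))) z" for z
  proof -
    have lim: "filterlim cnj (at (cnj z)) (at z)"
      unfolding filterlim_at by (auto simp: eventually_at_filter intro!: tendsto_intros)
    have "not_essential f (cnj z)"
      using assms by (simp add: meromorphic_on_altdef)
    then consider l where "f \<midarrow>cnj z\<rightarrow> l" | "is_pole f (cnj z)"
      by (auto simp: not_essential_def)
    then show ?thesis
    proof cases
      case 1
      then have "((\<lambda>x. f (cnj x)) \<longlongrightarrow> l) (at z)"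
        using filterlim_compose lim by blast
      then have "((\<lambda>x. cnj (f (cnj x))) \<longlongrightarrow> cnj l) (at z)"
        by (rule tendsto_cnj)
      then show ?thesis by (auto simp: not_essential_def)
    next
      case 2
      then have "filterlim (\<lambda>x. f (cnj x)) at_infinity (at z)"
        unfolding is_pole_def using filterlim_compose lim by blast
      then have "filterlim (\<lambda>x. cnj (f (cnj x))) at_infinity (at z)"
        by (simp add: filterlim_at_infinity_conv_norm_at_top)
      then show ?thesis by (auto simp: not_essential_def is_pole_def)
    qed
  qed
  ultimately show ?thesis by (simp add: meromorphic_on_altdef)
qed

lift_definition shift :: "complex \<Rightarrow> mero \<Rightarrow> mero" is "\<lambda>a f x. f (x + a)"
proof -
  fix a f g assume *: "mero_rel f g"
  have m: "(\<lambda>x. h (x + a)) meromorphic_on UNIV" if "h meromorphic_on UNIV" for h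
    by (rule meromorphic_on_compose[OF that]) (auto intro!: analytic_intros)
  have "eventually (\<lambda>x. f (x + a) = g (x + a)) (cosparse UNIV)"
    by (rule eventually_cosparse_UNIV_compose[where h = "\<lambda>x. x + a" and P = "\<lambda>x. f x = g x"])
       (use * in \<open>auto simp: mero_rel_def intro!: continuous_intros\<close>)
  then show "mero_rel (\<lambda>x. f (x + a)) (\<lambda>x. g (x + a))"
    using * m by (auto simp: mero_rel_def)
qed

lift_definition mero_bar :: "mero \<Rightarrow> mero" is "\<lambda>f x. cnj (f (cnj x))"
proof -
  fix f g assume *: "mero_rel f g"
  have "eventually (\<lambda>x. f (cnj x) = g (cnj x)) (cosparse UNIV)"
    by (rule eventually_cosparse_UNIV_compose[where h = cnj and P = "\<lambda>x. f x = g x"])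
       (use * in \<open>auto simp: mero_rel_def inj_on_def intro!: continuous_intros\<close>)
  then have "eventually (\<lambda>x. cnj (f (cnj x)) = cnj (g (cnj x))) (cosparse UNIV)"
    by eventually_elim auto
  then show "mero_rel (\<lambda>x. cnj (f (cnj x))) (\<lambda>x. cnj (g (cnj x)))"
    using * meromorphic_on_UNIV_cnj_cnj by (auto simp: mero_rel_def)
qed

text \<open>\<open>mero f\<close> is the element represented by \<open>f\<close>; it is meaningful only when \<open>f\<close> is meromorphic
  on the plane.\<close>

definition mero :: "(complex \<Rightarrow> complex) \<Rightarrow> mero" where
  "mero f = abs_mero f"


section \<open>The free algebra on the generators\<close>

typedef cstar = "{z :: complex. z \<noteq> 0}"
  by (rule exI[of _ 1]) simp

datatype gen = Alpha cstar | Beta cstar | Gam cstar | Delta cstar | Detinv cstar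
  | Lam mero | Mu mero

datatype word = Word (letters: "gen list")

instantiation word :: monoid_add
begin
definition zero_word :: word where "0 = Word []"
definition plus_word :: "word \<Rightarrow> word \<Rightarrow> word" where "v + w = Word (letters v @ letters w)"
instance by standard (simp_all add: zero_word_def plus_word_def)
end

text \<open>The free unital complex algebra is the monoid algebra of the free monoid of words:
  multiplication of \<^type>\<open>poly_mapping\<close> is convolution with respect to concatenation.\<close>

type_synonym falg = "word \<Rightarrow>\<^sub>0 complex"

definition gen :: "gen \<Rightarrow> falg" where "gen g = Poly_Mapping.single (Word [g]) 1"

definition scalar :: "complex \<Rightarrow> falg" where "scalar c = Poly_Mapping.single 0 c"

text \<open>The spectral parameter of these generators is always a nonzero complex number;
  \<open>Abs_cstar 0\<close> is unspecified and never used.\<close>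

definition alpha :: "complex \<Rightarrow> falg" where "alpha z = gen (Alpha (Abs_cstar z))"
definition beta :: "complex \<Rightarrow> falg" where "beta z = gen (Beta (Abs_cstar z))"
definition gam :: "complex \<Rightarrow> falg" where "gam z = gen (Gam (Abs_cstar z))"
definition delta :: "complex \<Rightarrow> falg" where "delta z = gen (Delta (Abs_cstar z))"
definition detinv :: "complex \<Rightarrow> falg" where "detinv z = gen (Detinv (Abs_cstar z))"
definition lam :: "mero \<Rightarrow> falg" where "lam f = gen (Lam f)"
definition mu :: "mero \<Rightarrow> falg" where "mu f = gen (Mu f)"

fun bidegree :: "gen \<Rightarrow> int \<times> int" where
  "bidegree (Alpha _) = (1, 1)"
| "bidegree (Beta _) = (1, -1)"
| "bidegree (Gam _) = (-1, 1)"
| "bidegree (Delta _) = (-1, -1)"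
| "bidegree (Detinv _) = (0, 0)"
| "bidegree (Lam _) = (0, 0)"
| "bidegree (Mu _) = (0, 0)"


section \<open>Defining relations\<close>

text \<open>The functions $a,b,c,d$ have the common factor $\theta(q^2z)$ in the denominator, which is
  replaced by a parameter \<open>s\<close>: taking \<open>s = theta p (q\<^sup>2 * z)\<close> gives $a,b,c,d$ themselves, and
  \<open>s = 1\<close> gives $\theta(q^2z)a$ etc., as needed for the residual relations.\<close>

definition Ra :: "real \<Rightarrow> real \<Rightarrow> complex \<Rightarrow> complex \<Rightarrow> mero" where
  "Ra p q s z = mero (\<lambda>x. theta p z * theta p (qpow q (2 * (x + 2)))
                          / (s * theta p (qpow q (2 * (x + 1)))))"

definition Rb :: "real \<Rightarrow> real \<Rightarrow> complex \<Rightarrow> complex \<Rightarrow> mero" where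
  "Rb p q s z = mero (\<lambda>x. theta p (of_real q ^ 2) * theta p (qpow q (-2 * (x + 1)) * z)
                          / (s * theta p (qpow q (-2 * (x + 1)))))"

definition Rc :: "real \<Rightarrow> real \<Rightarrow> complex \<Rightarrow> complex \<Rightarrow> mero" where
  "Rc p q s z = mero (\<lambda>x. theta p (of_real q ^ 2) * theta p (qpow q (2 * (x + 1)) * z)
                          / (s * theta p (qpow q (2 * (x + 1)))))"

definition Rd :: "real \<Rightarrow> real \<Rightarrow> complex \<Rightarrow> complex \<Rightarrow> mero" where
  "Rd p q s z = mero (\<lambda>x. theta p z * theta p (qpow q (-2 * x))
                          / (s * theta p (qpow q (-2 * (x + 1)))))"

text \<open>A relation with coefficients $a,b,c,d$ is imposed as it stands if
  $\theta(q^2z_{12}) \neq 0$ (the first case, \<open>e = 1\<close>). Otherwise it is multiplied by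
  $\theta(q^2z_{12})$ before specializing, so that the terms having no such coefficient acquire the
  factor \<open>e = 0\<close>.\<close>

definition coeff_case :: "real \<Rightarrow> real \<Rightarrow> complex \<Rightarrow> complex \<Rightarrow> complex \<Rightarrow> bool" where
  "coeff_case p q z e s \<longleftrightarrow>
     (let t = theta p (of_real q ^ 2 * z) in
        t \<noteq> 0 \<and> e = 1 \<and> s = t \<or> t = 0 \<and> e = 0 \<and> s = 1)"

definition Fmero :: "real \<Rightarrow> real \<Rightarrow> mero" where
  "Fmero p q = mero (\<lambda>x. qpow q x * theta p (qpow q (-2 * (x + 1))))"

text \<open>The element $F(\mu)/F(\lambda)$.\<close>

definition Fquot :: "real \<Rightarrow> real \<Rightarrow> falg" where
  "Fquot p q = mu (Fmero p q) * lam (inverse (Fmero p q))"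

definition det_el :: "real \<Rightarrow> real \<Rightarrow> complex \<Rightarrow> falg" where
  "det_el p q z = Fquot p q *
     (alpha z * delta (of_real q ^ 2 * z) - gam z * beta (of_real q ^ 2 * z))"

text \<open>Pairs (left-hand side, right-hand side) of the defining relations of
  $\mathcal{F}_R(U(2))$: the relations of $\mathcal{F}_R(M(2))$ together with those making
  \<open>detinv z\<close> a central inverse of \<open>det_el p q z\<close>. The rules for \<open>lam\<close> and \<open>mu\<close> make them
  unital homomorphisms of complex algebras; \<open>lam_shift\<close> and \<open>mu_shift\<close>, applied to the letters of
  bidegree $(0,0)$, also say that the two copies of the function field commute.\<close>

inductive_set FR_eqs :: "real \<Rightarrow> real \<Rightarrow> (falg \<times> falg) set" for p q :: real where
  lam_add: "(lam (f + g), lam f + lam g) \<in> FR_eqs p q"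
| lam_mult: "(lam (f * g), lam f * lam g) \<in> FR_eqs p q"
| lam_const: "(lam (mero (\<lambda>_. c)), scalar c) \<in> FR_eqs p q"
| mu_add: "(mu (f + g), mu f + mu g) \<in> FR_eqs p q"
| mu_mult: "(mu (f * g), mu f * mu g) \<in> FR_eqs p q"
| mu_const: "(mu (mero (\<lambda>_. c)), scalar c) \<in> FR_eqs p q"
| lam_shift: "(lam f * gen x, gen x * lam (shift (of_int (fst (bidegree x))) f)) \<in> FR_eqs p q"
| mu_shift: "(mu f * gen x, gen x * mu (shift (of_int (snd (bidegree x))) f)) \<in> FR_eqs p q"
| same: "\<lbrakk>z1 \<noteq> 0; z2 \<noteq> 0; x \<in> {alpha, beta, gam, delta}\<rbrakk> \<Longrightarrow>
    (x z1 * x z2, x z2 * x z1) \<in> FR_eqs p q"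
| row1: "\<lbrakk>z1 \<noteq> 0; z2 \<noteq> 0; z = z1 / z2; coeff_case p q z e s; (x, y) \<in> {(alpha, beta), (gam, delta)}\<rbrakk> \<Longrightarrow>
    (scalar e * x z1 * y z2,
     mu (Ra p q s z) * y z2 * x z1 + mu (Rc p q s z) * x z2 * y z1) \<in> FR_eqs p q"
| row2: "\<lbrakk>z1 \<noteq> 0; z2 \<noteq> 0; z = z1 / z2; coeff_case p q z e s; (x, y) \<in> {(alpha, beta), (gam, delta)}\<rbrakk> \<Longrightarrow>
    (scalar e * y z1 * x z2,
     mu (Rb p q s z) * y z2 * x z1 + mu (Rd p q s z) * x z2 * y z1) \<in> FR_eqs p q"
| col1: "\<lbrakk>z1 \<noteq> 0; z2 \<noteq> 0; z = z1 / z2; coeff_case p q z e s; (x, y) \<in> {(alpha, gam), (beta, delta)}\<rbrakk> \<Longrightarrow>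
    (lam (Ra p q s z) * x z1 * y z2 + lam (Rb p q s z) * y z1 * x z2,
     scalar e * y z2 * x z1) \<in> FR_eqs p q"
| col2: "\<lbrakk>z1 \<noteq> 0; z2 \<noteq> 0; z = z1 / z2; coeff_case p q z e s; (x, y) \<in> {(alpha, gam), (beta, delta)}\<rbrakk> \<Longrightarrow>
    (lam (Rc p q s z) * x z1 * y z2 + lam (Rd p q s z) * y z1 * x z2,
     scalar e * x z2 * y z1) \<in> FR_eqs p q"
| mixed1: "\<lbrakk>z1 \<noteq> 0; z2 \<noteq> 0; z = z1 / z2; coeff_case p q z e s\<rbrakk> \<Longrightarrow>
    (lam (Ra p q s z) * alpha z1 * delta z2 + lam (Rb p q s z) * gam z1 * beta z2,
     mu (Ra p q s z) * delta z2 * alpha z1 + mu (Rc p q s z) * gam z2 * beta z1) \<in> FR_eqs p q"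
| mixed2: "\<lbrakk>z1 \<noteq> 0; z2 \<noteq> 0; z = z1 / z2; coeff_case p q z e s\<rbrakk> \<Longrightarrow>
    (lam (Rc p q s z) * alpha z1 * delta z2 + lam (Rd p q s z) * gam z1 * beta z2,
     mu (Ra p q s z) * beta z2 * gam z1 + mu (Rc p q s z) * alpha z2 * delta z1) \<in> FR_eqs p q"
| mixed3: "\<lbrakk>z1 \<noteq> 0; z2 \<noteq> 0; z = z1 / z2; coeff_case p q z e s\<rbrakk> \<Longrightarrow>
    (lam (Ra p q s z) * beta z1 * gam z2 + lam (Rb p q s z) * delta z1 * alpha z2,
     mu (Rb p q s z) * delta z2 * alpha z1 + mu (Rd p q s z) * gam z2 * beta z1) \<in> FR_eqs p q"
| mixed4: "\<lbrakk>z1 \<noteq> 0; z2 \<noteq> 0; z = z1 / z2; coeff_case p q z e s\<rbrakk> \<Longrightarrow>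
    (lam (Rc p q s z) * beta z1 * gam z2 + lam (Rd p q s z) * delta z1 * alpha z2,
     mu (Rb p q s z) * beta z2 * gam z1 + mu (Rd p q s z) * alpha z2 * delta z1) \<in> FR_eqs p q"
| detinv_central: "z \<noteq> 0 \<Longrightarrow> (detinv z * gen x, gen x * detinv z) \<in> FR_eqs p q"
| detinv_inverse: "z \<noteq> 0 \<Longrightarrow> (det_el p q z * detinv z, 1) \<in> FR_eqs p q"


section \<open>The algebra F_R(U(2)), its antipode and its *-structure\<close>

definition free_ring :: "falg ring" where
  "free_ring = \<lparr>carrier = UNIV, monoid.mult = (*), one = 1, zero = 0, add = (+)\<rparr>"

definition FR_ideal :: "real \<Rightarrow> real \<Rightarrow> falg set" where
  "FR_ideal p q = Idl\<^bsub>free_ring\<^esub> {x - y | x y. (x, y) \<in> FR_eqs p q}"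

definition FRU2 :: "real \<Rightarrow> real \<Rightarrow> falg set ring" where
  "FRU2 p q = free_ring Quot FR_ideal p q"

text \<open>The element of $\mathcal{F}_R(U(2))$ given by an expression in the generators.\<close>

definition cls :: "real \<Rightarrow> real \<Rightarrow> falg \<Rightarrow> falg set" where
  "cls p q x = FR_ideal p q +>\<^bsub>free_ring\<^esub> x"

text \<open>The antipode and the *-structure are determined uniquely by the following properties, since
  they prescribe the values on all generators. Complex scalars are the classes of \<open>scalar c\<close>.\<close>

definition is_antipode :: "real \<Rightarrow> real \<Rightarrow> (falg set \<Rightarrow> falg set) \<Rightarrow> bool" where
  "is_antipode p q S \<longleftrightarrow>
     S \<in> carrier (FRU2 p q) \<rightarrow> carrier (FRU2 p q) \<and>
     (\<forall>x\<in>carrier (FRU2 p q). \<forall>y\<in>carrier (FRU2 p q).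
        S (x \<oplus>\<^bsub>FRU2 p q\<^esub> y) = S x \<oplus>\<^bsub>FRU2 p q\<^esub> S y \<and>
        S (x \<otimes>\<^bsub>FRU2 p q\<^esub> y) = S y \<otimes>\<^bsub>FRU2 p q\<^esub> S x) \<and>
     S \<one>\<^bsub>FRU2 p q\<^esub> = \<one>\<^bsub>FRU2 p q\<^esub> \<and>
     (\<forall>c. \<forall>x\<in>carrier (FRU2 p q).
        S (cls p q (scalar c) \<otimes>\<^bsub>FRU2 p q\<^esub> x) = cls p q (scalar c) \<otimes>\<^bsub>FRU2 p q\<^esub> S x) \<and>
     (\<forall>f. S (cls p q (lam f)) = cls p q (mu f) \<and> S (cls p q (mu f)) = cls p q (lam f)) \<and>
     (\<forall>z. z \<noteq> 0 \<longrightarrow> (let w = of_real q powi (-2) * z in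
        S (cls p q (detinv z)) = cls p q (det_el p q z) \<and>
        S (cls p q (alpha z)) = cls p q (Fquot p q * detinv w * delta w) \<and>
        S (cls p q (beta z)) = cls p q (- (Fquot p q * detinv w * beta w)) \<and>
        S (cls p q (gam z)) = cls p q (- (Fquot p q * detinv w * gam w)) \<and>
        S (cls p q (delta z)) = cls p q (Fquot p q * detinv w * alpha w)))"

definition is_star :: "real \<Rightarrow> real \<Rightarrow> (falg set \<Rightarrow> falg set) \<Rightarrow> bool" where
  "is_star p q star \<longleftrightarrow>
     star \<in> carrier (FRU2 p q) \<rightarrow> carrier (FRU2 p q) \<and>
     (\<forall>x\<in>carrier (FRU2 p q). \<forall>y\<in>carrier (FRU2 p q).
        star (x \<oplus>\<^bsub>FRU2 p q\<^esub> y) = star x \<oplus>\<^bsub>FRU2 p q\<^esub> star y \<and>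
        star (x \<otimes>\<^bsub>FRU2 p q\<^esub> y) = star y \<otimes>\<^bsub>FRU2 p q\<^esub> star x) \<and>
     (\<forall>c. \<forall>x\<in>carrier (FRU2 p q).
        star (cls p q (scalar c) \<otimes>\<^bsub>FRU2 p q\<^esub> x) = cls p q (scalar (cnj c)) \<otimes>\<^bsub>FRU2 p q\<^esub> star x) \<and>
     (\<forall>x\<in>carrier (FRU2 p q). star (star x) = x) \<and>
     (\<forall>f. star (cls p q (lam f)) = cls p q (lam (mero_bar f)) \<and>
          star (cls p q (mu f)) = cls p q (mu (mero_bar f))) \<and>
     (\<forall>z. z \<noteq> 0 \<longrightarrow>
        star (cls p q (alpha z)) = cls p q (delta (1 / cnj z)) \<and>
        star (cls p q (beta z)) = cls p q (- gam (1 / cnj z)) \<and>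
        star (cls p q (gam z)) = cls p q (- beta (1 / cnj z)) \<and>
        star (cls p q (delta z)) = cls p q (alpha (1 / cnj z)) \<and>
        star (cls p q (detinv z)) = cls p q (detinv (of_real q powi (-2) / cnj z)))"


section \<open>Matrix elements\<close>

text \<open>The string \<open>x(q\<^sup>2\<^sup>m z) x(q\<^sup>2\<^sup>m\<^sup>-\<^sup>2 z) \<dots>\<close> with \<open>n\<close> factors, from left to right.\<close>

definition gstring :: "real \<Rightarrow> (complex \<Rightarrow> falg) \<Rightarrow> int \<Rightarrow> complex \<Rightarrow> nat \<Rightarrow> falg" where
  "gstring q x m z n = prod_list (map (\<lambda>i. x (of_real q powi (2 * (m - int i)) * z)) [0..<n])"

definition t_coeff :: "real \<Rightarrow> real \<Rightarrow> nat \<Rightarrow> nat \<Rightarrow> nat \<Rightarrow> nat \<Rightarrow> mero" where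
  "t_coeff p q N k j l = (let n = of_nat N; k' = of_nat k; j' = of_nat j; l' = of_nat l in
     mero (\<lambda>x. ebinom p q k l * ebinom p q (N - k) (j - l)
        * (epoch p q (qpow q (2 * (x + n - k' - 2 * j' + l' + 2))) l
           / epoch p q (qpow q (2 * (x + n - 2 * j' + 2))) l)
        * (epoch p q (qpow q (2 * (x + l' - j' + 2))) (j - l)
           / epoch p q (qpow q (2 * (x + n - 2 * j' - k' + 2 * l' + 2))) (j - l))))"

text \<open>For \<open>k, j \<le> N\<close> the truncated subtraction in the summation range gives
  $\max(0, k+j-N)$, and no other subtraction on \<^typ>\<open>nat\<close> below is truncated.\<close>

definition t_el :: "real \<Rightarrow> real \<Rightarrow> nat \<Rightarrow> nat \<Rightarrow> nat \<Rightarrow> complex \<Rightarrow> falg" where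
  "t_el p q N k j z = (\<Sum>l = k + j - N..min k j.
     mu (t_coeff p q N k j l)
     * gstring q gam (int N - int k - 1) z (j - l)
     * gstring q delta (int N - int j - int k + int l - 1) z (N + l - k - j)
     * gstring q alpha (int N - 1) z l
     * gstring q beta (int N - int l - 1) z (k - l))"

definition Gamma_coeff :: "real \<Rightarrow> real \<Rightarrow> nat \<Rightarrow> nat \<Rightarrow> mero" where
  "Gamma_coeff p q N k = (let n = of_nat N; k' = of_nat k in
     mero (\<lambda>x. ebinom p q N k
        * (epoch p q (qpow q (2 * (x - k' + 2))) k
           / epoch p q (qpow q (2 * (x + n - 2 * k' + 2))) k)
        * (\<Prod>i<N - k. qpow q (- (x + n - 2 * k' - of_nat i))
             / theta p (qpow q (-2 * (x + n - 2 * k' - of_nat i + 1))))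
        * (\<Prod>i<k. qpow q (- (x - k' + of_nat i))
             / theta p (qpow q (-2 * (x - k' + of_nat i + 1))))))"

end

theory Submission
  imports Defs
begin

text \<open>
  The identity says that the corepresentation with matrix elements $t^N_{kj}$ is unitary with respect
  to the weights $\Gamma_k$. It holds because both sides are the same element, fused in two ways.

  Write $[x] = q^{-x}\theta(q^{2x})$, an odd entire function. At $z_1/z_2 = q^{2u}$ the coefficients
  of the exchange relations are
  $a = [u][\lambda+2]$, $b = [1][\lambda+1-u]$, $c = [1][\lambda+1+u]$, $d = [u][\lambda]$, each
  divided by $[u+1][\lambda+1]$, and $F(\mu)/F(\lambda) = [\mu+1]/[\lambda+1]$: all powers of $q$ have
  disappeared. Let $L_{ab}(z)$, with signs $a,b$, be the entries of the matrix with rows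
  $(\alpha,\beta)$ and $(\gamma,\delta)$. For a word $A$ of row signs consider the fused product
  \[ \sum_b L_{A_0 b_0}(w)\, L_{A_1 b_1}(q^2 w)\, L_{A_2 b_2}(q^4 w) \cdots, \]
  the sum over all words $b$ of the same length with $k$ plus signs. No coefficients are needed,
  and because of the relations at $u = 1$ the result depends on $A$ only through its number of plus
  signs (\<open>fused_swap\<close>). If $A$ is constant, the sum is a single ordered monomial times a
  quotient of brackets in $\mu$ (\<open>row_products\<close>). Splitting $A$ into its block of minus
  signs and its block of plus signs therefore produces the sum that defines $t^N_{kj}$
  (\<open>t_el_fused\<close>).

  The map $\phi = {*} \circ S$ is multiplicative. With $w = q^{-2(N-2)}/\overline z$ it sends
  $L_{ab}(q^{2i}z)$ to $L_{ba}(q^{2(N-1-i)}w)\,\frac{[\mu+1]}{[\lambda+1]}\det^{-1}(q^{-2i}/\overline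
  z)$ (\<open>\<phi>_rel_matgen\<close>). So $\phi(t^N_{kj}(\mu,z))$ is a fused product as well, but of
  the transposed matrix and with the exponents of $q$ decreasing from left to right. It has to be
  compared with $t^N_{jk}(\mu,w)$, in which they increase (\<open>fused_transpose\<close>). This is an
  induction on $N$. Splitting off the first factor of the transposed product leaves terms
  $L_{ab}(q^{2(N-1)}w)\,T_a$, where $T_a$ is a fused product of length $N-1$ with increasing exponents.
  By \<open>fused_exchange\<close> the factor on the left can be absorbed: summed over $a$ with suitable
  weights in $\lambda$, these terms give a function of $\mu$ times a fused product of length $N$ with
  increasing exponents. The weights needed are precisely the quotients of the $\Gamma$ for $N$ and $N-1$
  (\<open>T_gram_True\<close>, \<open>T_gram_False\<close>), so that a function of $\lambda$ and a
  function of $\mu$ split off at each step and accumulate to $\Gamma_j(\lambda)/\Gamma_k(\mu)$.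

  \<open>fused_exchange\<close> itself is an induction on the length which moves the absorbed factor past
  one generator at a time. All identities between its coefficients are instances of Weierstrass'
  addition formula (\<open>bracket_addition\<close>), which follows from Liouville's theorem.

  The algebra is a quotient that depends on $p$ and $q$. In order to compute with equations in a
  type, the computations take place in the product of the algebras over all pairs $(p,q)$, in which a
  central idempotent selects the component of interest.
\<close>

section \<open>Theta functions and Weierstrass' identity\<close>

locale nome =
  fixes p :: real
  assumes p_pos: "0 < p" and p_less: "p < 1"
begin

definition qpoch :: "complex \<Rightarrow> complex" where
  "qpoch z = prodinf (\<lambda>j. 1 - z * of_real p ^ j)"

lemma summable_factors: "summable (\<lambda>j. norm (z * of_real p ^ j :: complex))"
  using p_pos p_less by (simp add: norm_mult norm_power summable_mult)

lemma convergent_factors: "convergent_prod (\<lambda>j. 1 - z * of_real p ^ j :: complex)"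
  using summable_factors[of z]
  by (intro abs_convergent_prod_imp_convergent_prod) (simp add: abs_convergent_prod_conv_summable)

lemma qpoch_split: "qpoch z = (1 - z) * qpoch (of_real p * z)"
proof -
  have "(\<lambda>j. 1 - z * of_real p ^ j) has_prod
      ((\<Prod>j<1. 1 - z * of_real p ^ j) * prodinf (\<lambda>j. 1 - z * of_real p ^ (j + 1)))"
    by (rule has_prod_ignore_initial_segment'[OF convergent_factors])
  then show ?thesis
    unfolding qpoch_def by (simp add: has_prod_iff mult_ac)
qed

lemma qpoch_eq_0_iff: "qpoch z = 0 \<longleftrightarrow> (\<exists>j. z * of_real p ^ j = 1)"
  unfolding qpoch_def
  using has_prod_eq_0_iff[OF convergent_prod_has_prod[OF convergent_factors[of z]]] by auto

lemma holomorphic_qpoch: "qpoch holomorphic_on UNIV"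
proof (rule holomorphic_uniform_sequence[where f = "\<lambda>n z. \<Prod>j<n. 1 - z * of_real p ^ j"])
  fix x :: complex
  define R where "R = norm x + 1"
  have "uniformly_convergent_on (cball x 1) (\<lambda>n z. \<Prod>j<n. 1 - z * of_real p ^ j)"
  proof (rule uniformly_convergent_on_prod')
    show "uniformly_convergent_on (cball x 1) (\<lambda>N z. \<Sum>n<N. norm (1 - z * of_real p ^ n - 1))"
    proof (rule Weierstrass_m_test')
      show "summable (\<lambda>n. R * p ^ n)"
        using p_pos p_less by (intro summable_mult summable_geometric) auto
      fix n :: nat and z assume "z \<in> cball x 1"
      then have "norm z \<le> R"
        unfolding R_def using norm_triangle_ineq2[of z x] by (simp add: dist_norm norm_minus_commute)
      then show "norm (norm (1 - z * of_real p ^ n - 1)) \<le> R * p ^ n"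
        using p_pos by (simp add: norm_mult norm_power mult_right_mono)
    qed
  qed (auto intro!: continuous_intros)
  then obtain l where l: "uniform_limit (cball x 1) (\<lambda>n z. \<Prod>j<n. 1 - z * of_real p ^ j) l sequentially"
    by (auto simp: uniformly_convergent_on_def)
  have "l z = qpoch z" if "z \<in> cball x 1" for z
  proof -
    have "(\<lambda>n. \<Prod>j<n. 1 - z * of_real p ^ j) \<longlonglongrightarrow> l z"
      using l that by (rule tendsto_uniform_limitI)
    moreover have "(\<lambda>n. \<Prod>j\<le>n. 1 - z * of_real p ^ j) \<longlonglongrightarrow> qpoch z"
      unfolding qpoch_def by (rule convergent_prod_LIMSEQ[OF convergent_factors])
    then have "(\<lambda>n. \<Prod>j<Suc n. 1 - z * of_real p ^ j) \<longlonglongrightarrow> qpoch z"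
      by (simp only: lessThan_Suc_atMost)
    then have "(\<lambda>n. \<Prod>j<n. 1 - z * of_real p ^ j) \<longlonglongrightarrow> qpoch z"
      by (rule LIMSEQ_imp_Suc)
    ultimately show ?thesis by (rule LIMSEQ_unique)
  qed
  then have "uniform_limit (cball x 1) (\<lambda>n z. \<Prod>j<n. 1 - z * of_real p ^ j) qpoch sequentially"
    using l by (subst (asm) uniform_limit_cong'[where g = "\<lambda>n z. \<Prod>j<n. 1 - z * of_real p ^ j" and i = qpoch]) auto
  then show "\<exists>d>0. cball x d \<subseteq> UNIV \<and> uniform_limit (cball x d) (\<lambda>n z. \<Prod>j<n. 1 - z * of_real p ^ j) qpoch sequentially"
    by (intro exI[of _ 1]) auto
qed (auto intro!: holomorphic_intros)

lemma theta_qpoch: "theta p z = qpoch z * qpoch (of_real p / z)"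
proof -
  have "(\<lambda>j. 1 - of_real p ^ Suc j / z) = (\<lambda>j. 1 - of_real p / z * of_real p ^ j)"
    by (auto simp: field_simps)
  then show ?thesis
    unfolding theta_def qpoch_def
    using prodinf_mult[OF convergent_factors[of z] convergent_factors[of "of_real p / z"]] by metis
qed

lemma theta_p_mult:
  assumes "z \<noteq> 0"
  shows "theta p (of_real p * z) = - theta p z / z"
proof -
  have "theta p (of_real p * z) = qpoch (of_real p * z) * qpoch (1 / z)"
    using p_pos by (simp add: theta_qpoch)
  also have "qpoch (1 / z) = (1 - 1 / z) * qpoch (of_real p / z)"
    by (subst qpoch_split) simp
  finally have "theta p (of_real p * z) = (1 - 1 / z) * (qpoch (of_real p * z) * qpoch (of_real p / z))"
    by simp
  moreover have "theta p z = (1 - z) * (qpoch (of_real p * z) * qpoch (of_real p / z))"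
    unfolding theta_qpoch by (subst qpoch_split) simp
  ultimately show ?thesis using assms by (simp only:) (simp add: field_simps)
qed

lemma theta_inverse:
  assumes "z \<noteq> 0"
  shows "theta p (1 / z) = - theta p z / z"
proof -
  have "theta p (1 / z) = (1 - 1 / z) * (qpoch (of_real p / z) * qpoch (of_real p * z))"
    unfolding theta_qpoch by (subst qpoch_split) simp
  moreover have "theta p z = (1 - z) * (qpoch (of_real p * z) * qpoch (of_real p / z))"
    unfolding theta_qpoch by (subst qpoch_split) simp
  ultimately show ?thesis using assms by (simp only:) (simp add: field_simps)
qed

lemma theta_eq_0_iff:
  assumes "z \<noteq> 0"
  shows "theta p z = 0 \<longleftrightarrow> (\<exists>m::int. z = of_real p powi m)"
proof
  assume "theta p z = 0"
  then consider j where "z * of_real p ^ j = 1" | j where "of_real p / z * of_real p ^ j = 1"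
    by (auto simp: theta_qpoch qpoch_eq_0_iff)
  then show "\<exists>m::int. z = of_real p powi m"
  proof cases
    case 1
    then have "z = of_real p powi (- int j)"
      using p_pos by (simp add: power_int_minus field_simps)
    then show ?thesis ..
  next
    case 2
    then have "z = of_real p powi (int (Suc j))"
      using assms by (simp add: field_simps del: of_nat_Suc)
    then show ?thesis ..
  qed
next
  assume "\<exists>m::int. z = of_real p powi m"
  then obtain m :: int where m: "z = of_real p powi m" by blast
  show "theta p z = 0"
  proof (cases "m \<le> 0")
    case True
    then have "z * of_real p ^ nat (- m) = 1"
      using p_pos unfolding m by (simp add: power_int_def field_simps)
    then show ?thesis by (auto simp: theta_qpoch qpoch_eq_0_iff)
  next
    case False
    then have "of_real p / z * of_real p ^ nat (m - 1) = 1"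
      using p_pos unfolding m
      by (simp add: power_int_def Suc_nat_eq_nat_zadd1 flip: power_Suc)
    then show ?thesis by (auto simp: theta_qpoch qpoch_eq_0_iff)
  qed
qed

lemma holomorphic_theta: "theta p holomorphic_on - {0}"
proof -
  have "(\<lambda>z. qpoch z * qpoch (of_real p / z)) holomorphic_on - {0}"
    by (intro holomorphic_intros holomorphic_on_compose_gen[of "\<lambda>z. of_real p / z" _ qpoch UNIV, unfolded o_def]
        holomorphic_on_subset[OF holomorphic_qpoch] holomorphic_qpoch) auto
  then show ?thesis by (simp only: theta_qpoch[abs_def])
qed

lemma theta_compose [holomorphic_intros]:
  assumes "f holomorphic_on A" "\<And>z. z \<in> A \<Longrightarrow> f z \<noteq> 0"
  shows "(\<lambda>z. theta p (f z)) holomorphic_on A"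
  using holomorphic_on_compose_gen[OF assms(1) holomorphic_theta] assms(2) by (force simp: o_def)

lemma theta_has_derivative:
  assumes "z \<noteq> 0"
  shows "(theta p has_field_derivative deriv (theta p) z) (at z)"
  using holomorphic_derivI[OF holomorphic_theta, of z] assms by auto

lemma theta_deriv_p_mult:
  assumes "z \<noteq> 0" "theta p z = 0"
  shows "deriv (theta p) (of_real p * z) = - deriv (theta p) z / (of_real p * z)"
proof -
  have "((\<lambda>z. theta p (of_real p * z)) has_field_derivative deriv (theta p) (of_real p * z) * of_real p) (at z)"
    using p_pos assms by (auto intro!: derivative_eq_intros DERIV_chain2[OF theta_has_derivative])
  moreover have "((\<lambda>z. theta p (of_real p * z)) has_field_derivative - deriv (theta p) z / z) (at z)"
  proof (rule has_field_derivative_transform_within_open[where S = "- {0}"])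
    show "((\<lambda>z. - theta p z / z) has_field_derivative - deriv (theta p) z / z) (at z)"
      using assms by (auto intro!: derivative_eq_intros theta_has_derivative simp: field_simps)
  qed (use assms in \<open>auto simp: theta_p_mult\<close>)
  ultimately have "deriv (theta p) (of_real p * z) * of_real p = - deriv (theta p) z / z"
    by (rule DERIV_unique)
  then have "deriv (theta p) (of_real p * z) = - deriv (theta p) z / z / of_real p"
    using p_pos by (subst eq_divide_eq) auto
  then show ?thesis by (simp add: mult.commute)
qed

lemma theta_deriv_1: "deriv (theta p) 1 \<noteq> 0"
proof -
  define \<eta> where "\<eta> = (\<lambda>z. qpoch (of_real p * z) * qpoch (of_real p / z))"
  have "\<eta> holomorphic_on - {0}"
    unfolding \<eta>_def
    by (intro holomorphic_intros holomorphic_on_compose_gen[of "\<lambda>z. of_real p / z" _ qpoch UNIV, unfolded o_def]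
        holomorphic_on_compose_gen[of "\<lambda>z. of_real p * z" _ qpoch UNIV, unfolded o_def]
        holomorphic_on_subset[OF holomorphic_qpoch] holomorphic_qpoch) auto
  then have "(\<eta> has_field_derivative deriv \<eta> 1) (at 1)"
    by (rule holomorphic_derivI) auto
  then have "((\<lambda>z. (1 - z) * \<eta> z) has_field_derivative - \<eta> 1) (at 1)"
    by (auto intro!: derivative_eq_intros)
  moreover have "theta p = (\<lambda>z. (1 - z) * \<eta> z)"
  proof
    fix z
    show "theta p z = (1 - z) * \<eta> z"
      unfolding theta_qpoch \<eta>_def by (subst qpoch_split) simp
  qed
  ultimately have "deriv (theta p) 1 = - \<eta> 1"
    by (simp add: DERIV_imp_deriv)
  moreover have "qpoch (of_real p) \<noteq> 0"
  proof
    assume "qpoch (of_real p) = 0"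
    then obtain j where "of_real (p * p ^ j) = (1 :: complex)"
      by (auto simp: qpoch_eq_0_iff)
    then have "p ^ Suc j = 1" by (simp only: of_real_eq_1_iff power_Suc)
    moreover have "p ^ Suc j < 1" using p_pos p_less by (intro power_Suc_less_one) auto
    ultimately show False by simp
  qed
  ultimately show ?thesis by (simp add: \<eta>_def)
qed

text \<open>
  The zeros of $\theta$ are the powers of $p$. The zero at $1$ is simple, and the functional equation
  $\theta(pz) = -\theta(z)/z$ carries this to all others.
\<close>
lemma theta_deriv_nonzero:
  assumes "z \<noteq> 0" "theta p z = 0"
  shows "deriv (theta p) z \<noteq> 0"
proof -
  have zero: "theta p (of_real p powi m) = 0" for m :: int
    using p_pos by (subst theta_eq_0_iff) auto
  have step: "deriv (theta p) (of_real p powi (m + 1)) = 0 \<longleftrightarrow> deriv (theta p) (of_real p powi m) = 0" for m :: int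
    using theta_deriv_p_mult[OF _ zero[of m]] p_pos by (simp add: power_int_add mult.commute)
  have "deriv (theta p) (of_real p powi m) \<noteq> 0" for m :: int
  proof (induction m rule: int_induct[where k = 0])
    case base
    then show ?case using theta_deriv_1 by simp
  next
    case (step1 i)
    then show ?case using step[of i] by simp
  next
    case (step2 i)
    then show ?case using step[of "i - 1"] by simp
  qed
  then show ?thesis using assms by (auto simp: theta_eq_0_iff)
qed

text \<open>
  Every nonzero number can be scaled by a power of $p$ into the compact annulus $p \le |z| \le 1$.
\<close>
lemma bounded_annulus:
  assumes "continuous_on (- {0}) r" "\<And>z. z \<noteq> 0 \<Longrightarrow> r (of_real p * z) = r z"
  shows "bounded (r ` (- {0 :: complex}))"
proof -
  define A where "A = {z :: complex. p \<le> norm z \<and> norm z \<le> 1}"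
  have "compact A"
  proof -
    have "A = cball 0 1 - ball 0 p" by (auto simp: A_def)
    then show ?thesis by (simp add: compact_diff)
  qed
  moreover have "continuous_on A r"
    using p_pos by (intro continuous_on_subset[OF assms(1)]) (auto simp: A_def)
  ultimately have "bounded (r ` A)"
    by (intro compact_imp_bounded compact_continuous_image)
  moreover have "r ` (- {0}) \<subseteq> r ` A"
  proof (rule image_subsetI)
    fix z :: complex assume "z \<in> - {0}"
    then have z: "z \<noteq> 0" by simp
    have shift: "r (of_real p powi m * z) = r z" for m :: int
    proof (induction m rule: int_induct[where k = 0])
      case (step1 i)
      have "of_real p powi (i + 1) * z = of_real p * (of_real p powi i * z)"
        using p_pos by (simp add: power_int_add)
      moreover have "r (of_real p * (of_real p powi i * z)) = r (of_real p powi i * z)"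
        using assms(2)[of "of_real p powi i * z"] p_pos z by simp
      ultimately show ?case using step1 by metis
    next
      case (step2 i)
      have "of_real p powi i * z = of_real p * (of_real p powi (i - 1) * z)"
        using p_pos by (simp add: power_int_diff)
      moreover have "r (of_real p * (of_real p powi (i - 1) * z)) = r (of_real p powi (i - 1) * z)"
        using assms(2)[of "of_real p powi (i - 1) * z"] p_pos z by simp
      ultimately show ?case using step2 by metis
    qed simp
    \<comment> \<open>The exponent for which $|p^m z|$ lies in $(p, 1]$; the logarithm of \<open>p\<close> is negative.\<close>
    define m where "m = \<lceil>- ln (norm z) / ln p\<rceil>"
    have lp: "ln p < 0" using p_pos p_less by simp
    have "- ln (norm z) / ln p \<le> of_int m" "of_int m < - ln (norm z) / ln p + 1"
      unfolding m_def by linarith+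
    then have "of_int m * ln p \<le> - ln (norm z)" "of_int m * ln p > - ln (norm z) + ln p"
      using lp by (simp_all add: field_simps)
    then have "ln p < of_int m * ln p + ln (norm z)" "of_int m * ln p + ln (norm z) \<le> 0" by simp_all
    moreover have "norm (of_real p powi m * z) = exp (of_int m * ln p + ln (norm z))"
    proof -
      have "p powi m = p powr of_int m"
        using p_pos powr_real_of_int'[of p m] by simp
      then show ?thesis
        using p_pos z by (simp add: norm_mult norm_power_int exp_add powr_def)
    qed
    moreover have "p = exp (ln p)" using p_pos by simp
    ultimately have "of_real p powi m * z \<in> A"
      unfolding A_def by (metis (mono_tags, lifting) exp_le_cancel_iff exp_zero less_imp_le mem_Collect_eq)
    then show "r z \<in> r ` A" using shift[of m] by (metis imageI)
  qed
  ultimately show ?thesis by (rule bounded_subset)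
qed

text \<open>
  A holomorphic function on the torus $\mathbb{C}^*/p^{\mathbb{Z}}$ is constant: composed with the
  exponential function it becomes bounded and entire.
\<close>
lemma multiplicative_Liouville:
  assumes "r holomorphic_on - {0}" "\<And>z. z \<noteq> 0 \<Longrightarrow> r (of_real p * z) = r z"
  shows "\<exists>K. \<forall>z. z \<noteq> 0 \<longrightarrow> r z = K"
proof -
  have "(\<lambda>t. r (exp t)) holomorphic_on UNIV"
    by (rule holomorphic_on_compose_gen[OF holomorphic_on_exp assms(1), unfolded o_def]) auto
  moreover have "bounded (range (\<lambda>t. r (exp t)))"
    by (rule bounded_subset[OF bounded_annulus[OF holomorphic_on_imp_continuous_on[OF assms(1)] assms(2)]]) auto
  ultimately have "(\<lambda>t. r (exp t)) constant_on UNIV"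
    by (rule Liouville_theorem)
  then obtain K where "\<And>t. r (exp t) = K" by (auto simp: constant_on_def)
  then have "r z = K" if "z \<noteq> 0" for z
    using that by (metis exp_Ln)
  then show ?thesis by blast
qed

text \<open>
  Two sections of the same line bundle on the torus are proportional if the zeros of one are simple
  and are zeros of the other: the quotient has removable singularities only.
\<close>
lemma proportional_of_simple_zeros:
  assumes g: "g holomorphic_on - {0}" and h: "h holomorphic_on - {0}"
    and gp: "\<And>z. z \<noteq> 0 \<Longrightarrow> g (of_real p * z) = e z * g z"
    and hp: "\<And>z. z \<noteq> 0 \<Longrightarrow> h (of_real p * z) = e z * h z"
    and e: "\<And>z. z \<noteq> 0 \<Longrightarrow> e z \<noteq> 0"
    and zeros: "\<And>z. z \<noteq> 0 \<Longrightarrow> g z = 0 \<Longrightarrow> h z = 0 \<and> deriv g z \<noteq> 0"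
  shows "\<exists>K. \<forall>z. z \<noteq> 0 \<longrightarrow> h z = K * g z"
proof -
  \<comment> \<open>The quotient, continued to the zeros of \<open>g\<close> by the rule of de l'Hopital.\<close>
  define r where "r = (\<lambda>z. if g z = 0 then deriv h z / deriv g z else h z / g z)"
  have dg: "(g has_field_derivative deriv g z) (at z)" if "z \<noteq> 0" for z
    using that by (intro holomorphic_derivI[OF g]) auto
  have dh: "(h has_field_derivative deriv h z) (at z)" if "z \<noteq> 0" for z
    using that by (intro holomorphic_derivI[OF h]) auto
  have nz: "\<exists>\<delta>>0. \<forall>w\<in>ball z \<delta> - {z}. g w \<noteq> 0 \<and> w \<noteq> 0" if z: "z \<noteq> 0" for z
  proof -
    have "eventually (\<lambda>w. g w \<noteq> 0) (at z)"
    proof (cases "g z = 0")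
      case True
      have "((\<lambda>w. (g w - g z) / (w - z)) \<longlongrightarrow> deriv g z) (at z)"
        using dg[OF z] by (simp add: has_field_derivative_iff)
      then have "eventually (\<lambda>w. (g w - g z) / (w - z) \<noteq> 0) (at z)"
        using zeros[OF z True] by (intro tendsto_imp_eventually_ne) auto
      then show ?thesis by eventually_elim (use True in auto)
    next
      case False
      have "isCont g z" using dg[OF z] by (rule DERIV_isCont)
      then show ?thesis using False by (intro tendsto_imp_eventually_ne) (auto simp: isCont_def)
    qed
    moreover have "eventually (\<lambda>w. w \<noteq> 0) (at z)"
      using z by (intro tendsto_imp_eventually_ne[OF tendsto_ident_at])
    ultimately have "eventually (\<lambda>w. g w \<noteq> 0 \<and> w \<noteq> 0) (at z)" by eventually_elim auto
    then obtain \<delta> where "\<delta> > 0" "\<forall>w. w \<noteq> z \<and> dist w z < \<delta> \<longrightarrow> g w \<noteq> 0 \<and> w \<noteq> 0"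
      by (auto simp: eventually_at)
    then show ?thesis by (intro exI[of _ \<delta>]) (auto simp: dist_commute)
  qed
  have lim: "(r \<longlongrightarrow> r z) (at z)" if z: "z \<noteq> 0" for z
  proof -
    obtain \<delta> where \<delta>: "\<delta> > 0" "\<forall>w\<in>ball z \<delta> - {z}. g w \<noteq> 0 \<and> w \<noteq> 0" using nz[OF z] by blast
    have "((\<lambda>w. h w / g w) \<longlongrightarrow> r z) (at z)"
    proof (cases "g z = 0")
      case True
      then show ?thesis using zeros[OF z True] unfolding r_def
        by (intro lhopital_complex_simple[OF dh[OF z] dg[OF z]]) auto
    next
      case False
      have "isCont g z" "isCont h z" using dg[OF z] dh[OF z] DERIV_isCont by blast+
      then show ?thesis using False unfolding r_def isCont_def by (auto intro!: tendsto_intros)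
    qed
    moreover have "eventually (\<lambda>w. h w / g w = r w) (at z)"
      using \<delta> by (auto simp: eventually_at r_def dist_commute intro!: exI[of _ \<delta>])
    ultimately show ?thesis by (rule Lim_transform_eventually)
  qed
  have "r holomorphic_on - {0}"
  proof -
    have "r field_differentiable at z" if z: "z \<noteq> 0" for z
    proof -
      obtain \<delta> where \<delta>: "\<delta> > 0" "\<forall>w\<in>ball z \<delta> - {z}. g w \<noteq> 0 \<and> w \<noteq> 0" using nz[OF z] by blast
      have "r holomorphic_on ball z \<delta>"
      proof (rule no_isolated_singularity'[where K = "{z}"])
        have "(\<lambda>w. h w / g w) holomorphic_on ball z \<delta> - {z}"
          using \<delta> by (intro holomorphic_intros holomorphic_on_subset[OF h] holomorphic_on_subset[OF g]) auto
        then show "r holomorphic_on ball z \<delta> - {z}"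
          by (rule holomorphic_transform) (use \<delta> in \<open>auto simp: r_def\<close>)
        show "(r \<longlongrightarrow> r w) (at w within ball z \<delta>)" if "w \<in> {z}" for w
          using lim[OF z] that by (auto intro: tendsto_within_subset)
      qed auto
      then show ?thesis using \<delta> by (auto simp: holomorphic_on_def at_within_open[OF _ open_ball])
    qed
    then show ?thesis by (auto simp: holomorphic_on_def intro: field_differentiable_at_within)
  qed
  moreover have "r (of_real p * z) = r z" if z: "z \<noteq> 0" for z
  proof -
    obtain \<delta> where \<delta>: "\<delta> > 0" "\<forall>w\<in>ball z \<delta> - {z}. g w \<noteq> 0 \<and> w \<noteq> 0" using nz[OF z] by blast
    have pz: "of_real p * z \<noteq> 0" using z p_pos by simp
    have "eventually (\<lambda>w. r w = r (of_real p * w)) (at z)"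
      using \<delta> e gp hp by (auto simp: eventually_at r_def dist_commute intro!: exI[of _ \<delta>])
    with lim[OF z] have lim1: "((\<lambda>w. r (of_real p * w)) \<longlongrightarrow> r z) (at z)"
      by (rule Lim_transform_eventually)
    moreover have "isCont r (of_real p * z)" using lim[OF pz] by (simp add: isCont_def)
    then have "isCont (\<lambda>w. r (of_real p * w)) z"
      by (intro continuous_at_compose[of z "\<lambda>w. of_real p * w" r, unfolded o_def] continuous_intros)
    then have "((\<lambda>w. r (of_real p * w)) \<longlongrightarrow> r (of_real p * z)) (at z)" by (simp add: isCont_def)
    ultimately show ?thesis by (intro tendsto_unique[OF _ _ lim1]) auto
  qed
  ultimately obtain K where K: "\<And>z. z \<noteq> 0 \<Longrightarrow> r z = K"
    using multiplicative_Liouville[of r] by blast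
  have "h z = K * g z" if "z \<noteq> 0" for z
    using K[OF that] zeros[OF that] by (auto simp: r_def split: if_splits)
  then show ?thesis by blast
qed

text \<open>
  As a function of \<open>x\<close> this spans, for varying \<open>a\<close>, the two-dimensional space of holomorphic
  functions with $f(px) = x^{-2}f(x)$ and $f(1/x) = x^{-2}f(x)$, in which the addition formula is a
  linear relation.
\<close>
definition theta2 :: "complex \<Rightarrow> complex \<Rightarrow> complex" where
  "theta2 a x = theta p (x * a) * theta p (x / a)"

lemma theta2_p_mult:
  assumes "a \<noteq> 0" "x \<noteq> 0"
  shows "theta2 a (of_real p * x) = 1 / x\<^sup>2 * theta2 a x"
proof -
  have "theta p (of_real p * (x * a)) = - theta p (x * a) / (x * a)"
    "theta p (of_real p * (x / a)) = - theta p (x / a) / (x / a)"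
    using assms by (simp_all only: theta_p_mult mult_eq_0_iff divide_eq_0_iff simp_thms)
  then show ?thesis using assms by (simp add: theta2_def power2_eq_square mult.assoc)
qed

lemma theta2_swap:
  assumes "a \<noteq> 0" "x \<noteq> 0"
  shows "theta2 a x / x = - theta2 x a / a"
  using theta_inverse[of "a / x"] assms by (simp add: theta2_def mult.commute)

lemma theta2_inverse:
  assumes "a \<noteq> 0" "x \<noteq> 0"
  shows "theta2 a (1 / x) = theta2 a x / x\<^sup>2"
proof -
  have "theta p (1 / (x / a)) = - theta p (x / a) / (x / a)" "theta p (1 / (x * a)) = - theta p (x * a) / (x * a)"
    using assms by (simp_all only: theta_inverse mult_eq_0_iff divide_eq_0_iff simp_thms)
  then show ?thesis using assms by (simp add: theta2_def power2_eq_square mult.commute)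
qed

lemma theta2_p_powi:
  assumes "a \<noteq> 0" "x \<noteq> 0"
  shows "\<exists>e. e \<noteq> 0 \<and> (\<forall>b. b \<noteq> 0 \<longrightarrow> theta2 b (of_real p powi m * x) = e * theta2 b x)"
proof (induction m rule: int_induct[where k = 0])
  case base
  show ?case by (intro exI[of _ 1]) simp
next
  case (step1 i)
  then obtain e where e: "e \<noteq> 0" "\<And>b. b \<noteq> 0 \<Longrightarrow> theta2 b (of_real p powi i * x) = e * theta2 b x" by blast
  have *: "of_real p powi (i + 1) * x = of_real p * (of_real p powi i * x)"
    using p_pos by (simp add: power_int_add)
  have "theta2 b (of_real p powi (i + 1) * x) = (1 / (of_real p powi i * x)\<^sup>2 * e) * theta2 b x" if "b \<noteq> 0" for b
    unfolding * using that e p_pos assms theta2_p_mult[of b "of_real p powi i * x"] by simp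
  then show ?case using e p_pos assms by (intro exI[of _ "1 / (of_real p powi i * x)\<^sup>2 * e"]) simp
next
  case (step2 i)
  then obtain e where e: "e \<noteq> 0" "\<And>b. b \<noteq> 0 \<Longrightarrow> theta2 b (of_real p powi i * x) = e * theta2 b x" by blast
  have *: "of_real p powi i * x = of_real p * (of_real p powi (i - 1) * x)"
    using p_pos by (simp add: power_int_diff)
  have "theta2 b (of_real p powi (i - 1) * x) = ((of_real p powi (i - 1) * x)\<^sup>2 * e) * theta2 b x" if "b \<noteq> 0" for b
  proof -
    have "1 / (of_real p powi (i - 1) * x)\<^sup>2 * theta2 b (of_real p powi (i - 1) * x) = e * theta2 b x"
      using that e(2)[OF that] p_pos assms theta2_p_mult[of b "of_real p powi (i - 1) * x"] unfolding * by simp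
    then show ?thesis using p_pos assms by (simp add: field_simps)
  qed
  then show ?case using e p_pos assms by (intro exI[of _ "(of_real p powi (i - 1) * x)\<^sup>2 * e"]) simp
qed

lemma theta2_zero_cases:
  assumes "c \<noteq> 0" "z \<noteq> 0" "theta2 c z = 0"
  shows "(\<exists>m::int. z = of_real p powi m * c) \<or> (\<exists>m::int. z = of_real p powi m * (1 / c))"
  using assms by (auto simp: theta2_def theta_eq_0_iff field_simps)

text \<open>
  Vanishing of \<open>theta2 c z\<close> means that \<open>z\<close> and \<open>c\<close> agree up to a power of \<open>p\<close> and inversion,
  an equivalence relation.
\<close>
lemma theta2_zero_trans:
  assumes "a \<noteq> 0" "b \<noteq> 0" "c \<noteq> 0" "theta2 c a = 0" "theta2 c b = 0"
  shows "theta2 b a = 0"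
proof -
  have "\<exists>m::int. a = of_real p powi m * b \<or> a = of_real p powi m * (1 / b)"
  proof -
    obtain m n :: int where "a = of_real p powi m * c \<or> a = of_real p powi m * (1 / c)"
      "b = of_real p powi n * c \<or> b = of_real p powi n * (1 / c)"
      using theta2_zero_cases[of c a] theta2_zero_cases[of c b] assms by metis
    then have "a = of_real p powi (m - n) * b \<or> a = of_real p powi (m + n) * (1 / b)"
      using p_pos assms by (auto simp: power_int_diff power_int_add)
    then show ?thesis by blast
  qed
  then have "a * b = of_real p powi m \<or> a / b = of_real p powi m" if "a = of_real p powi m * b \<or> a = of_real p powi m * (1 / b)" for m
    using that assms by (elim disjE) simp_all
  then show ?thesis
    using assms \<open>\<exists>m::int. _\<close> unfolding theta2_def by (metis divide_eq_0_iff mult_eq_0_iff theta_eq_0_iff)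
qed

text \<open>
  Weierstrass' addition formula in multiplicative form. The first two terms, as functions of \<open>x\<close>,
  cancel at $x = c$ and hence at all zeros $p^m c^{\pm 1}$ of the third. These zeros are simple by the
  condition on $c^2$. Hence the sum of the first two terms is a multiple of \<open>theta2 c x\<close>, and the
  factor is found by evaluation at $x = b$ or $x = a$.
\<close>
lemma Weierstrass_nondegenerate:
  assumes nz: "a \<noteq> 0" "b \<noteq> 0" "c \<noteq> 0" "x \<noteq> 0" and c2: "theta p (c\<^sup>2) \<noteq> 0"
  shows "theta2 a x * theta2 c b / b + theta2 b x * theta2 a c / c + theta2 c x * theta2 b a / a = 0"
proof -
  define h where "h = (\<lambda>x. theta2 a x * theta2 c b / b + theta2 b x * theta2 a c / c)"
  have "\<exists>K. \<forall>z. z \<noteq> 0 \<longrightarrow> h z = K * theta2 c z"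
  proof (rule proportional_of_simple_zeros[where e = "\<lambda>x. 1 / x\<^sup>2"])
    have hol: "theta2 a holomorphic_on - {0}" if "a \<noteq> 0" for a
      unfolding theta2_def using that by (intro holomorphic_intros) auto
    show "theta2 c holomorphic_on - {0}" using hol nz by simp
    show "h holomorphic_on - {0}" unfolding h_def using nz by (intro holomorphic_intros hol) auto
    show "h (of_real p * z) = 1 / z\<^sup>2 * h z" if "z \<noteq> 0" for z
      unfolding h_def theta2_p_mult[OF nz(1) that] theta2_p_mult[OF nz(2) that]
      by (simp only: distrib_left times_divide_eq_right mult.assoc)
    show "h z = 0 \<and> deriv (theta2 c) z \<noteq> 0" if z: "z \<noteq> 0" "theta2 c z = 0" for z
    proof
      have sw: "theta2 c b / b = - theta2 b c / c" using nz by (intro theta2_swap) auto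
      have "h c = theta2 a c * (theta2 c b / b) + theta2 a c * (theta2 b c / c)"
        by (simp add: h_def mult.commute)
      then have hc: "h c = 0" unfolding sw by simp
      have hc': "h (1 / c) = 0"
      proof -
        have "h (1 / c) = h c / c\<^sup>2"
          unfolding h_def theta2_inverse[OF nz(1) nz(3)] theta2_inverse[OF nz(2) nz(3)]
          using nz by (simp add: field_simps)
        then show ?thesis using hc by simp
      qed
      have hp: "h (of_real p powi m * y) = 0" if "h y = 0" "y \<noteq> 0" for m y
      proof -
        obtain e where "\<And>b. b \<noteq> 0 \<Longrightarrow> theta2 b (of_real p powi m * y) = e * theta2 b y"
          using theta2_p_powi[of 1 y m] \<open>y \<noteq> 0\<close> by auto
        then have "h (of_real p powi m * y) = e * h y" using nz by (simp add: h_def algebra_simps)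
        then show ?thesis using that by simp
      qed
      show "h z = 0" using theta2_zero_cases[OF nz(3) z] hp[OF hc] hp[OF hc'] nz by auto
      have der: "(theta2 c has_field_derivative
          (deriv (theta p) (z * c) * c) * theta p (z / c) + (deriv (theta p) (z / c) * (1 / c)) * theta p (z * c)) (at z)"
        unfolding theta2_def[abs_def] using z nz
        by (auto intro!: derivative_eq_intros DERIV_chain2[OF theta_has_derivative])
      have "\<not> (theta p (z * c) = 0 \<and> theta p (z / c) = 0)"
      proof
        assume "theta p (z * c) = 0 \<and> theta p (z / c) = 0"
        then obtain m n :: int where "z * c = of_real p powi m" "z / c = of_real p powi n"
          using z nz by (metis divide_eq_0_iff mult_eq_0_iff theta_eq_0_iff)
        moreover have "c\<^sup>2 = (z * c) / (z / c)" using z nz by (simp add: power2_eq_square)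
        ultimately have "c\<^sup>2 = of_real p powi (m - n)" using p_pos by (simp add: power_int_diff)
        then have "theta p (c\<^sup>2) = 0" using nz p_pos by (subst theta_eq_0_iff) auto
        then show False using c2 by simp
      qed
      moreover have "theta p (z * c) = 0 \<or> theta p (z / c) = 0" using z by (simp add: theta2_def)
      ultimately have "(deriv (theta p) (z * c) * c) * theta p (z / c) + (deriv (theta p) (z / c) * (1 / c)) * theta p (z * c) \<noteq> 0"
        using theta_deriv_nonzero[of "z * c"] theta_deriv_nonzero[of "z / c"] z nz by auto
      then show "deriv (theta2 c) z \<noteq> 0" using DERIV_imp_deriv[OF der] by simp
    qed
  qed (use nz in \<open>auto simp: theta2_p_mult\<close>)
  then obtain K where K: "\<And>z. z \<noteq> 0 \<Longrightarrow> h z = K * theta2 c z" by blast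
  have "theta p 1 = 0" using theta_eq_0_iff[of 1] by (metis power_int_0_right zero_neq_one)
  then have diag: "theta2 b b = 0" if "b \<noteq> 0" for b
    using that by (simp add: theta2_def)
  \<comment> \<open>If neither $x = b$ nor $x = a$ can be used, all three terms vanish.\<close>
  consider "theta2 c b \<noteq> 0" | "theta2 c a \<noteq> 0" | "theta2 c b = 0" "theta2 c a = 0" by blast
  then show ?thesis
  proof cases
    case 1
    have "theta2 a b / b * theta2 c b = K * theta2 c b" using K[OF nz(2)] diag[OF nz(2)] by (simp add: h_def)
    then have "K = theta2 a b / b" using 1 mult_right_cancel[OF 1] by metis
    also have "\<dots> = - theta2 b a / a" using nz by (intro theta2_swap)
    finally show ?thesis using K[OF nz(4)] by (simp add: h_def)
  next
    case 2
    have "theta2 b a * (theta2 a c / c) = K * theta2 c a" using K[OF nz(1)] diag[OF nz(1)] by (simp add: h_def)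
    also have "theta2 a c / c = - theta2 c a / a" using nz by (intro theta2_swap)
    finally have "(- theta2 b a / a) * theta2 c a = K * theta2 c a" by simp
    then have "K = - theta2 b a / a" using mult_right_cancel[OF 2] by metis
    then show ?thesis using K[OF nz(4)] by (simp add: h_def)
  next
    case 3
    then have "theta2 b a = 0" using theta2_zero_trans[of a b c] nz by auto
    moreover have "theta2 a c = 0" using theta2_swap[of a c] 3 nz by simp
    ultimately show ?thesis using 3 by simp
  qed
qed

end

locale elliptic_params = nome p for p :: real +
  fixes q :: real
  assumes q_pos: "0 < q" and q_less: "q < 1" and indep: "alg_indep_Q p q"
begin

abbreviation E :: "complex \<Rightarrow> complex" where "E \<equiv> qpow q"

lemma E_add: "E (x + y) = E x * E y"
  by (simp add: qpow_def distrib_right exp_add)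

lemma E_minus: "E (- x) = 1 / E x"
  by (simp add: qpow_def exp_minus inverse_eq_divide)

lemma E_diff: "E (x - y) = E x / E y"
  by (simp add: qpow_def left_diff_distrib exp_diff)

lemma E_nz [simp]: "E x \<noteq> 0"
  by (simp add: qpow_def)

lemma E_0 [simp]: "E 0 = 1"
  by (simp add: qpow_def)

lemma E_int: "E (of_int m) = of_real q powi m"
proof -
  have "E (of_int m) = of_real (exp (of_int m * ln q))"
  proof -
    have "of_int m * of_real (ln q) = (of_real (of_int m * ln q) :: complex)" by simp
    then show ?thesis unfolding qpow_def by (simp only: exp_of_real)
  qed
  also have "exp (of_int m * ln q) = q powr of_int m"
    using q_pos by (simp add: powr_def)
  also have "\<dots> = q powi m"
    using q_pos powr_real_of_int'[of q m] by simp
  finally show ?thesis by simp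
qed

lemma E_double: "E (2 * x) = E x * E x"
  using E_add[of x x] by simp

text \<open>
  The elliptic analogue of \<open>x\<close>. The prefactor makes it odd.
\<close>
definition bracket :: "complex \<Rightarrow> complex" where
  "bracket x = E (- x) * theta p (E (2 * x))"

lemma bracket_minus: "bracket (- x) = - bracket x"
proof -
  have "theta p (1 / E (2 * x)) = - theta p (E (2 * x)) / E (2 * x)"
    by (rule theta_inverse) simp
  then show ?thesis
    by (simp add: bracket_def E_minus) (simp add: E_double)
qed

lemma theta_E: "theta p (E (2 * x)) = E x * bracket x"
  by (simp add: bracket_def E_minus)

text \<open>
  Algebraic independence, applied to the polynomial $X^i - Y^j$.
\<close>
lemma power_p_ne_power_q:
  assumes "i \<noteq> 0 \<or> j \<noteq> 0"
  shows "p ^ i \<noteq> q ^ j"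
proof
  assume eq: "p ^ i = q ^ j"
  define c :: "nat \<Rightarrow> nat \<Rightarrow> rat" where
    "c = (\<lambda>a b. (if a = i \<and> b = 0 then 1 else 0) - (if a = 0 \<and> b = j then 1 else 0))"
  define n where "n = max i j"
  have "(\<Sum>a\<le>n. \<Sum>b\<le>n. of_rat (c a b) * p ^ a * q ^ b)
      = (\<Sum>a\<le>n. \<Sum>b\<le>n. (if b = 0 then if a = i then p ^ a else 0 else 0) - (if b = j then if a = 0 then q ^ b else 0 else 0))"
    by (intro sum.cong refl) (auto simp: c_def of_rat_diff)
  also have "\<dots> = (\<Sum>a\<le>n. (if a = i then p ^ a else 0)) - (\<Sum>a\<le>n. (if a = 0 then q ^ j else 0))"
    by (simp add: sum_subtractf n_def)
  also have "\<dots> = 0" using eq by (simp add: n_def)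
  finally have "\<forall>a\<le>n. \<forall>b\<le>n. c a b = 0"
    using indep unfolding alg_indep_Q_def by blast
  then have "c i 0 = 0" by (simp add: n_def)
  then show False using assms by (auto simp: c_def split: if_splits)
qed

lemma q_powi_ne_p_powi:
  assumes "m \<noteq> 0"
  shows "of_real q powi m \<noteq> (of_real p powi k :: complex)"
proof
  assume "of_real q powi m = (of_real p powi k :: complex)"
  then have "of_real (q powi m) = (of_real (p powi k) :: complex)" by simp
  then have eq: "q powi m = p powi k" by (simp only: of_real_eq_iff)
  have neg: "q powi (- m) = p powi (- k)" using eq by (simp add: power_int_minus)
  have "m > 0 \<or> - m > 0" using assms by auto
  moreover have False if "m' > 0" "q powi m' = p powi k'" for m' k' :: int
  proof (cases "k' \<ge> 0")
    case True
    then have "q ^ nat m' = p ^ nat k'" using that by (simp add: power_int_def)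
    then show False using power_p_ne_power_q[of "nat k'" "nat m'"] that by auto
  next
    case False
    then have "q ^ nat m' * p ^ nat (- k') = 1" using that p_pos by (simp add: power_int_def field_simps)
    moreover have "q ^ nat m' < 1" using q_pos q_less that by (intro power_less_one_iff[THEN iffD2]) auto
    moreover have "q ^ nat m' * p ^ nat (- k') \<le> q ^ nat m' * 1"
      using q_pos p_pos p_less by (intro mult_left_mono power_le_one) auto
    ultimately show False by simp
  qed
  ultimately show False using eq neg by blast
qed

lemma theta_q_powi_nz: "m \<noteq> 0 \<Longrightarrow> theta p (of_real q powi m) \<noteq> 0"
  using q_pos q_powi_ne_p_powi[of m] by (subst theta_eq_0_iff) auto

lemma bracket_int_nz: "m \<noteq> 0 \<Longrightarrow> bracket (of_int m) \<noteq> 0"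
  using theta_q_powi_nz[of "2 * m"] E_int[of "2 * m"] by (simp add: bracket_def)

lemma bracket_0: "bracket 0 = 0"
  using bracket_minus[of 0] by simp

text \<open>
  A product of two brackets is a value of \<open>theta2\<close>, with the mean of the two arguments as
  variable and half their difference as parameter.
\<close>
lemma bracket_prod:
  assumes "x = (a + a') / 2" "u = (a - a') / 2"
  shows "bracket (z + a) * bracket (z + a') = theta2 (E (2 * u)) (E (2 * (z + x))) / E (2 * (z + x))"
proof -
  have 1: "z + a = (z + x) + u" "z + a' = (z + x) - u" unfolding assms by (simp_all add: field_simps)
  have "bracket ((z + x) + u) * bracket ((z + x) - u) = E (- ((z + x) + u)) * E (- ((z + x) - u)) *
    (theta p (E (2 * ((z + x) + u))) * theta p (E (2 * ((z + x) - u))))"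
    by (simp add: bracket_def)
  also have "E (- ((z + x) + u)) * E (- ((z + x) - u)) = 1 / E (2 * (z + x))"
    by (simp add: E_double flip: E_add E_minus)
  also have "E (2 * ((z + x) + u)) = E (2 * (z + x)) * E (2 * u)"
    unfolding E_add[symmetric] by (simp only: distrib_left)
  also have "E (2 * ((z + x) - u)) = E (2 * (z + x)) / E (2 * u)"
    unfolding E_diff[symmetric] by (simp only: right_diff_distrib)
  finally show ?thesis unfolding 1 by (simp add: theta2_def)
qed

text \<open>
  Three pairs with the same sum have the same mean, so that the three products in \<open>z\<close> are
  values of \<open>theta2\<close> in one variable.
\<close>
lemma bracket_addition_aux:
  fixes a a' b b' c c' :: int
  assumes "a + a' = b + b'" "b + b' = c + c'" "c \<noteq> c'"
  shows "bracket (z + of_int a) * bracket (z + of_int a') * bracket (of_int (b - c')) * bracket (of_int (b - c))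
    + bracket (z + of_int b) * bracket (z + of_int b') * bracket (of_int (c - a')) * bracket (of_int (c - a))
    + bracket (z + of_int c) * bracket (z + of_int c') * bracket (of_int (a - b')) * bracket (of_int (a - b)) = 0"
proof -
  define x :: complex where "x = (of_int a + of_int a') / 2"
  define A B C :: complex where "A = (of_int a - of_int a') / 2"
    and "B = (of_int b - of_int b') / 2" and "C = (of_int c - of_int c') / 2"
  define X where "X = E (2 * (z + x))"
  have xb: "x = (of_int b + of_int b') / 2" and xc: "x = (of_int c + of_int c') / 2"
    unfolding x_def using assms by (metis of_int_add)+
  have "of_int a = x + A" "of_int a' = x - A"
    unfolding x_def A_def by (simp_all add: field_simps)
  moreover have "of_int b = x + B" "of_int b' = x - B"
    unfolding xb B_def by (simp_all add: field_simps)
  moreover have "of_int c = x + C" "of_int c' = x - C"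
    unfolding xc C_def by (simp_all add: field_simps)
  ultimately have abc: "of_int a = x + A" "of_int a' = x - A" "of_int b = x + B" "of_int b' = x - B"
    "of_int c = x + C" "of_int c' = x - C" by blast+
  have n: "bracket (of_int (b - c')) * bracket (of_int (b - c)) = theta2 (E (2 * C)) (E (2 * B)) / E (2 * B)"
    "bracket (of_int (c - a')) * bracket (of_int (c - a)) = theta2 (E (2 * A)) (E (2 * C)) / E (2 * C)"
    "bracket (of_int (a - b')) * bracket (of_int (a - b)) = theta2 (E (2 * B)) (E (2 * A)) / E (2 * A)"
    using bracket_prod[of 0 C "- C" C B] bracket_prod[of 0 A "- A" A C] bracket_prod[of 0 B "- B" B A]
    by (simp_all add: abc of_int_diff mult.commute)
  have y: "bracket (z + of_int a) * bracket (z + of_int a') = theta2 (E (2 * A)) X / X"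
     "bracket (z + of_int b) * bracket (z + of_int b') = theta2 (E (2 * B)) X / X"
     "bracket (z + of_int c) * bracket (z + of_int c') = theta2 (E (2 * C)) X / X"
    unfolding X_def using bracket_prod[OF x_def A_def] bracket_prod[OF xb B_def] bracket_prod[OF xc C_def] by blast+
  have "(E (2 * C))\<^sup>2 = of_real q powi (2 * (c - c'))"
  proof -
    have "(E (2 * C))\<^sup>2 = E (of_int (2 * (c - c')))"
      unfolding power2_eq_square E_add[symmetric] by (simp add: C_def)
    then show ?thesis by (simp only: E_int)
  qed
  then have "theta p ((E (2 * C))\<^sup>2) \<noteq> 0"
    using assms(3) by (simp only:) (intro theta_q_powi_nz, simp)
  then have W: "theta2 (E (2 * A)) X * theta2 (E (2 * C)) (E (2 * B)) / E (2 * B)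
     + theta2 (E (2 * B)) X * theta2 (E (2 * A)) (E (2 * C)) / E (2 * C)
     + theta2 (E (2 * C)) X * theta2 (E (2 * B)) (E (2 * A)) / E (2 * A) = 0"
    by (intro Weierstrass_nondegenerate) (simp_all add: X_def)
  show ?thesis
  proof -
    have "P * Q * R * S = F * G / e / X" if "P * Q = F / X" "R * S = G / e" for P Q R S F G e
    proof -
      have "P * Q * R * S = (P * Q) * (R * S)" by (simp only: mult.assoc)
      then show ?thesis unfolding that by (simp add: mult.commute)
    qed
    note t = this[OF y(1) n(1)] this[OF y(2) n(2)] this[OF y(3) n(3)]
    show ?thesis
      unfolding t unfolding add_divide_distrib[symmetric] W by simp
  qed
qed

text \<open>
  The formula is invariant under cyclic permutation of the three pairs. The remaining case is that each
  pair consists of equal numbers, and then all pairs coincide.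
\<close>
lemma bracket_addition:
  fixes a a' b b' c c' :: int
  assumes "a + a' = b + b'" "b + b' = c + c'"
  shows "bracket (z + of_int a) * bracket (z + of_int a') * bracket (of_int (b - c')) * bracket (of_int (b - c))
    + bracket (z + of_int b) * bracket (z + of_int b') * bracket (of_int (c - a')) * bracket (of_int (c - a))
    + bracket (z + of_int c) * bracket (z + of_int c') * bracket (of_int (a - b')) * bracket (of_int (a - b)) = 0"
proof -
  consider "c \<noteq> c'" | "a \<noteq> a'" | "b \<noteq> b'" | "a = a'" "b = b'" "c = c'" by blast
  then show ?thesis
  proof cases
    case 1
    then show ?thesis using bracket_addition_aux assms by blast
  next
    case 2
    have "b + b' = c + c'" "c + c' = a + a'" using assms by simp_all
    from bracket_addition_aux[OF this 2, of z] show ?thesis by (simp only: add_ac)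
  next
    case 3
    have "c + c' = a + a'" "a + a' = b + b'" using assms by simp_all
    from bracket_addition_aux[OF this 3, of z] show ?thesis by (simp only: add_ac)
  next
    case 4
    then have "a = b" "b = c" using assms by auto
    then show ?thesis using 4 by (simp add: bracket_0)
  qed
qed

end

section \<open>Fused products in an algebra with a dynamical exchange relation\<close>

text \<open>
  \<open>fused L A k s\<close> is the sum of the products $L_{A_0 b_0}(s)\,L_{A_1 b_1}(s+1)\cdots$ over all
  sign words \<open>b\<close> with \<open>k\<close> plus signs, where \<open>True\<close> stands for plus. The integer argument of
  \<open>L\<close> is the exponent of $q^2$ in the spectral parameter. The count \<open>k\<close> is an integer, so that
  sums with an impossible count are $0$ and need no separate treatment.
\<close>
fun fused :: "(bool \<Rightarrow> bool \<Rightarrow> int \<Rightarrow> 'r::{ring, monoid_mult}) \<Rightarrow> bool list \<Rightarrow> int \<Rightarrow> int \<Rightarrow> 'r" where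
  "fused L [] k s = (if k = 0 then 1 else 0)"
| "fused L (a # A) k s = L a True s * fused L A (k - 1) (s + 1) + L a False s * fused L A k (s + 1)"

lemma fused_outside: "k < 0 \<or> k > int (length A) \<Longrightarrow> fused L A k s = 0"
  by (induction A arbitrary: k s) auto

abbreviation sg :: "bool \<Rightarrow> int" where "sg b \<equiv> (if b then 1 else - 1)"

lemma fused_Cons: "fused L (a # A) k s = L a b s * fused L A (k - of_bool b) (s + 1)
   + L a (\<not> b) s * fused L A (k - of_bool (\<not> b)) (s + 1)"
  by (cases b) (simp_all add: add.commute)

text \<open>
  Collect the words by the number \<open>m\<close> of plus signs in the first part.
\<close>
lemma fused_append:
  "fused L (A @ B) k s = (\<Sum>m = 0..int (length A). fused L A m s * fused L B (k - m) (s + int (length A)))"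
proof (induction A arbitrary: k s)
  case Nil
  then show ?case by simp
next
  case (Cons a A)
  let ?n = "int (length A)"
  have 1: "(\<Sum>m = 0..?n. fused L A m (s+1) * fused L B (k - 1 - m) (s + 1 + ?n))
      = (\<Sum>m = 0..?n+1. fused L A (m - 1) (s+1) * fused L B (k - m) (s + 1 + ?n))"
  proof -
    have "(\<Sum>m = 0..?n+1. fused L A (m - 1) (s+1) * fused L B (k - m) (s + 1 + ?n))
       = (\<Sum>m = 1..?n+1. fused L A (m - 1) (s+1) * fused L B (k - m) (s + 1 + ?n))"
      by (rule sum.mono_neutral_right) (auto simp: fused_outside)
    also have "\<dots> = (\<Sum>m = 0..?n. fused L A m (s+1) * fused L B (k - 1 - m) (s + 1 + ?n))"
      by (rule sum.reindex_bij_witness[of _ "\<lambda>m. m + 1" "\<lambda>m. m - 1"]) (auto simp: algebra_simps)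
    finally show ?thesis by simp
  qed
  have 2: "(\<Sum>m = 0..?n. fused L A m (s+1) * fused L B (k - m) (s + 1 + ?n))
      = (\<Sum>m = 0..?n+1. fused L A m (s+1) * fused L B (k - m) (s + 1 + ?n))"
    by (rule sum.mono_neutral_left) (auto simp: fused_outside)
  have "fused L ((a # A) @ B) k s = L a True s * (\<Sum>m = 0..?n+1. fused L A (m - 1) (s+1) * fused L B (k - m) (s + 1 + ?n))
     + L a False s * (\<Sum>m = 0..?n+1. fused L A m (s+1) * fused L B (k - m) (s + 1 + ?n))"
    using Cons.IH by (simp add: 1 2)
  also have "\<dots> = (\<Sum>m = 0..?n+1. fused L (a#A) m s * fused L B (k - m) (s + 1 + ?n))"
    by (simp add: sum_distrib_left sum.distrib mult.assoc distrib_right)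
  finally show ?case by (simp add: add_ac)
qed

text \<open>
  Two commuting copies of a field of functions, in variables $\lambda$ and $\mu$. The elements
  \<open>n i\<close> and \<open>y i\<close> stand for the constant $[i]$ and for the function $[x+i]$ of the dynamical
  variable \<open>x\<close>, and \<open>T i\<close> is the shift by \<open>i\<close>. Since a constant has the same image in both
  copies, the ring has to satisfy \<open>lam (n i) = mu (n i)\<close>. The sort of the ring includes the zero
  ring, so that no quotient has to be shown nontrivial.
\<close>
locale dynamical_scalars =
  fixes lam mu :: "'k::field \<Rightarrow> 'r::{ring, monoid_mult}"
    and T :: "int \<Rightarrow> 'k \<Rightarrow> 'k"
    and y n :: "int \<Rightarrow> 'k"
  assumes lam_add: "lam (f + g) = lam f + lam g" and lam_mult: "lam (f * g) = lam f * lam g"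
    and mu_add: "mu (f + g) = mu f + mu g" and mu_mult: "mu (f * g) = mu f * mu g"
    and lam_1: "lam 1 = 1" and mu_1: "mu 1 = 1"
    and lam_mu: "lam f * mu g = mu g * lam f"
    and lam_n: "lam (n i) = mu (n i)"
    and T_mult: "T i (f * g) = T i f * T i g" and T_divide: "T i (f / g) = T i f / T i g"
    and T_T: "T i (T j f) = T (i + j) f" and T_0: "T 0 f = f"
    and T_y: "T i (y j) = y (j + i)" and T_n: "T i (n j) = n j"
    and n_0: "n 0 = 0" and n_nz: "i \<noteq> 0 \<Longrightarrow> n i \<noteq> 0" and y_nz: "y i \<noteq> 0"
    and n_minus: "n (- i) = - n i"
    and addition: "\<lbrakk>a + a' = b + b'; b + b' = c + c'\<rbrakk> \<Longrightarrow>
      y a * y a' * n (b - c') * n (b - c) + y b * y b' * n (c - a') * n (c - a)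
        + y c * y c' * n (a - b') * n (a - b) = 0"
begin

lemma n_swap: "n (i - j) = - n (j - i)"
  using n_minus[of "j - i"] by simp

text \<open>
  This and \<open>addition2\<close> are the two instances of the addition formula on which the exchange of factors depends. They arise
  from each other by $j \mapsto m+1-j$ and $x \mapsto -x-2$.
\<close>
lemma addition1: "n 1 * n j * y (m + 2 - j) * y (1 - m) + n (m + 1) * n (m - j) * y (2 - j) * y 1
      = n m * n (m + 1 - j) * y 2 * y (1 - j)"
proof -
  have "y (m + 2 - j) * y (1 - m) * n ((2 - j) - (1 - j)) * n ((2 - j) - 2)
      + y (2 - j) * y 1 * n (2 - (1 - m)) * n (2 - (m + 2 - j))
      + y 2 * y (1 - j) * n ((m + 2 - j) - 1) * n ((m + 2 - j) - (2 - j)) = 0"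
    by (rule addition) auto
  moreover have "n ((2 - j) - 2) = - n j" "n (2 - (m + 2 - j)) = - n (m - j)"
    by (simp_all add: n_minus flip: n_swap[of j m])
  moreover have "(2 - j) - (1 - j) = 1" "2 - (1 - m) = m + 1" "(m + 2 - j) - 1 = m + 1 - j"
     "(m + 2 - j) - (2 - j) = m" by auto
  ultimately show ?thesis by (simp only:) (simp add: algebra_simps)
qed

lemma addition2: "n (m + 1) * n (j - 1) * y (m + 1 - j) * y 1 + n 1 * n (m + 1 - j) * y (1 + m) * y (1 - j)
   = n m * n j * y 0 * y (m + 2 - j)"
proof -
  have "y (m + 1 - j) * y 1 * n ((1 + m) - (m + 2 - j)) * n ((1 + m) - 0)
      + y (1 + m) * y (1 - j) * n (0 - 1) * n (0 - (m + 1 - j))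
      + y 0 * y (m + 2 - j) * n ((m + 1 - j) - (1 - j)) * n ((m + 1 - j) - (1 + m)) = 0"
    by (rule addition) auto
  moreover have "n (0 - 1) = - n 1" "n (0 - (m + 1 - j)) = - n (m + 1 - j)" "n ((m + 1 - j) - (1 + m)) = - n j"
     using n_minus[of 1] n_minus[of "m + 1 - j"] n_minus[of j] by simp_all
  moreover have "(1 + m) - (m + 2 - j) = j - 1" "(1 + m) - 0 = m + 1" "(m + 1 - j) - (1 - j) = m"
    by auto
  ultimately show ?thesis by (simp only:) (simp add: algebra_simps)
qed

text \<open>
  The coefficient in $\mu$ with which a factor of column sign \<open>b\<close> is absorbed by a fused product
  of \<open>m\<close> factors such that the result has column count \<open>k\<close>.
\<close>
definition exch_coeff :: "bool \<Rightarrow> int \<Rightarrow> int \<Rightarrow> 'k" where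
  "exch_coeff b m k = (if b then n k * y (m + 2 - k) else n (m + 1 - k) * y (1 - k)) / y 1"

text \<open>
  The coefficients satisfy a Pascal type recursion in \<open>m\<close>, in two parts. They belong to the terms
  whose new first factor has the opposite column sign, here, and the same column sign,
  \<open>exch_coeff_rec2\<close>.
\<close>
lemma exch_coeff_rec1:
  "y (1 + sg b) / y 1 * T (sg b) (exch_coeff b (m - 1) (k - of_bool (\<not> b))) = exch_coeff b m k"
  using y_nz[of 0] y_nz[of 1] y_nz[of 2]
  by (cases b) (simp_all add: exch_coeff_def T_mult T_divide T_y T_n algebra_simps)

lemma exch_coeff_rec2:
  assumes "m \<noteq> 0"
  shows "n (m + 1) / n m * T (- sg b) (exch_coeff b (m - 1) (k - of_bool b))
     + n 1 * y (1 + sg b * m) / (n m * y 1) * T (- sg b) (exch_coeff (\<not> b) (m - 1) (k - of_bool b)) = exch_coeff b m k"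
proof (cases b)
  case True
  have "n (m + 1) / n m * T (- sg b) (exch_coeff b (m - 1) (k - of_bool b))
     + n 1 * y (1 + sg b * m) / (n m * y 1) * T (- sg b) (exch_coeff (\<not> b) (m - 1) (k - of_bool b))
     = (n (m + 1) * n (k - 1) * y (m + 1 - k) * y 1 + n 1 * n (m + 1 - k) * y (1 + m) * y (1 - k))
        / (n m * y 0 * y 1)"
    using True assms y_nz[of 0] y_nz[of 1] n_nz[of m]
    by (simp add: exch_coeff_def T_mult T_divide T_y T_n field_simps)
  also have "\<dots> = exch_coeff b m k"
    using True assms y_nz[of 0] y_nz[of 1] n_nz[of m] unfolding addition2
    by (simp add: exch_coeff_def)
  finally show ?thesis .
next
  case False
  have "n (m + 1) / n m * T (- sg b) (exch_coeff b (m - 1) (k - of_bool b))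
     + n 1 * y (1 + sg b * m) / (n m * y 1) * T (- sg b) (exch_coeff (\<not> b) (m - 1) (k - of_bool b))
     = (n 1 * n k * y (m + 2 - k) * y (1 - m) + n (m + 1) * n (m - k) * y (2 - k) * y 1)
        / (n m * y 2 * y 1)"
    using False assms y_nz[of 2] y_nz[of 1] n_nz[of m]
    by (simp add: exch_coeff_def T_mult T_divide T_y T_n field_simps)
  also have "\<dots> = exch_coeff b m k"
    using False assms y_nz[of 2] y_nz[of 1] n_nz[of m] unfolding addition1
    by (simp add: exch_coeff_def)
  finally show ?thesis .
qed

lemma T_1: "T j 1 = 1"
proof -
  have "T j (n 1 / n 1) = n 1 / n 1" by (simp only: T_divide T_n)
  then show ?thesis using n_nz[of 1] by simp
qed

lemma T_prod: "T j (\<Prod>i\<in>A. h i) = (\<Prod>i\<in>A. T j (h i))"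
  by (induction A rule: infinite_finite_induct) (auto simp: T_mult T_1)

text \<open>
  Up to the constant $(-q)^{m+r}$ this is $\Gamma_r$ for $N = m + r$.
\<close>
definition gram :: "nat \<Rightarrow> nat \<Rightarrow> 'k" where
  "gram m r = (\<Prod>i=1..r. n (int (m + i)) / n (int i)) * y 1 / (\<Prod>i=1..m + r + 1. y (int i - int r))"

lemma gram_nz: "gram m r \<noteq> 0"
  using n_nz y_nz by (auto simp: gram_def)

lemma prod_shift: "(\<Prod>i=1..Suc N. h i) = h 1 * (\<Prod>i=1..N. h (Suc i))"
  for h :: "nat \<Rightarrow> 'k"
  by (induction N) (simp_all add: mult_ac)

lemma T_gram: "T j (gram m r / y 1) = (\<Prod>i=1..r. n (int (m + i)) / n (int i)) / (\<Prod>i=1..m + r + 1. y (int i - int r + j))"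
proof -
  have "gram m r / y 1 = (\<Prod>i=1..r. n (int (m + i)) / n (int i)) / (\<Prod>i=1..m + r + 1. y (int i - int r))"
    unfolding gram_def using y_nz[of 1] by simp
  then show ?thesis by (simp only: T_divide T_prod T_n T_y)
qed

text \<open>
  Together with \<open>T_gram_False\<close>: the quotient of norm factors of consecutive lengths is the weight in
  $\lambda$ required by \<open>fused_exchange\<close>. The division by \<open>y 1\<close> accounts for the denominator of
  $F(\mu)/F(\lambda)$.
\<close>
lemma T_gram_True:
  "T (- 1) (gram m r / y 1) = gram m (Suc r) / n (int (m + Suc r)) * (n (int (Suc r)) * y (int m + 1) / y 1)"
proof -
  define a b X P where "a = n (int (m + Suc r))" and "b = n (int (Suc r))"
    and "X = (\<Prod>i=1..r. n (int (m + i)) / n (int i))" and "P = (\<Prod>i=1..m + r + 1. y (int i - int r - 1))"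
  have "(\<Prod>i=1..m + Suc r + 1. y (int i - int (Suc r))) = P * y (int m + 1)"
    by (simp add: P_def algebra_simps)
  moreover have "(\<Prod>i=1..Suc r. n (int (m + i)) / n (int i)) = X * (a / b)"
    unfolding X_def a_def b_def by (simp del: of_nat_add of_nat_Suc add_Suc_right add_Suc)
  ultimately have "gram m (Suc r) = X * (a / b) * y 1 / (P * y (int m + 1))"
    unfolding gram_def by simp
  moreover have "T (- 1) (gram m r / y 1) = X / P"
    unfolding T_gram X_def P_def by simp
  moreover have "a \<noteq> 0" "b \<noteq> 0" "P \<noteq> 0"
    using n_nz y_nz by (simp_all add: a_def b_def P_def)
  ultimately show ?thesis using y_nz[of 1] y_nz[of "int m + 1"]
    unfolding a_def[symmetric] b_def[symmetric] by simp
qed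

lemma T_gram_False:
  "T 1 (gram m r / y 1) = gram (Suc m) r / n (int (Suc m + r)) * (n (int (Suc m)) * y (1 - int r) / y 1)"
proof -
  define a b X X' P where "a = n (int (Suc m + r))" and "b = n (int (Suc m))"
    and "X = (\<Prod>i=1..r. n (int (m + i)) / n (int i))" and "X' = (\<Prod>i=1..r. n (int (Suc m + i)) / n (int i))"
    and "P = (\<Prod>i=1..m + r + 1. y (int i - int r + 1))"
  have "(\<Prod>i=1..r. n (int (m + i)) / n (int i)) * n (int (Suc m + r))
      = (\<Prod>i=1..r. n (int (Suc m + i)) / n (int i)) * n (int (Suc m))"
  proof (induction r)
    case (Suc r)
    have "(\<Prod>i=1..Suc r. n (int (m + i)) / n (int i)) * n (int (Suc m + Suc r))
      = ((\<Prod>i=1..r. n (int (m + i)) / n (int i)) * n (int (Suc m + r))) * n (int (Suc m + Suc r)) / n (int (Suc r))"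
      by (simp del: of_nat_add of_nat_Suc)
    then show ?case unfolding Suc by simp
  qed simp
  then have XX: "X * a = X' * b" by (simp only: X_def X'_def a_def b_def)
  have "(\<Prod>i=1..Suc m + r + 1. y (int i - int r)) = y (1 - int r) * P"
    using prod_shift[of "\<lambda>i. y (int i - int r)" "m + r + 1"] by (simp add: P_def algebra_simps)
  then have "gram (Suc m) r = X' * y 1 / (y (1 - int r) * P)"
    by (simp only: gram_def X'_def)
  moreover have "T 1 (gram m r / y 1) = X / P"
    unfolding T_gram X_def P_def by simp
  moreover have "a \<noteq> 0" "b \<noteq> 0" "P \<noteq> 0"
    using n_nz y_nz by (simp_all add: a_def b_def P_def)
  moreover from this have "X = X' * b / a"
    using XX by (simp add: nonzero_eq_divide_eq)
  ultimately show ?thesis using y_nz[of 1] y_nz[of "1 - int r"]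
    unfolding a_def[symmetric] b_def[symmetric] by simp
qed

end

text \<open>
  The exchange relations in bracket form, for spectral parameters whose quotient is $q^{2u}$ with
  $u \ge 1$; for these no residual relation occurs. Writing the signs as variables merges the pairs
  of relations of each type into one, and the four mixed relations as well.
\<close>
locale RLL_algebra = dynamical_scalars lam mu T y n
  for lam mu :: "'k::field \<Rightarrow> 'r::{ring, monoid_mult}" and T y n +
  fixes L :: "bool \<Rightarrow> bool \<Rightarrow> int \<Rightarrow> 'r"
  assumes lam_L: "lam f * L a b i = L a b i * lam (T (sg a) f)"
    and mu_L: "mu f * L a b i = L a b i * mu (T (sg b) f)"
    and same: "L a b i * L a b j = L a b j * L a b i"
    and row: "u \<ge> 1 \<Longrightarrow> mu (n (u + 1) * y 1) * (L a b (i + u) * L a (\<not> b) i)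
       = mu (n u * y (1 + sg b)) * (L a (\<not> b) i * L a b (i + u))
         + mu (n 1 * y (1 + sg b * u)) * (L a b i * L a (\<not> b) (i + u))"
    and col: "u \<ge> 1 \<Longrightarrow> lam (n u * y (1 - sg a)) * (L (\<not> a) b (i + u) * L a b i)
         + lam (n 1 * y (1 + sg a * u)) * (L a b (i + u) * L (\<not> a) b i)
       = lam (n (u + 1) * y 1) * (L a b i * L (\<not> a) b (i + u))"
    and mixed: "u \<ge> 1 \<Longrightarrow> lam (n u * y (1 - sg a) / y 1) * (L (\<not> a) b (i + u) * L a (\<not> b) i)
         + lam (n 1 * y (1 + sg a * u) / y 1) * (L a b (i + u) * L (\<not> a) (\<not> b) i)
       = mu (n u * y (1 + sg b) / y 1) * (L a (\<not> b) i * L (\<not> a) b (i + u))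
         + mu (n 1 * y (1 + sg b * u) / y 1) * (L a b i * L (\<not> a) (\<not> b) (i + u))"
begin

lemma L_lam: "L a b i * lam f = lam (T (- sg a) f) * L a b i"
  by (simp add: lam_L T_T T_0)

lemma L_mu: "L a b i * mu f = mu (T (- sg b) f) * L a b i"
  by (simp add: mu_L T_T T_0)

lemma mu_mu: "mu f * (mu g * x) = mu (f * g) * x"
  by (simp add: mu_mult mult.assoc)

lemma lam_lam: "lam f * (lam g * x) = lam (f * g) * x"
  by (simp add: lam_mult mult.assoc)

lemma lam_mu_left: "lam f * (mu g * x) = mu g * (lam f * x)"
  by (metis lam_mu mult.assoc)

lemma L_mu_left: "L a b i * (mu f * x) = mu (T (- sg b) f) * (L a b i * x)"
  by (metis L_mu mult.assoc)

lemma L_lam_left: "L a b i * (lam f * x) = lam (T (- sg a) f) * (L a b i * x)"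
  by (metis L_lam mult.assoc)

lemma mu_comb: "mu f * x + mu g * x = mu (f + g) * x"
  by (simp add: mu_add distrib_right)

text \<open>
  The last step common to the two inductions that move a factor through a fused product. \<open>Z b\<close> is
  the already absorbed factor of column sign \<open>b\<close>. The terms regroup into the expansion of a longer
  fused product by its first factor, and the recursions for \<open>exch_coeff\<close> supply the coefficients.
\<close>
lemma transfer_step:
  assumes Z: "\<And>b k. Z b k = mu (exch_coeff b (m - 1) k) * W k" and m: "m \<noteq> 0"
  shows "mu (n (m + 1) / n m) * (L a b s * Z b (k - of_bool b))
     + (mu (y (1 + sg b) / y 1) * (L a (\<not> b) s * Z b (k - of_bool (\<not> b)))
       + mu (n 1 * y (1 + sg b * m) / (n m * y 1)) * (L a b s * Z (\<not> b) (k - of_bool b)))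
     = mu (exch_coeff b m k) * (L a True s * W (k - 1) + L a False s * W k)"
proof -
  have "mu (n (m + 1) / n m) * (L a b s * Z b (k - of_bool b))
       + mu (n 1 * y (1 + sg b * m) / (n m * y 1)) * (L a b s * Z (\<not> b) (k - of_bool b))
     = mu (exch_coeff b m k) * (L a b s * W (k - of_bool b))"
    unfolding Z L_mu_left mu_mu mu_comb exch_coeff_rec2[OF m] ..
  moreover have "mu (y (1 + sg b) / y 1) * (L a (\<not> b) s * Z b (k - of_bool (\<not> b)))
     = mu (exch_coeff b m k) * (L a (\<not> b) s * W (k - of_bool (\<not> b)))"
  proof -
    have "- sg (\<not> b) = sg b" by simp
    then show ?thesis unfolding Z L_mu_left mu_mu by (simp only: exch_coeff_rec1)
  qed
  moreover have "L a True s * W (k - 1) + L a False s * W k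
     = L a b s * W (k - of_bool b) + L a (\<not> b) s * W (k - of_bool (\<not> b))"
    by (cases b) (simp_all add: add.commute)
  ultimately show ?thesis by (simp add: distrib_left algebra_simps)
qed

lemma mu_0: "mu 0 = 0"
  using mu_add[of 0 0] by simp

lemma lam_0: "lam 0 = 0"
  using lam_add[of 0 0] by simp

lemma row_normalised:
  assumes "u \<ge> 1"
  shows "mu (n (u + 1) / n u) * (L a b (i + u) * L a (\<not> b) i)
       = mu (y (1 + sg b) / y 1) * (L a (\<not> b) i * L a b (i + u))
         + mu (n 1 * y (1 + sg b * u) / (n u * y 1)) * (L a b i * L a (\<not> b) (i + u))"
proof -
  have nz: "n u \<noteq> 0" using assms n_nz[of u] by simp
  have "mu (1 / (n u * y 1)) * (mu (n (u + 1) * y 1) * (L a b (i + u) * L a (\<not> b) i))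
     = mu (1 / (n u * y 1)) * (mu (n u * y (1 + sg b)) * (L a (\<not> b) i * L a b (i + u)))
     + mu (1 / (n u * y 1)) * (mu (n 1 * y (1 + sg b * u)) * (L a b i * L a (\<not> b) (i + u)))"
    by (simp add: row[OF assms] distrib_left del: minus_mult_commute)
  then show ?thesis using nz y_nz[of 1] unfolding mu_mu by simp
qed

text \<open>
  Exchange for a constant row word. The factor in front carries the largest exponent, and the row
  relation moves it to the right past the first factor of the product.
\<close>
lemma row_exchange:
  "mu (n (int m + 1)) * (L a b (s + int m) * fused L (replicate m a) (k - of_bool b) s)
   = mu (exch_coeff b (int m) k) * fused L (replicate (Suc m) a) k s"
proof (induction m arbitrary: b k s)
  case 0
  show ?case using y_nz[of 1] by (cases b) (auto simp: exch_coeff_def n_0 mu_0)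
next
  case (Suc m)
  define M where "M = int (Suc m)"
  have M: "M \<ge> 1" "M \<noteq> 0" "int m = M - 1" by (simp_all add: M_def)
  define W where "W = (\<lambda>k. fused L (replicate (Suc m) a) k (s + 1))"
  define Z where "Z = (\<lambda>b k. mu (n M) * (L a b (s + M) * fused L (replicate m a) (k - of_bool b) (s + 1)))"
  have Z: "Z b k = mu (exch_coeff b (M - 1) k) * W k" for b k
    using Suc.IH[of b "s + 1" k] by (simp add: Z_def W_def M add_ac)
  have tn: "L a b s * (mu (n i) * x) = mu (n i) * (L a b s * x)" for b i x
    by (simp add: L_mu_left T_n)
  let ?V = "\<lambda>k. fused L (replicate m a) k (s + 1)"
  have "mu (n (M + 1)) * (L a b (s + M) * fused L (replicate (Suc m) a) (k - of_bool b) s)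
     = mu (n (M + 1)) * (L a b s * (L a b (s + M) * ?V (k - of_bool b - of_bool b)))
       + mu (n M) * (mu (n (M + 1) / n M) * (L a b (s + M) * L a (\<not> b) s) * ?V (k - of_bool b - of_bool (\<not> b)))"
  proof -
    have "n M * (n (M + 1) / n M) = n (M + 1)" using n_nz[of M] M by simp
    then show ?thesis
      unfolding replicate_Suc fused_Cons[of L a _ _ _ b] mult.assoc mu_mu distrib_left
      using same[of a b "s + M" s] by (simp flip: mult.assoc)
  qed
  also have "\<dots> = mu (n (M + 1) / n M) * (L a b s * Z b (k - of_bool b))
     + (mu (y (1 + sg b) / y 1) * (L a (\<not> b) s * Z b (k - of_bool (\<not> b)))
       + mu (n 1 * y (1 + sg b * M) / (n M * y 1)) * (L a b s * Z (\<not> b) (k - of_bool b)))"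
  proof -
    have "k - of_bool b - of_bool (\<not> b) = k - of_bool (\<not> b) - of_bool b" by simp
    moreover have "n M \<noteq> 0" using M n_nz by simp
    ultimately show ?thesis unfolding row_normalised[OF M(1)] Z_def tn mu_mu
      by (simp only: distrib_left distrib_right mult.assoc mu_mu) (simp add: mult.commute)
  qed
  also have "\<dots> = mu (exch_coeff b M k) * (L a True s * W (k - 1) + L a False s * W k)"
    by (rule transfer_step[OF Z M(2)])
  also have "\<dots> = mu (exch_coeff b M k) * fused L (replicate (Suc (Suc m)) a) k s"
    by (simp add: W_def)
  finally show ?case by (simp add: M_def add_ac)
qed

lemma lam_inverse_n: "lam (1 / n j) = mu (1 / n j)"
proof (cases "n j = 0")
  case True
  then show ?thesis by (simp add: lam_0 mu_0)
next
  case False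
  have "mu (n j) * lam (1 / n j) = lam (n j * (1 / n j))"
    by (simp only: lam_mult lam_n)
  then have *: "mu (n j) * lam (1 / n j) = 1"
    using False by (simp add: lam_1)
  have "lam (1 / n j) = mu (1 / n j * n j) * lam (1 / n j)"
    using False by (simp add: mu_1)
  also have "\<dots> = mu (1 / n j)"
    unfolding mu_mult mult.assoc * by simp
  finally show ?thesis .
qed

lemma lam_n_divide: "lam (n i / n j) = mu (n i / n j)"
proof -
  have "lam (n i * (1 / n j)) = mu (n i * (1 / n j))"
    unfolding lam_mult mu_mult lam_n lam_inverse_n ..
  then show ?thesis by simp
qed

lemma lam_cancel:
  assumes "f \<noteq> 0" "lam f * x = lam f * x'"
  shows "x = x'"
proof -
  have "lam (1 / f * f) * x = lam (1 / f * f) * x'"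
    unfolding lam_mult mult.assoc assms(2) ..
  then show ?thesis using assms(1) by (simp add: lam_1)
qed

lemma mu_cancel:
  assumes "f \<noteq> 0" "mu f * x = mu f * x'"
  shows "x = x'"
proof -
  have "mu (1 / f * f) * x = mu (1 / f * f) * x'"
    unfolding mu_mult mult.assoc assms(2) ..
  then show ?thesis using assms(1) by (simp add: mu_1)
qed

text \<open>
  At $u = 1$ the two column relations have the same left-hand side, and so have the two mixed relations
  with the same column signs. Comparing right-hand sides shows that rows can be interchanged in an
  product with increasing exponents.
\<close>
lemma swap_same: "L True b i * L False b (i + 1) = L False b i * L True b (i + 1)"
proof (rule lam_cancel)
  show "n 2 * y 1 \<noteq> 0" using n_nz[of 2] y_nz[of 1] by simp
  show "lam (n 2 * y 1) * (L True b i * L False b (i + 1)) = lam (n 2 * y 1) * (L False b i * L True b (i + 1))"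
    using col[of 1 True b i] col[of 1 False b i] by (simp add: add.commute)
qed

lemma swap_mixed: "L True True i * L False False (i + 1) + L True False i * L False True (i + 1)
   = L False True i * L True False (i + 1) + L False False i * L True True (i + 1)"
proof (rule mu_cancel)
  show "n 1 * y 2 / y 1 \<noteq> 0" using n_nz[of 1] y_nz[of 1] y_nz[of 2] by simp
  show "mu (n 1 * y 2 / y 1) * (L True True i * L False False (i + 1) + L True False i * L False True (i + 1))
   = mu (n 1 * y 2 / y 1) * (L False True i * L True False (i + 1) + L False False i * L True True (i + 1))"
    using mixed[of 1 True True i] mixed[of 1 False True i] by (simp add: add.commute distrib_left)
qed

lemma fused_swap: "fused L (True # False # A) k s = fused L (False # True # A) k s"
proof -
  have "fused L (a # (\<not> a) # A) k s =
     (L a True s * L (\<not> a) True (s + 1)) * fused L A (k - 2) (s + 2)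
     + (L a True s * L (\<not> a) False (s + 1) + L a False s * L (\<not> a) True (s + 1)) * fused L A (k - 1) (s + 2)
     + (L a False s * L (\<not> a) False (s + 1)) * fused L A k (s + 2)" for a
    by (simp add: distrib_left distrib_right mult.assoc add_ac)
  from this[of True] this[of False] show ?thesis
    using swap_same[of True s] swap_same[of False s] swap_mixed[of s] by simp
qed

abbreviation W :: "nat \<Rightarrow> nat \<Rightarrow> int \<Rightarrow> int \<Rightarrow> 'r" where
  "W m r \<equiv> fused L (replicate m False @ replicate r True)"

lemma W_True: "W m (Suc r) k s = fused L (True # replicate m False @ replicate r True) k s"
proof (induction m arbitrary: k s)
  case (Suc m)
  have "W (Suc m) (Suc r) k s = fused L (False # True # replicate m False @ replicate r True) k s"
    using Suc by simp
  then show ?case by (simp only: fused_swap replicate_Suc append_Cons)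
qed simp

lemma W_False: "W (Suc m) r k s = fused L (False # replicate m False @ replicate r True) k s"
  by simp

text \<open>
  In the induction step for \<open>fused_exchange\<close> the terms with different row signs form the
  left-hand side of a column relation or of a mixed relation, multiplied by a common factor.
\<close>
lemma exchange_pair_same:
  fixes m r :: nat and b s
  defines "M \<equiv> int (m + Suc r)"
  shows "lam (n (int (Suc r)) * y (int m + 2) / y 1) * (L True b (s + M) * L False b s)
     + lam (n (int (Suc r)) * y (int m + 2) * n 1 * y (1 - M) / (y 1 * n M * y 2)) * (L False b (s + M) * L True b s)
    = mu (n (M + 1) / n M) * (lam (n (int (Suc r)) * y (int m + 2) / y 2) * (L False b s * L True b (s + M)))"
proof -
  let ?f = "n (int (Suc r)) * y (int m + 2) / (y 1 * n M * y 2)"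
  have M: "M \<ge> 1" "n M \<noteq> 0" using n_nz[of M] by (auto simp: M_def)
  note nz = y_nz[of 1] y_nz[of 2] M(2)
  have "lam ?f * (lam (n M * y 2) * (L True b (s + M) * L False b s)
      + lam (n 1 * y (1 - M)) * (L False b (s + M) * L True b s))
     = lam ?f * (lam (n (M + 1) * y 1) * (L False b s * L True b (s + M)))"
    using col[OF M(1), of False b s] by simp
  then have "lam (?f * (n M * y 2)) * (L True b (s + M) * L False b s)
      + lam (?f * (n 1 * y (1 - M))) * (L False b (s + M) * L True b s)
     = lam (?f * (n (M + 1) * y 1)) * (L False b s * L True b (s + M))"
    by (simp only: distrib_left lam_lam)
  moreover have "?f * (n M * y 2) = n (int (Suc r)) * y (int m + 2) / y 1"
    "?f * (n 1 * y (1 - M)) = n (int (Suc r)) * y (int m + 2) * n 1 * y (1 - M) / (y 1 * n M * y 2)"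
    "?f * (n (M + 1) * y 1) = n (M + 1) / n M * (n (int (Suc r)) * y (int m + 2) / y 2)"
    using nz by simp_all
  ultimately show ?thesis by (simp only: lam_lam flip: lam_n_divide)
qed

lemma exchange_pair_mixed:
  fixes m r :: nat and b s
  defines "M \<equiv> int (m + Suc r)"
  shows "lam (n (int (Suc r)) * y (int m + 2) / y 1) * (L True b (s + M) * L False (\<not> b) s)
     + lam (n (int (Suc r)) * y (int m + 2) * n 1 * y (1 - M) / (y 1 * n M * y 2)) * (L False b (s + M) * L True (\<not> b) s)
    = mu (y (1 + sg b) / y 1) * (lam (n (int (Suc r)) * y (int m + 2) / y 2) * (L False (\<not> b) s * L True b (s + M)))
      + mu (n 1 * y (1 + sg b * M) / (n M * y 1)) * (lam (n (int (Suc r)) * y (int m + 2) / y 2) * (L False b s * L True (\<not> b) (s + M)))"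
proof -
  let ?f = "n (int (Suc r)) * y (int m + 2) / y 2"
  have M: "M \<ge> 1" "n M \<noteq> 0" using n_nz[of M] by (auto simp: M_def)
  note nz = y_nz[of 1] y_nz[of 2] M(2)
  have "lam (?f * (1 / n M)) * (lam (n M * y 2 / y 1) * (L True b (s + M) * L False (\<not> b) s)
      + lam (n 1 * y (1 - M) / y 1) * (L False b (s + M) * L True (\<not> b) s))
     = lam (?f * (1 / n M)) * (mu (n M * y (1 + sg b) / y 1) * (L False (\<not> b) s * L True b (s + M))
         + mu (n 1 * y (1 + sg b * M) / y 1) * (L False b s * L True (\<not> b) (s + M)))"
    using mixed[OF M(1), of False b s] by simp
  also have "\<dots> = mu (1 / n M) * (mu (n M * y (1 + sg b) / y 1) * (lam ?f * (L False (\<not> b) s * L True b (s + M)))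
         + mu (n 1 * y (1 + sg b * M) / y 1) * (lam ?f * (L False b s * L True (\<not> b) (s + M))))"
    unfolding lam_mult[of ?f] lam_inverse_n mult.assoc distrib_left
    by (simp only: lam_mu_left mu_mu)
  finally have "lam (?f * (1 / n M) * (n M * y 2 / y 1)) * (L True b (s + M) * L False (\<not> b) s)
      + lam (?f * (1 / n M) * (n 1 * y (1 - M) / y 1)) * (L False b (s + M) * L True (\<not> b) s)
    = mu (1 / n M * (n M * y (1 + sg b) / y 1)) * (lam ?f * (L False (\<not> b) s * L True b (s + M)))
         + mu (1 / n M * (n 1 * y (1 + sg b * M) / y 1)) * (lam ?f * (L False b s * L True (\<not> b) (s + M)))"
    by (simp only: distrib_left lam_lam mu_mu)
  moreover have "?f * (1 / n M) * (n M * y 2 / y 1) = n (int (Suc r)) * y (int m + 2) / y 1"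
    "?f * (1 / n M) * (n 1 * y (1 - M) / y 1) = n (int (Suc r)) * y (int m + 2) * n 1 * y (1 - M) / (y 1 * n M * y 2)"
    "1 / n M * (n M * y (1 + sg b) / y 1) = y (1 + sg b) / y 1"
    "1 / n M * (n 1 * y (1 + sg b * M) / y 1) = n 1 * y (1 + sg b * M) / (n M * y 1)"
    using nz by (simp_all add: field_simps)
  ultimately show ?thesis by (simp only:)
qed

text \<open>
  The product with \<open>m\<close> minus signs and \<open>Suc r\<close> plus signs is expanded in two ways. Its
  coefficient splits by the addition formula into two parts. For one part the product
  is expanded beginning with a plus sign, which by symmetry is possible; together with the first term
  this is the left-hand side of an exchange relation. For the other part it begins with a minus sign,
  and a row relation applies. Both contributions then have the form demanded by the induction
  hypothesis \<open>Z\<close>.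
\<close>
lemma fused_exchange_step:
  fixes m r :: nat and Z :: "bool \<Rightarrow> int \<Rightarrow> 'r" and b k s
  assumes Z: "\<And>b k. Z b k = lam (n (int (Suc r)) * y (int m + 1) / y 1) * (L True b (s + int (m + Suc r)) * W m r (k - of_bool b) (s + 1))
     + lam (n (int m) * y (- int r) / y 1) * (L False b (s + int (m + Suc r)) * W (m - 1) (Suc r) (k - of_bool b) (s + 1))"
  defines "M \<equiv> int (m + Suc r)"
  shows "lam (n (int (Suc r)) * y (int m + 2) / y 1) * (L True b (s + M) * W (Suc m) r (k - of_bool b) s)
      + lam (n (int m + 1) * y (- int r) / y 1) * (L False b (s + M) * W m (Suc r) (k - of_bool b) s)
    = mu (n (M + 1) / n M) * (L False b s * Z b (k - of_bool b))
     + (mu (y (1 + sg b) / y 1) * (L False (\<not> b) s * Z b (k - of_bool (\<not> b)))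
       + mu (n 1 * y (1 + sg b * M) / (n M * y 1)) * (L False b s * Z (\<not> b) (k - of_bool b)))"
proof -
  have M: "M \<ge> 1" "n M \<noteq> 0" using n_nz[of M] by (auto simp: M_def)
  note nz = y_nz[of 1] y_nz[of 2] M(2)
  let ?x1 = "n (int (Suc r)) * y (int m + 2) / y 1"
  let ?x2 = "n (int (Suc r)) * y (int m + 2) * n 1 * y (1 - M) / (y 1 * n M * y 2)"
  let ?x1' = "n (int (Suc r)) * y (int m + 2) / y 2"
  let ?x3' = "n (int m) * y (1 - int r) / y 2"
  let ?x3 = "n (M + 1) / n M * ?x3'"
  \<comment> \<open>The splitting of the coefficient that fits both the exchange relation and the induction hypothesis.\<close>
  have x23: "n (int m + 1) * y (- int r) / y 1 = ?x2 + ?x3"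
  proof -
    have 1: "M + 2 - int (Suc r) = int m + 2" "M - int (Suc r) = int m" "M + 1 - int (Suc r) = int m + 1"
      "2 - int (Suc r) = 1 - int r" "1 - int (Suc r) = - int r" by (simp_all add: M_def)
    have "?x2 + ?x3 = (n 1 * n (int (Suc r)) * y (int m + 2) * y (1 - M) + n (M + 1) * n (int m) * y (1 - int r) * y 1) / (n M * y 1 * y 2)"
      using nz by (simp add: field_simps)
    also have "\<dots> = n M * n (int m + 1) * y 2 * y (- int r) / (n M * y 1 * y 2)"
      using addition1[of "int (Suc r)" M] unfolding 1 by simp
    finally show ?thesis using nz by simp
  qed
  have ZL: "L False c s * Z b k = lam ?x1' * (L False c s * L True b (s + M)) * W m r (k - of_bool b) (s + 1)
     + lam ?x3' * (L False c s * L False b (s + M)) * W (m - 1) (Suc r) (k - of_bool b) (s + 1)" for b c k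
    unfolding Z by (simp add: distrib_left L_lam_left T_mult T_divide T_n T_y M_def mult.assoc add_ac)
  define X where "X = (\<lambda>c. W m r (k - of_bool b - of_bool c) (s + 1))"
  define X' where "X' = (\<lambda>c. W (m - 1) (Suc r) (k - of_bool b - of_bool c) (s + 1))"
  \<comment> \<open>For $m = 0$ there is no minus sign to begin with, but then the coefficient is $0$.\<close>
  have X3: "lam ?x3 * (L False b (s + M) * W m (Suc r) (k - of_bool b) s)
      = lam ?x3 * (L False b (s + M) * (L False b s * X' b + L False (\<not> b) s * X' (\<not> b)))"
  proof (cases m)
    case 0
    then show ?thesis by (simp add: n_0 lam_0)
  next
    case (Suc m')
    then show ?thesis unfolding Suc W_False fused_Cons[of L False _ _ _ b] X'_def by simp
  qed
  have sw: "k - of_bool (\<not> b) - of_bool b = k - of_bool b - of_bool (\<not> b)" by simp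
  have row3: "lam ?x3 * (L False b (s + M) * L False (\<not> b) s)
     = mu (y (1 + sg b) / y 1) * (lam ?x3' * (L False (\<not> b) s * L False b (s + M)))
      + mu (n 1 * y (1 + sg b * M) / (n M * y 1)) * (lam ?x3' * (L False b s * L False (\<not> b) (s + M)))"
  proof -
    have "lam ?x3 * (L False b (s + M) * L False (\<not> b) s)
      = lam ?x3' * (mu (n (M + 1) / n M) * (L False b (s + M) * L False (\<not> b) s))"
      by (subst mult.commute) (simp only: lam_mult[of ?x3'] lam_n_divide mult.assoc)
    then show ?thesis unfolding row_normalised[OF M(1)] distrib_left lam_mu_left .
  qed
  have same3: "lam ?x3 * (L False b (s + M) * L False b s)
     = mu (n (M + 1) / n M) * (lam ?x3' * (L False b s * L False b (s + M)))"
    unfolding same[of False b "s + M"] lam_mult[of "n (M + 1) / n M"] lam_n_divide mult.assoc ..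
  have "lam ?x1 * (L True b (s + M) * W (Suc m) r (k - of_bool b) s)
      + lam (n (int m + 1) * y (- int r) / y 1) * (L False b (s + M) * W m (Suc r) (k - of_bool b) s)
     = lam ?x1 * (L True b (s + M) * (L False b s * X b + L False (\<not> b) s * X (\<not> b)))
      + lam ?x2 * (L False b (s + M) * (L True b s * X b + L True (\<not> b) s * X (\<not> b)))
      + lam ?x3 * (L False b (s + M) * (L False b s * X' b + L False (\<not> b) s * X' (\<not> b)))"
    unfolding x23 lam_add distrib_right X3
    unfolding W_False W_True fused_Cons[of L False _ _ _ b] fused_Cons[of L True _ _ _ b] X_def by (simp only: add.assoc)
  also have "\<dots> = (lam ?x1 * (L True b (s + M) * L False b s) + lam ?x2 * (L False b (s + M) * L True b s)) * X b
     + (lam ?x1 * (L True b (s + M) * L False (\<not> b) s) + lam ?x2 * (L False b (s + M) * L True (\<not> b) s)) * X (\<not> b)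
     + (lam ?x3 * (L False b (s + M) * L False b s)) * X' b + (lam ?x3 * (L False b (s + M) * L False (\<not> b) s)) * X' (\<not> b)"
    by (simp only: distrib_left distrib_right mult.assoc add_ac)
  also have "\<dots> = mu (n (M + 1) / n M) * (L False b s * Z b (k - of_bool b))
     + (mu (y (1 + sg b) / y 1) * (L False (\<not> b) s * Z b (k - of_bool (\<not> b)))
       + mu (n 1 * y (1 + sg b * M) / (n M * y 1)) * (L False b s * Z (\<not> b) (k - of_bool b)))"
    unfolding ZL sw row3 same3 unfolding M_def exchange_pair_same exchange_pair_mixed
    unfolding M_def[symmetric] X_def[symmetric] X'_def[symmetric]
    by (simp only: distrib_left distrib_right mult.assoc add_ac X_def X'_def)
  finally show ?thesis .
qed

text \<open>
  A factor with the largest exponent, in front of a fused product, is absorbed after summation over its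
  row sign. Here \<open>m\<close> and \<open>r\<close> count the minus and plus signs of the
  rows. When \<open>m\<close> or \<open>r\<close> is $0$, the term with a truncated difference has coefficient $0$.
\<close>
lemma fused_exchange:
  assumes "m + r = Suc M"
  shows "lam (n (int r) * y (int m + 1) / y 1) * (L True b (s + int M) * W m (r - 1) (k - of_bool b) s)
     + lam (n (int m) * y (1 - int r) / y 1) * (L False b (s + int M) * W (m - 1) r (k - of_bool b) s)
    = mu (exch_coeff b (int M) k) * W m r k s"
  using assms
proof (induction m arbitrary: M k s b)
  case 0
  then have r: "r = Suc M" by simp
  have "lam (n (int M + 1)) = mu (n (int M + 1))" by (rule lam_n)
  then show ?case using row_exchange[of M True b s k] y_nz[of 1] unfolding r
    by (simp add: n_0 lam_0 add.commute)
next
  case (Suc m)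
  show ?case
  proof (cases r)
    case 0
    with Suc.prems have M: "M = m" by simp
    then show ?thesis using row_exchange[of M False b s k] y_nz[of 1] unfolding M 0
      by (simp add: n_0 lam_0 add.commute lam_n)
  next
    case r: (Suc r')
    with Suc.prems have M: "M = m + Suc r'" "M = Suc (m + r')" by simp_all
    define Z where "Z = (\<lambda>b k. lam (n (int (Suc r')) * y (int m + 1) / y 1) * (L True b (s + int (m + Suc r')) * W m r' (k - of_bool b) (s + 1))
     + lam (n (int m) * y (- int r') / y 1) * (L False b (s + int (m + Suc r')) * W (m - 1) (Suc r') (k - of_bool b) (s + 1)))"
    have Z: "Z b k = mu (exch_coeff b (int M - 1) k) * W m r k (s + 1)" for b k
      using Suc.IH[of "m + r'" b "s + 1" k] by (simp add: Z_def M r add_ac)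
    have "mu (exch_coeff b (int M) k) * W (Suc m) r k s
      = mu (exch_coeff b (int M) k) * (L False True s * W m r (k - 1) (s + 1) + L False False s * W m r k (s + 1))"
      by simp
    also have "\<dots> = mu (n (int M + 1) / n (int M)) * (L False b s * Z b (k - of_bool b))
     + (mu (y (1 + sg b) / y 1) * (L False (\<not> b) s * Z b (k - of_bool (\<not> b)))
       + mu (n 1 * y (1 + sg b * int M) / (n (int M) * y 1)) * (L False b s * Z (\<not> b) (k - of_bool b)))"
      by (rule transfer_step[symmetric, OF Z]) (use M in simp)
    also have "\<dots> = lam (n (int (Suc r')) * y (int m + 2) / y 1) * (L True b (s + int M) * W (Suc m) r' (k - of_bool b) s)
      + lam (n (int m + 1) * y (- int r') / y 1) * (L False b (s + int M) * W m (Suc r') (k - of_bool b) s)"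
      unfolding M(1) by (rule fused_exchange_step[symmetric]) (simp add: Z_def)
    finally show ?thesis by (simp add: r add_ac)
  qed
qed

text \<open>
  A constant row word absorbs its factors with plus columns one after the other from the left. The
  factors with minus columns that remain commute with each other.
\<close>
lemma row_products:
  assumes "k \<le> N"
  shows "fused L (replicate N a) (int k) s
    = mu (\<Prod>i<k. n (int (N - i)) * y (1 - int i) / (n (int (k - i)) * y (int (N - k) + 1 - int i)))
      * prod_list (map (\<lambda>i. L a True (s + int N - 1 - int i)) [0..<k])
      * prod_list (map (\<lambda>i. L a False (s + int N - int k - 1 - int i)) [0..<N - k])"
  using assms
proof (induction k arbitrary: N)
  case 0
  have "fused L (replicate N a) 0 s = prod_list (map (\<lambda>i. L a False (s + int N - 1 - int i)) [0..<N])" for N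
  proof (induction N arbitrary: s)
    case (Suc N)
    have comm: "L a False s * prod_list (map (\<lambda>i. L a False (f i)) xs) = prod_list (map (\<lambda>i. L a False (f i)) xs) * L a False s"
      for f and xs :: "nat list"
    proof (induction xs)
      case (Cons x xs)
      have "L a False s * (L a False (f x) * dbracket) = L a False (f x) * (L a False s * dbracket)" for dbracket
        using same[of a False s "f x"] by (simp flip: mult.assoc)
      then show ?case using Cons by (simp add: mult.assoc)
    qed simp
    have "fused L (replicate (Suc N) a) 0 s = L a False s * prod_list (map (\<lambda>i. L a False (s + int N - int i)) [0..<N])"
      using Suc[of "s + 1"] by (simp add: fused_outside)
    then show ?case unfolding comm by simp
  qed simp
  then show ?case by (simp add: mu_1)
next
  case (Suc k)
  then obtain M where N: "N = Suc M" by (cases N) auto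
  with Suc.prems have k: "k \<le> M" by simp
  let ?K = "\<lambda>k N. \<Prod>i<k. n (int (N - i)) * y (1 - int i) / (n (int (k - i)) * y (int (N - k) + 1 - int i))"
  let ?c = "n (int N) * y 1 / (n (int (Suc k)) * y (int (N - Suc k) + 1))"
  have nz: "n (int (Suc k)) \<noteq> 0" "y (int (N - Suc k) + 1) \<noteq> 0" "y 1 \<noteq> 0" using n_nz y_nz by auto
  let ?d = "n (int (Suc k)) * y (int (N - Suc k) + 1) / y 1"
  have d: "?d \<noteq> 0" using nz by simp
  have "int M + 2 - int (Suc k) = int (N - Suc k) + 1" using N k by simp
  then have "exch_coeff True (int M) (int (Suc k)) = ?d" by (simp only: exch_coeff_def if_True)
  with row_exchange[of M a True s "int (Suc k)"]
  have "mu ?d * fused L (replicate N a) (int (Suc k)) s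
      = mu (n (int N)) * (L a True (s + int M) * fused L (replicate M a) (int k) s)"
    by (simp add: N add.commute)
  also have "n (int N) = ?d * ?c" using nz by simp
  finally have "mu ?d * fused L (replicate N a) (int (Suc k)) s
      = mu ?d * (mu ?c * (L a True (s + int M) * fused L (replicate M a) (int k) s))"
    by (simp only: mu_mult mult.assoc)
  then have "fused L (replicate N a) (int (Suc k)) s = mu ?c * (L a True (s + int M) * fused L (replicate M a) (int k) s)"
    by (rule mu_cancel[OF d])
  also have "\<dots> = mu (?c * T (- 1) (?K k M)) * (L a True (s + int M) *
      prod_list (map (\<lambda>i. L a True (s + int M - 1 - int i)) [0..<k])
      * prod_list (map (\<lambda>i. L a False (s + int M - int k - 1 - int i)) [0..<M - k]))"
    unfolding Suc.IH[OF k] by (simp add: L_mu_left mu_mu mult.assoc)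
  also have "?c * T (- 1) (?K k M) = ?K (Suc k) N"
  proof -
    show ?thesis unfolding prod.lessThan_Suc_shift T_prod
      by (simp add: T_mult T_divide T_n T_y N algebra_simps)
  qed
  also have "L a True (s + int M) * prod_list (map (\<lambda>i. L a True (s + int M - 1 - int i)) [0..<k])
     = prod_list (map (\<lambda>i. L a True (s + int N - 1 - int i)) [0..<Suc k])"
    by (subst map_upt_Suc) (simp add: N algebra_simps)
  also have "(\<lambda>i. L a False (s + int M - int k - 1 - int i)) = (\<lambda>i. L a False (s + int N - int (Suc k) - 1 - int i))"
    by (simp add: N algebra_simps)
  also have "M - k = N - Suc k" by (simp add: N)
  finally show ?case by (simp only: mult.assoc)
qed

end

context RLL_algebra
begin

lemma L_list_mu:
  "prod_list (map (\<lambda>i. L a b (h i)) xs) * mu f = mu (T (- sg b * int (length xs)) f) * prod_list (map (\<lambda>i. L a b (h i)) xs)"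
proof (induction xs arbitrary: f)
  case (Cons x xs)
  have "- sg b + - sg b * int (length xs) = - sg b * int (length (x # xs))" by (simp add: algebra_simps)
  then show ?case
    using Cons by (simp only: list.map prod_list.Cons mult.assoc L_mu_left T_T)
qed (simp add: T_0)

text \<open>
  The coefficient of the second block is moved to the left past the first block, which has \<open>m\<close> plus
  columns and $k_1 - m$ minus columns; this causes the shift.
\<close>
lemma two_rows:
  fixes m l k1 k2 :: nat
  assumes "m \<le> k1" "l \<le> k2"
  defines "K \<equiv> \<lambda>l k. \<Prod>i<l. n (int (k - i)) * y (1 - int i) / (n (int (l - i)) * y (int (k - l) + 1 - int i))"
  shows "fused L (replicate k1 False) (int m) 0 * fused L (replicate k2 True) (int l) (int k1)
    = mu (K m k1 * T (int k1 - 2 * int m) (K l k2))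
      * prod_list (map (\<lambda>i. L False True (int k1 - 1 - int i)) [0..<m])
      * prod_list (map (\<lambda>i. L False False (int k1 - int m - 1 - int i)) [0..<k1 - m])
      * prod_list (map (\<lambda>i. L True True (int k1 + int k2 - 1 - int i)) [0..<l])
      * prod_list (map (\<lambda>i. L True False (int k1 + int k2 - int l - 1 - int i)) [0..<k2 - l])"
proof -
  have "- sg True * int (length [0..<m]) + - sg False * int (length [0..<k1 - m]) = int k1 - 2 * int m"
    using assms(1) by (simp add: of_nat_diff)
  moreover have "P * Q * mu f = mu (T (- sg True * int (length [0..<m]) + - sg False * int (length [0..<k1 - m])) f) * (P * Q)"
    if "P = prod_list (map (\<lambda>i. L False True (h i)) [0..<m])" "Q = prod_list (map (\<lambda>i. L False False (h' i)) [0..<k1 - m])"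
    for P Q f h h'
  proof -
    have "P * Q * mu f = P * (Q * mu f)" by (simp only: mult.assoc)
    also have "Q * mu f = mu (T (- sg False * int (length [0..<k1 - m])) f) * Q"
      unfolding that L_list_mu ..
    also have "P * (mu g * Q) = (P * mu g) * Q" for g by (simp only: mult.assoc)
    also have "P * mu g = mu (T (- sg True * int (length [0..<m])) g) * P" for g
      unfolding that L_list_mu ..
    finally show ?thesis by (simp only: T_T mult.assoc)
  qed
  ultimately have move: "P * Q * mu f = mu (T (int k1 - 2 * int m) f) * (P * Q)"
    if "P = prod_list (map (\<lambda>i. L False True (h i)) [0..<m])" "Q = prod_list (map (\<lambda>i. L False False (h' i)) [0..<k1 - m])"
    for P Q f h h' using that by (simp only:)
  define P Q where "P = prod_list (map (\<lambda>i. L False True (int k1 - 1 - int i)) [0..<m])"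
    and "Q = prod_list (map (\<lambda>i. L False False (int k1 - int m - 1 - int i)) [0..<k1 - m])"
  have 1: "fused L (replicate k1 False) (int m) 0 = mu (K m k1) * P * Q"
    using row_products[OF assms(1), of False 0] unfolding K_def P_def Q_def by simp
  have 2: "fused L (replicate k2 True) (int l) (int k1) = mu (K l k2)
      * prod_list (map (\<lambda>i. L True True (int k1 + int k2 - 1 - int i)) [0..<l])
      * prod_list (map (\<lambda>i. L True False (int k1 + int k2 - int l - 1 - int i)) [0..<k2 - l])"
    using row_products[OF assms(2), of True "int k1"] unfolding K_def by simp
  have "mu (K m k1) * P * Q * (mu (K l k2) * A * B) = mu (K m k1) * (P * Q * mu (K l k2)) * A * B" for A B
    by (simp only: mult.assoc)
  then show ?thesis unfolding 1 2 move[OF P_def Q_def] P_def[symmetric] Q_def[symmetric]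
    by (simp only: mult.assoc mu_mult)
qed

end

text \<open>
  The elements \<open>d i\<close> stand for the inverse determinants, and \<open>c\<close> for the reflection of the
  spectral parameters.
\<close>
locale transposed_RLL = RLL_algebra lam mu T y n L
  for lam mu :: "'k::field \<Rightarrow> 'r::{ring, monoid_mult}" and T y n L +
  fixes d :: "int \<Rightarrow> 'r" and c :: int
  assumes d_central: "d i * x = x * d i"
begin

text \<open>
  The image of $L_{ab}$ under the composition of antipode and star.
\<close>
definition L' :: "bool \<Rightarrow> bool \<Rightarrow> int \<Rightarrow> 'r" where
  "L' a b i = L b a (c - i) * (mu (y 1) * lam (1 / y 1)) * d i"

text \<open>
  In the variable $\mu$ the quotient of norm factors cancels the coefficient produced by
  \<open>fused_exchange\<close>, up to a constant.
\<close>
lemma gram_exch_coeff: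
  assumes "m' = m1 + of_bool (\<not> b)" "r' = r1 + of_bool b" "m' + r' = Suc M"
  shows "gram m' r' * T (- sg b) (y 1 / gram m1 r1) * exch_coeff b (int M) (int r') = n (int (Suc M))"
proof -
  have inv: "T i (y 1 / gram m1 r1) = 1 / T i (gram m1 r1 / y 1)" for i
    by (simp add: T_divide)
  have gm: "gram m' r' \<noteq> 0" by (rule gram_nz)
  show ?thesis
  proof (cases b)
    case True
    then have r: "r' = Suc r1" "m' = m1" using assms by auto
    have M: "int M + 2 - int (Suc r1) = int m1 + 1" "int (m1 + Suc r1) = int (Suc M)" using assms r by auto
    show ?thesis
      using True gm n_nz[of "int (Suc M)"] n_nz[of "int (Suc r1)"] y_nz[of 1] y_nz[of "int m1 + 1"]
      unfolding exch_coeff_def inv r by (simp only: if_True T_gram_True M) simp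
  next
    case False
    then have r: "r' = r1" "m' = Suc m1" using assms by auto
    have M: "int M + 1 - int r1 = int (Suc m1)" "int (Suc m1 + r1) = int (Suc M)" using assms r by auto
    show ?thesis
      using False gm n_nz[of "int (Suc M)"] n_nz[of "int (Suc m1)"] y_nz[of 1] y_nz[of "1 - int r1"]
      unfolding exch_coeff_def inv r by (simp only: if_False minus_minus T_gram_False M) simp
  qed
qed

lemma d_left: "d i * (x * z) = x * (d i * z)"
  by (simp add: d_central[of i x] flip: mult.assoc)

lemma L'_mult:
  assumes "X = mu (1 / f) * (lam h * (V * D))"
  shows "L' b a s * X = (mu (T (- sg b) (y 1 / f)) * lam (T (- sg a) (h / y 1))) * (L a b (c - s) * V) * (d s * D)"
proof -
  have "L' b a s * X = L a b (c - s) * (mu (y 1) * (lam (1 / y 1) * (mu (1 / f) * (lam h * (V * (d s * D))))))"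
    unfolding L'_def assms mult.assoc d_left ..
  also have "L a b (c - s) * (mu (y 1) * (lam (1 / y 1) * (mu (1 / f) * (lam h * (V * (d s * D))))))
    = L a b (c - s) * (mu (y 1 * (1 / f)) * (lam (1 / y 1 * h) * (V * (d s * D))))"
    unfolding lam_mu_left mu_mu lam_lam ..
  also have "\<dots> = mu (T (- sg b) (y 1 * (1 / f))) * (lam (T (- sg a) (1 / y 1 * h)) * (L a b (c - s) * (V * (d s * D))))"
    unfolding L_mu_left L_lam_left ..
  finally show ?thesis by (simp add: mult.assoc)
qed

text \<open>
  A fused product of the transposed matrix with decreasing exponents agrees with one of the matrix itself
  with increasing exponents, up to a function of $\lambda$ and a function of $\mu$. The signs \<open>m'\<close>, \<open>r'\<close> count the
  rows on the left and \<open>m\<close>, \<open>r\<close> the columns, and conversely on the right.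
\<close>
theorem fused_transpose:
  assumes "m + r = N" "m' + r' = N"
  shows "mu (gram m' r') * fused L' (replicate m' False @ replicate r' True) (int r) s
    = lam (gram m r) * W m r (int r') (c - s - int N + 1) * prod_list (map (\<lambda>i. d (s + int i)) [0..<N])"
  using assms
proof (induction N arbitrary: m r m' r' s)
  case 0
  have "lam (n 1 / n 1) = mu (n 1 / n 1)" by (rule lam_n_divide)
  have "gram 0 0 = 1" using y_nz[of 1] by (simp add: gram_def)
  with 0 show ?case by (simp add: lam_1 mu_1)
next
  case (Suc M)
  \<comment> \<open>The first row sign is minus as long as there is one.\<close>
  define b where "b \<longleftrightarrow> m' = 0"
  define m1 r1 where "m1 = m' - of_bool (\<not> b)" and "r1 = r' - of_bool b"
  have mr1: "m' = m1 + of_bool (\<not> b)" "r' = r1 + of_bool b" "m1 + r1 = M"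
    using Suc.prems(2) by (auto simp: b_def m1_def r1_def)
  have list: "replicate m' False @ replicate r' True = b # replicate m1 False @ replicate r1 True"
    using Suc.prems(2) by (cases m') (auto simp: b_def m1_def r1_def)
  define t where "t = c - s - int M"
  let ?D = "prod_list (map (\<lambda>i. d (s + 1 + int i)) [0..<M])"
  let ?fused = "\<lambda>k. fused L' (replicate m1 False @ replicate r1 True) k (s + 1)"
  have IH: "?fused (int r0) = mu (1 / gram m1 r1) * (lam (gram m0 r0) * (W m0 r0 (int r1) t * ?D))"
    if "m0 + r0 = M" for m0 r0
  proof -
    have "mu (1 / gram m1 r1) * (mu (gram m1 r1) * ?fused (int r0))
      = mu (1 / gram m1 r1) * (lam (gram m0 r0) * W m0 r0 (int r1) (c - (s + 1) - int M + 1) * ?D)"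
      using Suc.IH[OF that mr1(3), of "s + 1"] by simp
    moreover have "c - (s + 1) - int M + 1 = t" by (simp add: t_def)
    ultimately show ?thesis using gram_nz[of m1 r1] unfolding mu_mu by (simp add: mu_1 mult.assoc)
  qed
  define F where "F = mu (T (- sg b) (y 1 / gram m1 r1))"
  define K where "K = lam (gram m r / n (int (Suc M)))"
  have T: "c - s = t + int M" by (simp add: t_def)
  have r1': "int r1 = int r' - of_bool b" using mr1 by auto
  have plus: "L' b True s * ?fused (int r - 1) = F * K * (lam (n (int r) * y (int m + 1) / y 1) *
      (L True b (c - s) * W m (r - 1) (int r1) t)) * (d s * ?D)"
  proof (cases r)
    case 0
    then show ?thesis by (simp add: fused_outside n_0 lam_0)
  next
    case (Suc r0)
    then have "int r - 1 = int r0" "m + r0 = M" using Suc.prems by auto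
    have "L' b True s * ?fused (int r - 1) = F * lam (T (- 1) (gram m r0 / y 1)) * (L True b (c - s) * W m r0 (int r1) t) * (d s * ?D)"
      using L'_mult[OF IH[OF \<open>m + r0 = M\<close>], of b True s] \<open>int r - 1 = int r0\<close> by (simp add: F_def)
    also have "T (- 1) (gram m r0 / y 1) = gram m r / n (int (Suc M)) * (n (int r) * y (int m + 1) / y 1)"
      using T_gram_True[of m r0] Suc \<open>m + r0 = M\<close> by auto
    finally show ?thesis unfolding lam_mult[of "gram m r / n (int (Suc M))"] K_def
      by (simp add: Suc mult.assoc)
  qed
  have minus: "L' b False s * ?fused (int r) = F * K * (lam (n (int m) * y (1 - int r) / y 1) *
      (L False b (c - s) * W (m - 1) r (int r1) t)) * (d s * ?D)"
  proof (cases m)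
    case 0
    then have "r = Suc M" using Suc.prems by simp
    with 0 show ?thesis using mr1 by (simp add: fused_outside n_0 lam_0)
  next
    case (Suc m0)
    then have m0: "m0 + r = M" using Suc.prems by auto
    have "L' b False s * ?fused (int r) = F * lam (T 1 (gram m0 r / y 1)) * (L False b (c - s) * W m0 r (int r1) t) * (d s * ?D)"
      using L'_mult[OF IH[OF m0], of b False s] by (simp add: F_def)
    also have "T 1 (gram m0 r / y 1) = gram m r / n (int (Suc M)) * (n (int m) * y (1 - int r) / y 1)"
      using T_gram_False[of m0 r] Suc m0 by auto
    finally show ?thesis unfolding lam_mult[of "gram m r / n (int (Suc M))"] K_def
      by (simp add: Suc mult.assoc)
  qed
  have "fused L' (replicate m' False @ replicate r' True) (int r) s
     = F * K * (lam (n (int r) * y (int m + 1) / y 1) * (L True b (t + int M) * W m (r - 1) (int r' - of_bool b) t)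
         + lam (n (int m) * y (1 - int r) / y 1) * (L False b (t + int M) * W (m - 1) r (int r' - of_bool b) t)) * (d s * ?D)"
    unfolding list fused.simps plus minus distrib_left distrib_right unfolding T r1' ..
  also have "\<dots> = F * K * (mu (exch_coeff b (int M) (int r')) * W m r (int r') t) * (d s * ?D)"
    unfolding fused_exchange[OF Suc.prems(1)] ..
  also have "mu (gram m' r') * \<dots> = mu (gram m' r' * T (- sg b) (y 1 / gram m1 r1) * exch_coeff b (int M) (int r'))
      * (K * W m r (int r') t * (d s * ?D))"
    unfolding F_def K_def mult.assoc lam_mu_left by (simp only: mu_mult mult.assoc)
  also have "\<dots> = lam (n (int (Suc M))) * (K * W m r (int r') t * (d s * ?D))"
    unfolding gram_exch_coeff[OF mr1(1,2) Suc.prems(2)] lam_n ..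
  also have "\<dots> = lam (gram m r) * W m r (int r') t * (d s * ?D)"
    using n_nz[of "int (Suc M)"] unfolding K_def mult.assoc lam_lam by simp
  also have "d s * ?D = prod_list (map (\<lambda>i. d (s + int i)) [0..<Suc M])"
    by (subst map_upt_Suc) (simp add: algebra_simps)
  also have "t = c - s - int (Suc M) + 1" by (simp add: t_def)
  finally show ?case .
qed

end

section \<open>Brackets as meromorphic functions\<close>

text \<open>
  Identities in the function field are reduced to pointwise ones on representatives.
\<close>
lemma mero_cases:
  obtains F where "F meromorphic_on UNIV" "f = mero F"
proof -
  have "mero_rel (rep_mero f) (rep_mero f)"
    by (rule Quotient3_rep_reflp[OF Quotient3_mero])
  moreover have "f = mero (rep_mero f)"
    unfolding mero_def by (simp add: Quotient3_abs_rep[OF Quotient3_mero])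
  ultimately show thesis using that by (auto simp: mero_rel_def)
qed

context
  fixes F G :: "complex \<Rightarrow> complex"
  assumes F: "F meromorphic_on UNIV" and G: "G meromorphic_on UNIV"
begin

lemma mero_add: "mero F + mero G = mero (\<lambda>x. F x + G x)"
  and mero_mult: "mero F * mero G = mero (\<lambda>x. F x * G x)"
  and mero_divide: "mero F / mero G = mero (\<lambda>x. F x / G x)"
  using F G by (simp_all add: mero_def mero_rel_def plus_mero.abs_eq times_mero.abs_eq divide_mero.abs_eq)

end

context
  fixes F :: "complex \<Rightarrow> complex"
  assumes F: "F meromorphic_on UNIV"
begin

lemma mero_uminus: "- mero F = mero (\<lambda>x. - F x)"
  using F by (simp add: mero_def mero_rel_def uminus_mero.abs_eq)

lemma shift_mero: "shift a (mero F) = mero (\<lambda>x. F (x + a))"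
  using F by (simp add: mero_def mero_rel_def shift.abs_eq)

lemma mero_bar_mero: "mero_bar (mero F) = mero (\<lambda>x. cnj (F (cnj x)))"
  using F by (simp add: mero_def mero_rel_def mero_bar.abs_eq)

lemma mero_eq_0_iff: "mero F = 0 \<longleftrightarrow> eventually (\<lambda>x. F x = 0) (cosparse UNIV)"
proof -
  have "mero F = 0 \<longleftrightarrow> mero_rel F (\<lambda>_. 0)"
    unfolding mero_def zero_mero_def
    using Quotient3_rel[OF Quotient3_mero, of F "\<lambda>_. 0"] F by (auto simp: mero_rel_def meromorphic_on_const)
  then show ?thesis using F by (simp add: mero_rel_def meromorphic_on_const)
qed

end

lemma meromorphic_shift: "F meromorphic_on UNIV \<Longrightarrow> (\<lambda>x. F (x + a)) meromorphic_on UNIV"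
  for F :: "complex \<Rightarrow> complex"
  by (rule meromorphic_on_compose) (auto intro!: analytic_intros)

lemma mero_1: "mero (\<lambda>_. 1) = 1"
  by (simp add: mero_def one_mero_def)

lemma mero_prod:
  "(\<And>i. i \<in> A \<Longrightarrow> F i meromorphic_on UNIV) \<Longrightarrow> (\<Prod>i\<in>A. mero (F i)) = mero (\<lambda>x. \<Prod>i\<in>A. F i x)"
  by (induction A rule: infinite_finite_induct) (auto simp: mero_1 mero_mult meromorphic_on_prod)

lemma shift_mult: "shift a (f * g) = shift a f * shift a g"
  by (rule mero_cases[of f], rule mero_cases[of g])
     (auto simp: mero_mult shift_mero meromorphic_on_mult meromorphic_shift)

lemma shift_divide: "shift a (f / g) = shift a f / shift a g"
  by (rule mero_cases[of f], rule mero_cases[of g])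
     (auto simp: mero_divide shift_mero meromorphic_on_divide meromorphic_shift)

lemma shift_shift: "shift a (shift b f) = shift (a + b) f"
  by (rule mero_cases[of f]) (auto simp: shift_mero meromorphic_shift add_ac)

lemma shift_0: "shift 0 f = f"
  by (rule mero_cases[of f]) (auto simp: shift_mero)

lemma mero_bar_mult: "mero_bar (f * g) = mero_bar f * mero_bar g"
  by (rule mero_cases[of f], rule mero_cases[of g])
     (auto simp: mero_mult mero_bar_mero meromorphic_on_mult meromorphic_on_UNIV_cnj_cnj)

lemma mero_bar_divide: "mero_bar (f / g) = mero_bar f / mero_bar g"
  by (rule mero_cases[of f], rule mero_cases[of g])
     (auto simp: mero_divide mero_bar_mero meromorphic_on_divide meromorphic_on_UNIV_cnj_cnj)

context elliptic_params
begin

lemma holomorphic_bracket: "bracket holomorphic_on UNIV"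
  unfolding bracket_def[abs_def] qpow_def by (intro holomorphic_intros) auto

lemma meromorphic_bracket: "(\<lambda>x. bracket (x + a)) meromorphic_on UNIV"
  by (rule meromorphic_shift)
     (simp add: holomorphic_bracket analytic_on_imp_meromorphic_on analytic_on_open)

definition dbracket :: "int \<Rightarrow> mero" where "dbracket i = mero (\<lambda>x. bracket (x + of_int i))"
definition cbracket :: "int \<Rightarrow> mero" where "cbracket i = mero (\<lambda>_. bracket (of_int i))"

text \<open>
  Vanishing off a sparse set would imply vanishing at $x = 1 - i$, by continuity, although
  $[1] \ne 0$.
\<close>
lemma dbracket_nz: "dbracket i \<noteq> 0"
proof
  assume "dbracket i = 0"
  then have "eventually (\<lambda>x. bracket (x + of_int i) = 0) (at (1 - of_int i))"
    unfolding dbracket_def mero_eq_0_iff[OF meromorphic_bracket]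
    by (simp add: eventually_cosparse_open_eq)
  moreover have "((\<lambda>x. bracket (x + of_int i)) \<longlongrightarrow> bracket (1 - of_int i + of_int i)) (at (1 - of_int i))"
  proof -
    have "isCont bracket (1 - of_int i + of_int i)"
      using holomorphic_on_imp_continuous_on[OF holomorphic_bracket] by (auto simp: continuous_on_eq_continuous_at)
    then have "isCont (\<lambda>x. bracket (x + of_int i)) (1 - of_int i)"
      by (intro continuous_at_compose[of _ "\<lambda>x. x + of_int i" bracket, unfolded o_def] continuous_intros)
    then show ?thesis by (simp add: isCont_def)
  qed
  ultimately have "bracket (1 - of_int i + of_int i) = 0"
    using tendsto_unique[OF trivial_limit_at _ tendsto_eventually] by blast
  then show False using bracket_int_nz[of 1] by simp
qed

lemma cbracket_nz: "i \<noteq> 0 \<Longrightarrow> cbracket i \<noteq> 0"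
proof
  assume "i \<noteq> 0" "cbracket i = 0"
  then have "eventually (\<lambda>_. bracket (of_int i) = 0) (cosparse (UNIV :: complex set))"
    unfolding cbracket_def by (subst (asm) mero_eq_0_iff) auto
  then show False using bracket_int_nz[OF \<open>i \<noteq> 0\<close>] by simp
qed

lemma dbracket_addition:
  assumes "a + a' = b + b'" "b + b' = c + c'"
  shows "dbracket a * dbracket a' * cbracket (b - c') * cbracket (b - c) + dbracket b * dbracket b' * cbracket (c - a') * cbracket (c - a)
        + dbracket c * dbracket c' * cbracket (a - b') * cbracket (a - b) = 0"
proof -
  have "dbracket a * dbracket a' * cbracket (b - c') * cbracket (b - c) + dbracket b * dbracket b' * cbracket (c - a') * cbracket (c - a)
        + dbracket c * dbracket c' * cbracket (a - b') * cbracket (a - b)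
    = mero (\<lambda>z. bracket (z + of_int a) * bracket (z + of_int a') * bracket (of_int (b - c')) * bracket (of_int (b - c))
    + bracket (z + of_int b) * bracket (z + of_int b') * bracket (of_int (c - a')) * bracket (of_int (c - a))
    + bracket (z + of_int c) * bracket (z + of_int c') * bracket (of_int (a - b')) * bracket (of_int (a - b)))"
    unfolding dbracket_def cbracket_def
    by (simp only: mero_mult mero_add meromorphic_bracket meromorphic_on_mult meromorphic_on_add meromorphic_on_const)
  also have "\<dots> = 0"
    unfolding bracket_addition[OF assms] by (simp add: mero_def zero_mero_def)
  finally show ?thesis .
qed

lemma shift_dbracket: "shift (of_int i) (dbracket j) = dbracket (j + i)"
  by (simp add: dbracket_def shift_mero meromorphic_bracket add_ac)

lemma shift_cbracket: "shift a (cbracket j) = cbracket j"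
  by (simp add: cbracket_def shift_mero meromorphic_on_const)

lemma cbracket_0: "cbracket 0 = 0"
  by (simp add: cbracket_def bracket_0 mero_def zero_mero_def)

lemma cbracket_minus: "cbracket (- i) = - cbracket i"
  by (simp add: cbracket_def mero_uminus bracket_minus meromorphic_on_const)

end

section \<open>The algebra as a type\<close>

lemma ring_free_ring: "ring free_ring"
proof (rule ringI)
  show "abelian_group free_ring"
  proof (rule abelian_groupI)
    fix x assume "x \<in> carrier free_ring"
    show "\<exists>y\<in>carrier free_ring. y \<oplus>\<^bsub>free_ring\<^esub> x = \<zero>\<^bsub>free_ring\<^esub>"
      by (rule bexI[of _ "- x"]) (auto simp: free_ring_def)
  qed (auto simp: free_ring_def add_ac)
  show "monoid free_ring"
    by (rule monoidI) (auto simp: free_ring_def mult.assoc)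
qed (auto simp: free_ring_def algebra_simps)

lemma ideal_FR: "ideal (FR_ideal p q) free_ring"
  unfolding FR_ideal_def by (rule ring.genideal_ideal[OF ring_free_ring]) (simp add: free_ring_def)

lemma free_ring_minus: "x \<ominus>\<^bsub>free_ring\<^esub> y = x - y"
proof -
  interpret ring free_ring by (rule ring_free_ring)
  have "\<ominus>\<^bsub>free_ring\<^esub> y = - y"
    by (rule minus_equality) (auto simp: free_ring_def)
  then show ?thesis by (simp add: a_minus_def) (simp add: free_ring_def)
qed

lemma FR_ideal_0: "0 \<in> FR_ideal p q"
  using additive_subgroup.zero_closed[OF ideal.axioms(1)[OF ideal_FR, of p q]] by (simp add: free_ring_def)

lemma FR_ideal_add: "x \<in> FR_ideal p q \<Longrightarrow> y \<in> FR_ideal p q \<Longrightarrow> x + y \<in> FR_ideal p q"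
  using additive_subgroup.a_closed[OF ideal.axioms(1)[OF ideal_FR, of p q]] by (simp add: free_ring_def)

lemma FR_ideal_mult_left: "x \<in> FR_ideal p q \<Longrightarrow> y * x \<in> FR_ideal p q"
  using ideal.I_l_closed[OF ideal_FR, of x p q y] by (simp add: free_ring_def)

lemma FR_ideal_mult_right: "x \<in> FR_ideal p q \<Longrightarrow> x * y \<in> FR_ideal p q"
  using ideal.I_r_closed[OF ideal_FR, of x p q y] by (simp add: free_ring_def)

lemma FR_ideal_uminus: "x \<in> FR_ideal p q \<Longrightarrow> - x \<in> FR_ideal p q"
  using FR_ideal_mult_left[of x p q "- 1"] by simp

lemma FR_ideal_diff_commute: "x - y \<in> FR_ideal p q \<Longrightarrow> y - x \<in> FR_ideal p q"
  using FR_ideal_uminus[of "x - y" p q] by simp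

lemma FR_ideal_eqs: "(x, y) \<in> FR_eqs p q \<Longrightarrow> x - y \<in> FR_ideal p q"
proof -
  assume "(x, y) \<in> FR_eqs p q"
  then have "x - y \<in> {x - y | x y. (x, y) \<in> FR_eqs p q}" by blast
  then show ?thesis unfolding FR_ideal_def
    using ring.genideal_self[OF ring_free_ring, of "{x - y | x y. (x, y) \<in> FR_eqs p q}"]
    by (auto simp: free_ring_def)
qed

lemma cls_eq_iff: "cls p q x = cls p q y \<longleftrightarrow> x - y \<in> FR_ideal p q"
  unfolding cls_def free_ring_minus[symmetric]
  by (rule ring.quotient_eq_iff_same_a_r_cos[OF ring_free_ring ideal_FR, symmetric]) (auto simp: free_ring_def)

lemma cls_hom:
  shows cls_carrier: "cls p q x \<in> carrier (FRU2 p q)"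
    and cls_mult: "cls p q x \<otimes>\<^bsub>FRU2 p q\<^esub> cls p q y = cls p q (x * y)"
    and cls_add: "cls p q x \<oplus>\<^bsub>FRU2 p q\<^esub> cls p q y = cls p q (x + y)"
    and cls_one: "\<one>\<^bsub>FRU2 p q\<^esub> = cls p q 1"
proof -
  have *: "(+>\<^bsub>free_ring\<^esub>) (FR_ideal p q) \<in> ring_hom free_ring (FRU2 p q)"
    unfolding FRU2_def by (rule ideal.rcos_ring_hom[OF ideal_FR])
  have c: "x \<in> carrier free_ring" for x by (simp add: free_ring_def)
  show "cls p q x \<in> carrier (FRU2 p q)"
    unfolding cls_def by (rule ring_hom_closed[OF * c])
  show "cls p q x \<otimes>\<^bsub>FRU2 p q\<^esub> cls p q y = cls p q (x * y)"
    using ring_hom_mult[OF * c[of x] c[of y]] by (simp add: cls_def) (simp add: free_ring_def)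
  show "cls p q x \<oplus>\<^bsub>FRU2 p q\<^esub> cls p q y = cls p q (x + y)"
    using ring_hom_add[OF * c[of x] c[of y]] by (simp add: cls_def) (simp add: free_ring_def)
  show "\<one>\<^bsub>FRU2 p q\<^esub> = cls p q 1"
    using ring_hom_one[OF *] by (simp add: cls_def) (simp add: free_ring_def)
qed

text \<open>
  Families indexed by all pairs $(p,q)$, modulo the ideal in each component.
\<close>
definition fr_rel :: "(real \<times> real \<Rightarrow> falg) \<Rightarrow> (real \<times> real \<Rightarrow> falg) \<Rightarrow> bool" where
  "fr_rel f g \<longleftrightarrow> (\<forall>p q. f (p, q) - g (p, q) \<in> FR_ideal p q)"

lemma equivp_fr_rel: "equivp fr_rel"
proof (rule equivpI)
  show "reflp fr_rel" by (auto simp: reflp_def fr_rel_def FR_ideal_0)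
  show "symp fr_rel" by (auto simp: symp_def fr_rel_def intro: FR_ideal_diff_commute)
  show "transp fr_rel"
  proof (rule transpI)
    fix f g h assume *: "fr_rel f g" "fr_rel g h"
    show "fr_rel f h" unfolding fr_rel_def
    proof (intro allI)
      fix p q
      have "(f (p, q) - g (p, q)) + (g (p, q) - h (p, q)) \<in> FR_ideal p q"
        using * by (intro FR_ideal_add) (auto simp: fr_rel_def)
      then show "f (p, q) - h (p, q) \<in> FR_ideal p q" by simp
    qed
  qed
qed

text \<open>
  The product over all $(p,q)$ of the algebras $\mathcal{F}_R(U(2))$. Unlike a single one of them it is
  a type without parameters.
\<close>
quotient_type fr = "real \<times> real \<Rightarrow> falg" / fr_rel
  by (rule equivp_fr_rel)

instantiation fr :: "{ring, monoid_mult}"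
begin

lift_definition zero_fr :: fr is "\<lambda>_. 0" .
lift_definition one_fr :: fr is "\<lambda>_. 1" .
lift_definition plus_fr :: "fr \<Rightarrow> fr \<Rightarrow> fr" is "\<lambda>f g i. f i + g i"
proof -
  fix f f' g g' assume *: "fr_rel f f'" "fr_rel g g'"
  have "(f (p, q) - f' (p, q)) + (g (p, q) - g' (p, q)) \<in> FR_ideal p q" for p q
    using * by (intro FR_ideal_add) (auto simp: fr_rel_def)
  then show "fr_rel (\<lambda>i. f i + g i) (\<lambda>i. f' i + g' i)" by (simp add: fr_rel_def algebra_simps)
qed
lift_definition uminus_fr :: "fr \<Rightarrow> fr" is "\<lambda>f i. - f i"
  by (auto simp: fr_rel_def intro: FR_ideal_diff_commute)
lift_definition times_fr :: "fr \<Rightarrow> fr \<Rightarrow> fr" is "\<lambda>f g i. f i * g i"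
proof -
  fix f f' g g' assume *: "fr_rel f f'" "fr_rel g g'"
  have "(f (p, q) - f' (p, q)) * g (p, q) + f' (p, q) * (g (p, q) - g' (p, q)) \<in> FR_ideal p q" for p q
    using * by (intro FR_ideal_add FR_ideal_mult_left FR_ideal_mult_right) (auto simp: fr_rel_def)
  then show "fr_rel (\<lambda>i. f i * g i) (\<lambda>i. f' i * g' i)" by (simp add: fr_rel_def algebra_simps)
qed
definition minus_fr :: "fr \<Rightarrow> fr \<Rightarrow> fr" where "minus_fr x y = x + - y"

instance
proof
  fix x y z :: fr
  show "x + y + z = x + (y + z)" by transfer (simp add: fr_rel_def FR_ideal_0 algebra_simps)
  show "x + y = y + x" by transfer (simp add: fr_rel_def FR_ideal_0 algebra_simps)
  show "0 + x = x" by transfer (simp add: fr_rel_def FR_ideal_0 algebra_simps)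
  show "- x + x = 0" by transfer (simp add: fr_rel_def FR_ideal_0 algebra_simps)
  show "x - y = x + - y" by (rule minus_fr_def)
  show "x * y * z = x * (y * z)" by transfer (simp add: fr_rel_def FR_ideal_0 algebra_simps)
  show "1 * x = x" by transfer (simp add: fr_rel_def FR_ideal_0 algebra_simps)
  show "x * 1 = x" by transfer (simp add: fr_rel_def FR_ideal_0 algebra_simps)
  show "(x + y) * z = x * z + y * z" by transfer (simp add: fr_rel_def FR_ideal_0 algebra_simps)
  show "x * (y + z) = x * y + x * z" by transfer (simp add: fr_rel_def FR_ideal_0 algebra_simps)
qed

end

text \<open>
  Constant families. Relations valid for all $(p,q)$, such as those for the function fields, hold
  between them. Relations for one fixed pair only hold after multiplication by the central idempotent
  \<open>unit_at\<close> of their component.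
\<close>
definition \<kappa> :: "falg \<Rightarrow> fr" where "\<kappa> x = abs_fr (\<lambda>_. x)"

lemma \<kappa>_add: "\<kappa> (x + y) = \<kappa> x + \<kappa> y"
  and \<kappa>_mult: "\<kappa> (x * y) = \<kappa> x * \<kappa> y"
  and \<kappa>_0: "\<kappa> 0 = 0" and \<kappa>_1: "\<kappa> 1 = 1"
  by (simp_all add: \<kappa>_def plus_fr.abs_eq times_fr.abs_eq zero_fr_def one_fr_def)

lemma \<kappa>_eqI: "(\<And>p q. (x, y) \<in> FR_eqs p q) \<Longrightarrow> \<kappa> x = \<kappa> y"
  by (simp add: \<kappa>_def fr.abs_eq_iff fr_rel_def FR_ideal_eqs)

context
  fixes p q :: real
begin

definition unit_at :: fr where "unit_at = abs_fr (\<lambda>i. if i = (p, q) then 1 else 0)"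

definition \<iota> :: "falg \<Rightarrow> fr" where "\<iota> x = unit_at * \<kappa> x"

lemma unit_at_central: "unit_at * x = x * unit_at"
  unfolding unit_at_def
  by (induction x rule: fr.abs_induct) (auto simp: times_fr.abs_eq intro!: arg_cong[of _ _ abs_fr])

lemma unit_at_idem: "unit_at * unit_at = unit_at"
  unfolding unit_at_def by (auto simp: times_fr.abs_eq intro!: arg_cong[of _ _ abs_fr])

text \<open>
  This transfers equations between the product and the algebra for the given $(p,q)$.
\<close>
lemma \<iota>_eq_iff: "\<iota> x = \<iota> y \<longleftrightarrow> cls p q x = cls p q y"
  by (auto simp: \<iota>_def unit_at_def \<kappa>_def times_fr.abs_eq fr.abs_eq_iff fr_rel_def cls_eq_iff FR_ideal_0)

lemma \<iota>_add: "\<iota> (x + y) = \<iota> x + \<iota> y"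
  by (simp add: \<iota>_def \<kappa>_add distrib_left)

lemma \<iota>_0: "\<iota> 0 = 0"
  by (simp add: \<iota>_def \<kappa>_0)

lemma \<iota>_1: "\<iota> 1 = unit_at"
  by (simp add: \<iota>_def \<kappa>_1)

lemma \<iota>_mult_\<kappa>: "\<iota> (x * y) = \<kappa> x * \<iota> y"
  unfolding \<iota>_def \<kappa>_mult mult.assoc[symmetric] unit_at_central[of "\<kappa> x"] ..

lemma \<iota>_mult: "\<iota> (x * y) = \<iota> x * \<iota> y"
proof -
  have "\<iota> x * \<iota> y = (unit_at * \<kappa> x * unit_at) * \<kappa> y" by (simp add: \<iota>_def mult.assoc)
  also have "unit_at * \<kappa> x * unit_at = unit_at * unit_at * \<kappa> x"
    by (simp only: mult.assoc unit_at_central[of "\<kappa> x", symmetric])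
  finally show ?thesis by (simp add: unit_at_idem \<iota>_def \<kappa>_mult mult.assoc)
qed

lemma unit_at_\<iota>: "unit_at * \<iota> x = \<iota> x"
  by (simp add: \<iota>_def unit_at_idem flip: mult.assoc)

lemma \<iota>_eqI: "(x, y) \<in> FR_eqs p q \<Longrightarrow> \<iota> x = \<iota> y"
  by (simp add: \<iota>_eq_iff cls_eq_iff FR_ideal_eqs)

end

definition matgen :: "bool \<Rightarrow> bool \<Rightarrow> complex \<Rightarrow> falg" where
  "matgen a b z = (if a then if b then alpha z else beta z else if b then gam z else delta z)"

lemma \<kappa>_lam_gen: "\<kappa> (lam f) * \<kappa> (gen x) = \<kappa> (gen x) * \<kappa> (lam (shift (of_int (fst (bidegree x))) f))"
  unfolding \<kappa>_mult[symmetric] by (rule \<kappa>_eqI) (rule FR_eqs.lam_shift)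

lemma \<kappa>_mu_gen: "\<kappa> (mu f) * \<kappa> (gen x) = \<kappa> (gen x) * \<kappa> (mu (shift (of_int (snd (bidegree x))) f))"
  unfolding \<kappa>_mult[symmetric] by (rule \<kappa>_eqI) (rule FR_eqs.mu_shift)

lemma \<kappa>_lam_matgen: "\<kappa> (lam f) * \<kappa> (matgen a b z) = \<kappa> (matgen a b z) * \<kappa> (lam (shift (of_int (sg a)) f))"
  by (simp add: matgen_def alpha_def beta_def gam_def delta_def \<kappa>_lam_gen)

lemma \<kappa>_mu_matgen: "\<kappa> (mu f) * \<kappa> (matgen a b z) = \<kappa> (matgen a b z) * \<kappa> (mu (shift (of_int (sg b)) f))"
  by (simp add: matgen_def alpha_def beta_def gam_def delta_def \<kappa>_mu_gen)

lemma scalar_1: "scalar 1 = 1"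
  by (simp add: scalar_def)

lemma \<kappa>_lam_const: "\<kappa> (lam (mero (\<lambda>_. c))) = \<kappa> (scalar c)"
  by (rule \<kappa>_eqI) (rule FR_eqs.lam_const)

lemma \<kappa>_mu_const: "\<kappa> (mu (mero (\<lambda>_. c))) = \<kappa> (scalar c)"
  by (rule \<kappa>_eqI) (rule FR_eqs.mu_const)

context elliptic_params
begin

lemma dynamical_scalars_fr: "dynamical_scalars (\<lambda>f. \<kappa> (lam f)) (\<lambda>f. \<kappa> (mu f)) (\<lambda>i. shift (of_int i)) dbracket cbracket"
proof
  show "\<kappa> (lam f) * \<kappa> (mu g) = \<kappa> (mu g) * \<kappa> (lam f)" for f g
    using \<kappa>_lam_gen[of f "Mu g"] by (simp add: mu_def shift_0)
  show "\<kappa> (lam (f + g)) = \<kappa> (lam f) + \<kappa> (lam g)" for f g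
    unfolding \<kappa>_add[symmetric] by (rule \<kappa>_eqI) (rule FR_eqs.lam_add)
  show "\<kappa> (mu (f + g)) = \<kappa> (mu f) + \<kappa> (mu g)" for f g
    unfolding \<kappa>_add[symmetric] by (rule \<kappa>_eqI) (rule FR_eqs.mu_add)
  show "\<kappa> (lam (f * g)) = \<kappa> (lam f) * \<kappa> (lam g)" for f g
    unfolding \<kappa>_mult[symmetric] by (rule \<kappa>_eqI) (rule FR_eqs.lam_mult)
  show "\<kappa> (mu (f * g)) = \<kappa> (mu f) * \<kappa> (mu g)" for f g
    unfolding \<kappa>_mult[symmetric] by (rule \<kappa>_eqI) (rule FR_eqs.mu_mult)
  show "\<kappa> (lam 1) = 1" "\<kappa> (mu 1) = 1"
    using \<kappa>_lam_const[of 1] \<kappa>_mu_const[of 1] by (simp_all add: mero_1 scalar_1 \<kappa>_1)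
  show "\<kappa> (lam (cbracket i)) = \<kappa> (mu (cbracket i))" for i
    unfolding cbracket_def \<kappa>_lam_const \<kappa>_mu_const ..
qed (simp_all add: shift_mult shift_divide shift_shift shift_0 shift_dbracket shift_cbracket cbracket_0 cbracket_nz dbracket_nz cbracket_minus dbracket_addition flip: of_int_add)

text \<open>
  In terms of brackets all powers of \<open>q\<close> cancel. The identities hold pointwise, including the points
  where a denominator vanishes.
\<close>
lemma R_coeffs:
  fixes u :: int
  defines "z \<equiv> of_real q powi (2 * u)"
  defines "s \<equiv> theta p (of_real q ^ 2 * z)"
  shows "Ra p q s z = cbracket u * dbracket 2 / (cbracket (u + 1) * dbracket 1)"
    and "Rb p q s z = cbracket 1 * dbracket (1 - u) / (cbracket (u + 1) * dbracket 1)"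
    and "Rc p q s z = cbracket 1 * dbracket (1 + u) / (cbracket (u + 1) * dbracket 1)"
    and "Rd p q s z = cbracket u * dbracket 0 / (cbracket (u + 1) * dbracket 1)"
proof -
  have z: "z = E (2 * of_int u)" using E_int[of "2 * u"] by (simp add: z_def)
  have E2: "E 2 = E 1 * E 1" using E_double[of 1] by simp
  have q2: "of_real q ^ 2 = E (2 * 1)" using E_int[of 2] by simp
  have "of_real q ^ 2 * z = E (2 * (of_int u + 1))"
    unfolding z q2 by (simp flip: E_add add: algebra_simps)
  then have s: "s = E (of_int u + 1) * bracket (of_int u + 1)"
    unfolding s_def by (simp only: theta_E)
  have tz: "theta p z = E (of_int u) * bracket (of_int u)" unfolding z theta_E ..
  have tq: "theta p (of_real q ^ 2) = E 1 * bracket 1" unfolding q2 theta_E ..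
  have t1: "theta p (E (2 * (x + 1))) = E (x + 1) * bracket (x + 1)" for x by (rule theta_E)
  have t2: "theta p (E (2 * (x + 2))) = E (x + 2) * bracket (x + 2)" for x by (rule theta_E)
  have tm: "theta p (E (- 2 * x)) = - (E (- x) * bracket x)" for x
    using theta_E[of "- x"] by (simp add: bracket_minus)
  have tp: "theta p (E (2 * (x + 1)) * z) = E (x + 1 + of_int u) * bracket (x + 1 + of_int u)" for x
  proof -
    have "E (2 * (x + 1)) * z = E (2 * (x + 1 + of_int u))"
      unfolding z by (simp flip: E_add add: algebra_simps)
    then show ?thesis by (simp only: theta_E)
  qed
  have tmz: "theta p (E (- 2 * (x + 1)) * z) = - (E (- (x + 1 - of_int u)) * bracket (x + 1 - of_int u))" for x
  proof -
    have "E (- 2 * (x + 1)) * z = E (- 2 * (x + 1 - of_int u))"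
      unfolding z by (simp flip: E_add add: algebra_simps)
    then show ?thesis by (simp only: tm)
  qed
  have dbracket: "cbracket i * dbracket j / (cbracket (u + 1) * dbracket 1) = mero (\<lambda>x. bracket (of_int i) * bracket (x + of_int j) / (bracket (of_int (u + 1)) * bracket (x + of_int 1)))" for i j
    unfolding dbracket_def cbracket_def
    by (simp only: mero_mult mero_divide meromorphic_bracket meromorphic_on_mult meromorphic_on_const)
  show "Ra p q s z = cbracket u * dbracket 2 / (cbracket (u + 1) * dbracket 1)"
    unfolding Ra_def dbracket tz t2 t1 s
    by (rule arg_cong[of _ _ mero]) (simp add: fun_eq_iff E_add E2 divide_simps)
  show "Rb p q s z = cbracket 1 * dbracket (1 - u) / (cbracket (u + 1) * dbracket 1)"
    unfolding Rb_def dbracket tq tmz tm s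
    by (rule arg_cong[of _ _ mero]) (simp add: fun_eq_iff E_add E_diff E_minus add_diff_eq divide_simps)
  show "Rc p q s z = cbracket 1 * dbracket (1 + u) / (cbracket (u + 1) * dbracket 1)"
    unfolding Rc_def dbracket tq tp t1 s
    by (rule arg_cong[of _ _ mero]) (simp add: fun_eq_iff E_add divide_simps add_ac)
  show "Rd p q s z = cbracket u * dbracket 0 / (cbracket (u + 1) * dbracket 1)"
    unfolding Rd_def dbracket tz tm s
    by (rule arg_cong[of _ _ mero]) (simp add: fun_eq_iff E_add E_diff E_minus divide_simps)
qed

end

section \<open>The exchange relations between the generators\<close>

context elliptic_params
begin

abbreviation \<iota>' :: "falg \<Rightarrow> fr" where "\<iota>' \<equiv> \<iota> p q"
abbreviation e :: fr where "e \<equiv> unit_at p q"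

sublocale K: dynamical_scalars "\<lambda>f. \<kappa> (lam f)" "\<lambda>f. \<kappa> (mu f)" "\<lambda>i. shift (of_int i)" dbracket cbracket
  by (rule dynamical_scalars_fr)

text \<open>
  The generators with spectral parameters in $q^{2\mathbb{Z}}w$.
\<close>
definition gens_at :: "complex \<Rightarrow> bool \<Rightarrow> bool \<Rightarrow> int \<Rightarrow> fr" where
  "gens_at w a b i = \<iota>' (matgen a b (of_real q powi (2 * i) * w))"

lemma gens_at_shift:
  "\<kappa> (lam f) * gens_at w a b i = gens_at w a b i * \<kappa> (lam (shift (of_int (sg a)) f))"
  "\<kappa> (mu f) * gens_at w a b i = gens_at w a b i * \<kappa> (mu (shift (of_int (sg b)) f))"
proof -
  have "\<kappa> x * \<iota>' y = e * (\<kappa> x * \<kappa> y)" for x y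
    unfolding \<iota>_def mult.assoc[symmetric] unit_at_central[of p q "\<kappa> x"] ..
  then show "\<kappa> (lam f) * gens_at w a b i = gens_at w a b i * \<kappa> (lam (shift (of_int (sg a)) f))"
    "\<kappa> (mu f) * gens_at w a b i = gens_at w a b i * \<kappa> (mu (shift (of_int (sg b)) f))"
    unfolding gens_at_def \<kappa>_lam_matgen \<kappa>_mu_matgen by (simp_all add: \<iota>_def mult.assoc \<kappa>_lam_matgen \<kappa>_mu_matgen)
qed

text \<open>
  For $u \ge 1$ the number $\theta(q^2 z_{12}) = \theta(q^{2(u+1)})$ is not $0$, so that the relations
  hold in the form without residues.
\<close>
lemma gens_at_relations:
  assumes w: "w \<noteq> 0" and u: "u \<ge> 1"
  shows "\<kappa> (mu (cbracket (u + 1) * dbracket 1)) * (gens_at w a b (i + u) * gens_at w a (\<not> b) i)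
       = \<kappa> (mu (cbracket u * dbracket (1 + sg b))) * (gens_at w a (\<not> b) i * gens_at w a b (i + u))
         + \<kappa> (mu (cbracket 1 * dbracket (1 + sg b * u))) * (gens_at w a b i * gens_at w a (\<not> b) (i + u))" (is ?row)
    and "\<kappa> (lam (cbracket u * dbracket (1 - sg a))) * (gens_at w (\<not> a) b (i + u) * gens_at w a b i)
         + \<kappa> (lam (cbracket 1 * dbracket (1 + sg a * u))) * (gens_at w a b (i + u) * gens_at w (\<not> a) b i)
       = \<kappa> (lam (cbracket (u + 1) * dbracket 1)) * (gens_at w a b i * gens_at w (\<not> a) b (i + u))" (is ?col)
    and "\<kappa> (lam (cbracket u * dbracket (1 - sg a) / dbracket 1)) * (gens_at w (\<not> a) b (i + u) * gens_at w a (\<not> b) i)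
         + \<kappa> (lam (cbracket 1 * dbracket (1 + sg a * u) / dbracket 1)) * (gens_at w a b (i + u) * gens_at w (\<not> a) (\<not> b) i)
       = \<kappa> (mu (cbracket u * dbracket (1 + sg b) / dbracket 1)) * (gens_at w a (\<not> b) i * gens_at w (\<not> a) b (i + u))
         + \<kappa> (mu (cbracket 1 * dbracket (1 + sg b * u) / dbracket 1)) * (gens_at w a b i * gens_at w (\<not> a) (\<not> b) (i + u))" (is ?mixed)
proof -
  \<comment> \<open>The larger exponent of \<open>q\<close> belongs to the first argument in the relations.\<close>
  define z1 z2 z s where "z1 = of_real q powi (2 * (i + u)) * w" and "z2 = of_real q powi (2 * i) * w"
    and "z = (of_real q powi (2 * u) :: complex)" and "s = theta p (of_real q ^ 2 * z)"
  have nz: "z1 \<noteq> 0" "z2 \<noteq> 0" using w q_pos by (simp_all add: z1_def z2_def)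
  have z: "z = z1 / z2" using w q_pos by (simp add: z_def z1_def z2_def power_int_add distrib_left)
  have "of_real q ^ 2 * z = of_real q powi (2 * (u + 1))"
    using q_pos by (simp add: z_def power_int_add distrib_left)
  then have s: "s \<noteq> 0" using theta_q_powi_nz[of "2 * (u + 1)"] u by (simp add: s_def)
  have cc: "coeff_case p q z 1 s" using s by (simp add: coeff_case_def s_def)
  note R = R_coeffs[of u, folded z_def, folded s_def]
  have Nnz: "cbracket (u + 1) \<noteq> 0" using cbracket_nz u by simp
  have L: "gens_at w a b (i + u) = \<iota>' (matgen a b z1)" "gens_at w a b i = \<iota>' (matgen a b z2)" for a b
    by (simp_all add: gens_at_def z1_def z2_def)
  have m: "\<kappa> (mu f) * (\<kappa> (mu f') * x) = \<kappa> (mu (f * f')) * x" "\<kappa> (lam f) * (\<kappa> (lam f') * x) = \<kappa> (lam (f * f')) * x" for f f' x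
    by (simp_all add: K.mu_mult K.lam_mult mult.assoc)
  have \<iota>3: "\<iota>' (f * x * y) = \<kappa> f * (\<iota>' x * \<iota>' y)" for f x y
    unfolding mult.assoc \<iota>_mult_\<kappa>[of p q f] unfolding \<iota>_mult ..
  have \<iota>2: "\<iota>' (matgen a b z * matgen a' b' z') = \<iota>' (matgen a b z) * \<iota>' (matgen a' b' z')" for a b z a' b' z'
    by (rule \<iota>_mult)
  let ?d = "cbracket (u + 1) * dbracket 1"
  have d: "?d * (f / ?d) = f" for f using Nnz dbracket_nz[of 1] by simp
  have row: "\<iota>' (matgen a b z1) * \<iota>' (matgen a (\<not> b) z2)
      = \<kappa> (mu (cbracket u * dbracket (1 + sg b) / ?d)) * (\<iota>' (matgen a (\<not> b) z2) * \<iota>' (matgen a b z1))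
        + \<kappa> (mu (cbracket 1 * dbracket (1 + sg b * u) / ?d)) * (\<iota>' (matgen a b z2) * \<iota>' (matgen a (\<not> b) z1))"
  proof (cases b)
    case True
    have "(matgen a True, matgen a False) \<in> {(alpha, beta), (gam, delta)}"
      by (cases a) (simp_all add: matgen_def[abs_def])
    from \<iota>_eqI[OF FR_eqs.row1[OF nz z cc this]] show ?thesis
      using True by (simp add: \<iota>_add \<iota>3 scalar_1 \<iota>2 R)
  next
    case False
    have "(matgen a True, matgen a False) \<in> {(alpha, beta), (gam, delta)}"
      by (cases a) (simp_all add: matgen_def[abs_def])
    from \<iota>_eqI[OF FR_eqs.row2[OF nz z cc this]] show ?thesis
      using False by (simp add: \<iota>_add \<iota>3 scalar_1 \<iota>2 R add.commute)
  qed
  show ?row unfolding L row distrib_left m d ..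
  have col: "\<iota>' (matgen a b z2) * \<iota>' (matgen (\<not> a) b z1)
      = \<kappa> (lam (cbracket u * dbracket (1 - sg a) / ?d)) * (\<iota>' (matgen (\<not> a) b z1) * \<iota>' (matgen a b z2))
        + \<kappa> (lam (cbracket 1 * dbracket (1 + sg a * u) / ?d)) * (\<iota>' (matgen a b z1) * \<iota>' (matgen (\<not> a) b z2))"
  proof (cases a)
    case False
    have "(matgen True b, matgen False b) \<in> {(alpha, gam), (beta, delta)}"
      by (cases b) (simp_all add: matgen_def[abs_def])
    from \<iota>_eqI[OF FR_eqs.col1[OF nz z cc this], symmetric] show ?thesis
      using False by (simp add: \<iota>_add \<iota>3 scalar_1 \<iota>2 R)
  next
    case True
    have "(matgen True b, matgen False b) \<in> {(alpha, gam), (beta, delta)}"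
      by (cases b) (simp_all add: matgen_def[abs_def])
    from \<iota>_eqI[OF FR_eqs.col2[OF nz z cc this], symmetric] show ?thesis
      using True by (simp add: \<iota>_add \<iota>3 scalar_1 \<iota>2 R add.commute)
  qed
  show ?col unfolding L col distrib_left m d ..
  have mixed: "\<kappa> (lam (cbracket u * dbracket (1 - sg a) / ?d)) * (\<iota>' (matgen (\<not> a) b z1) * \<iota>' (matgen a (\<not> b) z2))
        + \<kappa> (lam (cbracket 1 * dbracket (1 + sg a * u) / ?d)) * (\<iota>' (matgen a b z1) * \<iota>' (matgen (\<not> a) (\<not> b) z2))
      = \<kappa> (mu (cbracket u * dbracket (1 + sg b) / ?d)) * (\<iota>' (matgen a (\<not> b) z2) * \<iota>' (matgen (\<not> a) b z1))
        + \<kappa> (mu (cbracket 1 * dbracket (1 + sg b * u) / ?d)) * (\<iota>' (matgen a b z2) * \<iota>' (matgen (\<not> a) (\<not> b) z1))"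
  proof -
    note mx = FR_eqs.mixed1[OF nz z cc] FR_eqs.mixed2[OF nz z cc] FR_eqs.mixed3[OF nz z cc] FR_eqs.mixed4[OF nz z cc]
    show ?thesis
      using mx[THEN \<iota>_eqI] by (cases a; cases b) (simp_all add: \<iota>_add \<iota>3 R matgen_def add.commute)
  qed
  have d': "cbracket (u + 1) * (f / ?d) = f / dbracket 1" for f using Nnz by simp
  have "\<kappa> (lam (cbracket (u + 1))) * (\<kappa> (lam (cbracket u * dbracket (1 - sg a) / ?d)) * (\<iota>' (matgen (\<not> a) b z1) * \<iota>' (matgen a (\<not> b) z2))
        + \<kappa> (lam (cbracket 1 * dbracket (1 + sg a * u) / ?d)) * (\<iota>' (matgen a b z1) * \<iota>' (matgen (\<not> a) (\<not> b) z2)))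
      = \<kappa> (mu (cbracket (u + 1))) * (\<kappa> (mu (cbracket u * dbracket (1 + sg b) / ?d)) * (\<iota>' (matgen a (\<not> b) z2) * \<iota>' (matgen (\<not> a) b z1))
        + \<kappa> (mu (cbracket 1 * dbracket (1 + sg b * u) / ?d)) * (\<iota>' (matgen a b z2) * \<iota>' (matgen (\<not> a) (\<not> b) z1)))"
    unfolding mixed K.lam_n ..
  then show ?mixed unfolding L distrib_left m d' .
qed

lemma gens_at_same:
  assumes "w \<noteq> 0"
  shows "gens_at w a b i * gens_at w a b j = gens_at w a b j * gens_at w a b i"
proof -
  have "matgen a b \<in> {alpha, beta, gam, delta}" by (cases a; cases b) (simp_all add: matgen_def[abs_def])
  then show ?thesis unfolding gens_at_def \<iota>_mult[symmetric]
    using assms q_pos by (intro \<iota>_eqI FR_eqs.same) auto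
qed

lemma RLL_algebra_gens_at:
  assumes "w \<noteq> 0"
  shows "RLL_algebra (\<lambda>f. \<kappa> (lam f)) (\<lambda>f. \<kappa> (mu f)) (\<lambda>i. shift (of_int i)) dbracket cbracket (gens_at w)"
  using gens_at_shift gens_at_same[OF assms] gens_at_relations[OF assms] by unfold_locales

section \<open>The matrix elements as fused products\<close>

lemma ebinom_bracket:
  assumes "l \<le> k"
  shows "ebinom p q k l = E (of_nat l * of_nat (k - l)) * (\<Prod>i<l. bracket (of_int (int (k - i))) / bracket (of_int (int (l - i))))"
proof -
  have "ebinom p q k l = (\<Prod>i=1..l. E (of_nat (k - l)) * (bracket (of_nat (k - l + i)) / bracket (of_nat i)))"
    unfolding ebinom_def
  proof (intro prod.cong refl)
    fix i assume "i \<in> {1..l}"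
    have "of_real q powi (2 * (int k - int l + int i)) = E (of_int (2 * (int k - int l + int i)))"
      by (simp only: E_int)
    also have "of_int (2 * (int k - int l + int i)) = (2 * of_nat (k - l + i) :: complex)"
      using assms by (simp add: of_nat_diff)
    finally have 1: "theta p (of_real q powi (2 * (int k - int l + int i))) = E (of_nat (k - l + i)) * bracket (of_nat (k - l + i))"
      by (simp only: theta_E)
    have "of_real q ^ (2 * i) = E (of_int (2 * int i))"
      by (simp only: E_int) (metis int_ops(7) of_nat_numeral power_int_of_nat)
    also have "of_int (2 * int i) = (2 * of_nat i :: complex)" by simp
    finally have 2: "theta p (of_real q ^ (2 * i)) = E (of_nat i) * bracket (of_nat i)"
      by (simp only: theta_E)
    show "theta p (of_real q powi (2 * (int k - int l + int i))) / theta p (of_real q ^ (2 * i))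
       = E (of_nat (k - l)) * (bracket (of_nat (k - l + i)) / bracket (of_nat i))"
      unfolding 1 2 by (simp add: E_add del: of_nat_diff)
  qed
  also have "\<dots> = E (of_nat (k - l)) ^ l * (\<Prod>i=1..l. bracket (of_nat (k - l + i)) / bracket (of_nat i))"
    by (subst prod.distrib) simp
  also have "(\<Prod>i=1..l. bracket (of_nat (k - l + i)) / bracket (of_nat i)) = (\<Prod>i<l. bracket (of_nat (k - i)) / bracket (of_nat (l - i)))"
    by (rule prod.reindex_bij_witness[of _ "\<lambda>i. l - i" "\<lambda>i. l - i"]) (use assms in auto)
  also have "E (of_nat (k - l)) ^ l = E (of_nat l * of_nat (k - l))"
    by (simp add: qpow_def mult.assoc flip: exp_of_nat_mult)
  finally show ?thesis by simp
qed

lemma epoch_quotient: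
  "epoch p q (E (2 * x)) l / epoch p q (E (2 * x')) l = E (of_nat l * (x - x')) * (\<Prod>i<l. bracket (x + of_nat i) / bracket (x' + of_nat i))"
proof -
  have ep: "epoch p q (E (2 * x)) l = (\<Prod>i<l. E (x + of_nat i) * bracket (x + of_nat i))" for x
    unfolding epoch_def
  proof (intro prod.cong refl)
    fix i
    have "of_real q ^ (2 * i) = E (of_int (2 * int i))"
      by (simp only: E_int) (metis int_ops(7) of_nat_numeral power_int_of_nat)
    then have "E (2 * x) * of_real q ^ (2 * i) = E (2 * (x + of_nat i))"
      by (simp flip: E_add add: distrib_left)
    then show "theta p (E (2 * x) * of_real q ^ (2 * i)) = E (x + of_nat i) * bracket (x + of_nat i)"
      by (simp only: theta_E)
  qed
  have "epoch p q (E (2 * x)) l / epoch p q (E (2 * x')) l = (\<Prod>i<l. E (x - x') * (bracket (x + of_nat i) / bracket (x' + of_nat i)))"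
    unfolding ep prod_dividef[symmetric] by (intro prod.cong refl) (simp add: E_add E_diff)
  also have "\<dots> = E (x - x') ^ l * (\<Prod>i<l. bracket (x + of_nat i) / bracket (x' + of_nat i))"
    by (subst prod.distrib) simp
  also have "E (x - x') ^ l = E (of_nat l * (x - x'))"
    by (simp add: qpow_def mult.assoc flip: exp_of_nat_mult)
  finally show ?thesis .
qed

text \<open>
  The power of \<open>q\<close> that turns the elliptic binomial into brackets is inverse to the power that does
  so for the quotient of shifted factorials.
\<close>
lemma ebinom_epoch:
  assumes "l \<le> k" "x' = x + of_nat (k - l)"
  shows "ebinom p q k l * (epoch p q (E (2 * x)) l / epoch p q (E (2 * x')) l)
     = (\<Prod>i<l. bracket (of_int (int (k - i))) / bracket (of_int (int (l - i)))) * (\<Prod>i<l. bracket (x + of_nat i) / bracket (x' + of_nat i))"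
proof -
  have "E (of_nat l * of_nat (k - l)) * E (of_nat l * (x - x')) = 1"
    unfolding E_add[symmetric] assms(2) by (simp add: algebra_simps)
  then have "ebinom p q k l * (epoch p q (E (2 * x)) l / epoch p q (E (2 * x')) l)
     = 1 * ((\<Prod>i<l. bracket (of_int (int (k - i))) / bracket (of_int (int (l - i)))) * (\<Prod>i<l. bracket (x + of_nat i) / bracket (x' + of_nat i)))"
  proof -
    have "A * P * (B * Q) = (A * B) * (P * Q)" for A B P Q :: complex by (simp only: mult_ac)
    then show ?thesis using \<open>E (of_nat l * of_nat (k - l)) * E (of_nat l * (x - x')) = 1\<close>
      unfolding ebinom_bracket[OF assms(1)] epoch_quotient by (simp only:)
  qed
  then show ?thesis by simp
qed

definition bracket_binomial :: "nat \<Rightarrow> nat \<Rightarrow> mero" where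
  "bracket_binomial k l = (\<Prod>i<l. cbracket (int (k - i)) / cbracket (int (l - i)))"

definition bracket_ratio :: "int \<Rightarrow> int \<Rightarrow> nat \<Rightarrow> mero" where
  "bracket_ratio r r' l = (\<Prod>i<l. dbracket (r + int i) / dbracket (r' + int i))"

lemma bracket_binomial_mero: "bracket_binomial k l = mero (\<lambda>x. \<Prod>i<l. bracket (of_int (int (k - i))) / bracket (of_int (int (l - i))))"
  unfolding bracket_binomial_def cbracket_def by (simp add: mero_divide mero_prod meromorphic_on_const meromorphic_on_divide)

lemma bracket_ratio_mero: "bracket_ratio r r' l = mero (\<lambda>x. \<Prod>i<l. bracket (x + of_int r + of_nat i) / bracket (x + of_int r' + of_nat i))"
proof -
  have "bracket_ratio r r' l = mero (\<lambda>x. \<Prod>i<l. bracket (x + of_int (r + int i)) / bracket (x + of_int (r' + int i)))"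
    unfolding bracket_ratio_def dbracket_def by (simp only: mero_divide mero_prod meromorphic_bracket meromorphic_on_divide)
  then show ?thesis by (simp add: add.assoc)
qed

lemma meromorphic_bracket_binomial: "(\<lambda>x. \<Prod>i<l. bracket (of_int (int (k - i))) / bracket (of_int (int (l - i)))) meromorphic_on UNIV"
  by (intro meromorphic_on_const)

lemma meromorphic_bracket_ratio: "(\<lambda>x. \<Prod>i<l. bracket (x + of_int r + of_nat i) / bracket (x + of_int r' + of_nat i)) meromorphic_on UNIV"
  unfolding add.assoc by (intro meromorphic_on_prod meromorphic_on_divide meromorphic_bracket)

lemma t_coeff_eq:
  assumes "l \<le> k" "l \<le> j" "j - l \<le> N - k" "k \<le> N"
  shows "t_coeff p q N k j l =
      (bracket_binomial k l * bracket_ratio (int N - int k - 2 * int j + int l + 2) (int N - 2 * int j + 2) l)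
      * (bracket_binomial (N - k) (j - l) * bracket_ratio (int l - int j + 2) (int N - 2 * int j - int k + 2 * int l + 2) (j - l))"
proof -
  have "t_coeff p q N k j l = mero (\<lambda>x.
      ((\<Prod>i<l. bracket (of_int (int (k - i))) / bracket (of_int (int (l - i))))
         * (\<Prod>i<l. bracket (x + of_int (int N - int k - 2 * int j + int l + 2) + of_nat i) / bracket (x + of_int (int N - 2 * int j + 2) + of_nat i)))
    * ((\<Prod>i<j-l. bracket (of_int (int (N - k - i))) / bracket (of_int (int (j - l - i))))
         * (\<Prod>i<j-l. bracket (x + of_int (int l - int j + 2) + of_nat i) / bracket (x + of_int (int N - 2 * int j - int k + 2 * int l + 2) + of_nat i))))"
    unfolding t_coeff_def Let_def
  proof (rule arg_cong[of _ _ mero], rule ext)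
    fix x :: complex
    let ?x1 = "x + of_nat N - of_nat k - 2 * of_nat j + of_nat l + 2"
    let ?y1 = "x + of_nat N - 2 * of_nat j + 2"
    let ?x2 = "x + of_nat l - of_nat j + 2"
    let ?y2 = "x + of_nat N - 2 * of_nat j - of_nat k + 2 * of_nat l + 2"
    have e: "x + of_int (int N - int k - 2 * int j + int l + 2) = ?x1" "x + of_int (int N - 2 * int j + 2) = ?y1"
      "x + of_int (int l - int j + 2) = ?x2" "x + of_int (int N - 2 * int j - int k + 2 * int l + 2) = ?y2"
      by simp_all
    have y1: "?y1 = ?x1 + of_nat (k - l)" using assms by (simp add: of_nat_diff)
    have y2: "?y2 = ?x2 + of_nat (N - k - (j - l))" using assms by (simp add: of_nat_diff)
    show "ebinom p q k l * ebinom p q (N - k) (j - l) * (epoch p q (E (2 * ?x1)) l / epoch p q (E (2 * ?y1)) l) *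
          (epoch p q (E (2 * ?x2)) (j - l) / epoch p q (E (2 * ?y2)) (j - l))
     = ((\<Prod>i<l. bracket (of_int (int (k - i))) / bracket (of_int (int (l - i))))
         * (\<Prod>i<l. bracket (x + of_int (int N - int k - 2 * int j + int l + 2) + of_nat i) / bracket (x + of_int (int N - 2 * int j + 2) + of_nat i)))
    * ((\<Prod>i<j-l. bracket (of_int (int (N - k - i))) / bracket (of_int (int (j - l - i))))
         * (\<Prod>i<j-l. bracket (x + of_int (int l - int j + 2) + of_nat i) / bracket (x + of_int (int N - 2 * int j - int k + 2 * int l + 2) + of_nat i)))"
      unfolding e ebinom_epoch[OF assms(1) y1, symmetric] ebinom_epoch[OF assms(3) y2, symmetric]
      by (simp only: mult_ac)
  qed
  also have "\<dots> = (bracket_binomial k l * bracket_ratio (int N - int k - 2 * int j + int l + 2) (int N - 2 * int j + 2) l)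
      * (bracket_binomial (N - k) (j - l) * bracket_ratio (int l - int j + 2) (int N - 2 * int j - int k + 2 * int l + 2) (j - l))"
    unfolding bracket_binomial_mero bracket_ratio_mero
    by (simp only: mero_mult meromorphic_bracket_binomial meromorphic_bracket_ratio meromorphic_on_mult)
  finally show ?thesis .
qed

lemma shift_bracket_binomial: "shift a (bracket_binomial k l) = bracket_binomial k l"
  unfolding bracket_binomial_mero by (rule shift_mero[OF meromorphic_bracket_binomial])

lemma shift_bracket_ratio: "shift (of_int a) (bracket_ratio r r' l) = bracket_ratio (r + a) (r' + a) l"
  unfolding bracket_ratio_def K.T_prod shift_divide shift_dbracket by (simp add: add_ac)

text \<open>
  The coefficient of \<open>row_products\<close> in the shape in which it occurs in $t^N_{kj}$; the products
  run in opposite directions.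
\<close>
lemma row_coeff:
  assumes "k \<le> N"
  shows "(\<Prod>i<k. cbracket (int (N - i)) * dbracket (1 - int i) / (cbracket (int (k - i)) * dbracket (int (N - k) + 1 - int i)))
    = bracket_binomial N k * bracket_ratio (2 - int k) (int N - 2 * int k + 2) k"
proof -
  have "bracket_ratio (2 - int k) (int N - 2 * int k + 2) k = (\<Prod>i<k. dbracket (1 - int i) / dbracket (int (N - k) + 1 - int i))"
    unfolding bracket_ratio_def
    by (rule prod.reindex_bij_witness[of _ "\<lambda>i. k - Suc i" "\<lambda>i. k - Suc i"])
       (use assms in \<open>auto simp: of_nat_diff algebra_simps\<close>)
  then show ?thesis unfolding bracket_binomial_def by (simp flip: prod.distrib)
qed

text \<open>
  Multiplication by \<open>e\<close> matters for the empty product only, because \<open>\<iota>' 1 = e\<close>.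
\<close>
lemma e_prod_list: "e * prod_list (map (\<lambda>i. \<iota>' (x i)) xs) = \<iota>' (prod_list (map x xs))"
proof (induction xs)
  case (Cons i xs)
  have "e * (\<iota>' (x i) * P) = \<iota>' (x i) * (e * P)" for P
    using unit_at_central[of p q "\<iota>' (x i)"] by (simp flip: mult.assoc)
  then show ?case using Cons by (simp add: \<iota>_mult)
qed (simp add: \<iota>_1)

lemma gstring_gens_at:
  "\<iota>' (gstring q (matgen a b) m w r) = e * prod_list (map (\<lambda>i. gens_at w a b (m - int i)) [0..<r])"
  unfolding gstring_def gens_at_def e_prod_list ..

end

context elliptic_params
begin

text \<open>
  The rows $-^{N-k}+^k$ consist of two constant blocks. If the second block has \<open>l\<close> plus columns, the
  first has $j-l$, and the product of the two blocks is the summand for \<open>l\<close>.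
\<close>
lemma t_el_fused:
  assumes w: "w \<noteq> 0" and "k \<le> N" "j \<le> N"
  shows "\<iota>' (t_el p q N k j w) = e * fused (gens_at w) (replicate (N - k) False @ replicate k True) (int j) 0"
proof -
  interpret RLL_algebra "\<lambda>f. \<kappa> (lam f)" "\<lambda>f. \<kappa> (mu f)" "\<lambda>i. shift (of_int i)" dbracket cbracket "gens_at w"
    by (rule RLL_algebra_gens_at[OF w])
  let ?t = "\<lambda>l. \<kappa> (mu (t_coeff p q N k j l))
      * prod_list (map (\<lambda>i. gens_at w False True (int N - int k - 1 - int i)) [0..<j - l])
      * prod_list (map (\<lambda>i. gens_at w False False (int N - int j - int k + int l - 1 - int i)) [0..<N + l - k - j])
      * prod_list (map (\<lambda>i. gens_at w True True (int N - 1 - int i)) [0..<l])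
      * prod_list (map (\<lambda>i. gens_at w True False (int N - int l - 1 - int i)) [0..<k - l])"
  have summand: "fused (gens_at w) (replicate (N - k) False) (int (j - l)) 0 * fused (gens_at w) (replicate k True) (int l) (int (N - k)) = ?t l"
    if l: "l \<in> {k + j - N..min k j}" for l
  proof -
    have l': "j - l \<le> N - k" "l \<le> k" "l \<le> j" using l assms by auto
    have ix: "int (N - k) - 1 = int N - int k - 1" "int (N - k) - int (j - l) - 1 = int N - int j - int k + int l - 1"
      "int (N - k) + int k = int N" "N - k - (j - l) = N + l - k - j"
      using l assms by (auto simp: of_nat_diff)
    have "bracket_binomial k l * bracket_ratio (2 - int l + (int (N - k) - 2 * int (j - l))) (int k - 2 * int l + 2 + (int (N - k) - 2 * int (j - l))) l
       = bracket_binomial k l * bracket_ratio (int N - int k - 2 * int j + int l + 2) (int N - 2 * int j + 2) l"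
      using l assms by (intro arg_cong2[of _ _ _ _ "(*)"] arg_cong2[of _ _ _ _ "\<lambda>r r'. bracket_ratio r r' l"] refl) (auto simp: of_nat_diff)
    moreover have "bracket_ratio (2 - int (j - l)) (int (N - k) - 2 * int (j - l) + 2) (j - l) = bracket_ratio (int l - int j + 2) (int N - 2 * int j - int k + 2 * int l + 2) (j - l)"
      using l assms by (intro arg_cong2[of _ _ _ _ "\<lambda>r r'. bracket_ratio r r' (j - l)"]) (auto simp: of_nat_diff)
    ultimately have "bracket_binomial (N - k) (j - l) * bracket_ratio (2 - int (j - l)) (int (N - k) - 2 * int (j - l) + 2) (j - l)
      * shift (of_int (int (N - k) - 2 * int (j - l))) (bracket_binomial k l * bracket_ratio (2 - int l) (int k - 2 * int l + 2) l) = t_coeff p q N k j l"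
      unfolding t_coeff_eq[OF l'(2,3,1) assms(2)] shift_mult shift_bracket_binomial shift_bracket_ratio by (simp only: mult.commute)
    then show ?thesis
      unfolding two_rows[OF l'(1,2)] row_coeff[OF l'(1)] row_coeff[OF l'(2)] by (simp only: ix)
  qed
  have "fused (gens_at w) (replicate (N - k) False @ replicate k True) (int j) 0
    = (\<Sum>m = 0..int (N - k). fused (gens_at w) (replicate (N - k) False) m 0 * fused (gens_at w) (replicate k True) (int j - m) (int (N - k)))"
    by (subst fused_append) simp
  also have "\<dots> = (\<Sum>m \<in> (\<lambda>l. int j - int l) ` {k + j - N..min k j}. fused (gens_at w) (replicate (N - k) False) m 0 * fused (gens_at w) (replicate k True) (int j - m) (int (N - k)))"
  proof (rule sum.mono_neutral_right)
    show "(\<lambda>l. int j - int l) ` {k + j - N..min k j} \<subseteq> {0..int (N - k)}" using assms by auto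
    show "\<forall>m\<in>{0..int (N - k)} - (\<lambda>l. int j - int l) ` {k + j - N..min k j}.
       fused (gens_at w) (replicate (N - k) False) m 0 * fused (gens_at w) (replicate k True) (int j - m) (int (N - k)) = 0"
    proof
      fix m assume m: "m \<in> {0..int (N - k)} - (\<lambda>l. int j - int l) ` {k + j - N..min k j}"
      \<comment> \<open>All other values of \<open>m\<close> require an impossible number of plus columns in the second block.\<close>
      have "int j - m < 0 \<or> int j - m > int k"
      proof (rule ccontr)
        assume *: "\<not> (int j - m < 0 \<or> int j - m > int k)"
        define l where "l = nat (int j - m)"
        have "m = int j - int l" "l \<in> {k + j - N..min k j}" using * m assms by (auto simp: l_def)
        then show False using m by blast
      qed
      then show "fused (gens_at w) (replicate (N - k) False) m 0 * fused (gens_at w) (replicate k True) (int j - m) (int (N - k)) = 0"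
        by (subst (2) fused_outside) auto
    qed
  qed simp
  also have "\<dots> = (\<Sum>l = k + j - N..min k j. fused (gens_at w) (replicate (N - k) False) (int (j - l)) 0 * fused (gens_at w) (replicate k True) (int l) (int (N - k)))"
    by (subst sum.reindex) (auto simp: inj_on_def of_nat_diff intro!: sum.cong)
  also have "\<dots> = (\<Sum>l = k + j - N..min k j. ?t l)"
    by (rule sum.cong[OF refl]) (rule summand)
  finally have fused: "fused (gens_at w) (replicate (N - k) False @ replicate k True) (int j) 0 = (\<Sum>l = k + j - N..min k j. ?t l)" .
  have gen: "gam = matgen False True" "delta = matgen False False" "alpha = matgen True True" "beta = matgen True False"
    by (simp_all add: matgen_def[abs_def])
  have sum: "\<iota>' (sum h A) = (\<Sum>l\<in>A. \<iota>' (h l))" for h and A :: "nat set"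
    by (induction A rule: infinite_finite_induct) (simp_all add: \<iota>_0 \<iota>_add)
  have ec: "x * (e * z) = e * (x * z)" for x z
    using unit_at_central[of p q x] by (simp flip: mult.assoc)
  have eP: "(e * x) * (e * z) = e * (x * z)" for x z
  proof -
    have "(e * x) * (e * z) = e * (x * (e * z))" by (rule mult.assoc)
    also have "\<dots> = e * (e * (x * z))" unfolding ec[of x z] ..
    also have "\<dots> = (e * e) * (x * z)" by (rule mult.assoc[symmetric])
    finally show ?thesis unfolding unit_at_idem .
  qed
  have "\<iota>' (mu f * gstring q (matgen a1 b1) m1 w r1 * gstring q (matgen a2 b2) m2 w r2
      * gstring q (matgen a3 b3) m3 w r3 * gstring q (matgen a4 b4) m4 w r4)
    = e * (\<kappa> (mu f) * prod_list (map (\<lambda>i. gens_at w a1 b1 (m1 - int i)) [0..<r1])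
       * prod_list (map (\<lambda>i. gens_at w a2 b2 (m2 - int i)) [0..<r2])
       * prod_list (map (\<lambda>i. gens_at w a3 b3 (m3 - int i)) [0..<r3])
       * prod_list (map (\<lambda>i. gens_at w a4 b4 (m4 - int i)) [0..<r4]))" for f a1 b1 m1 r1 a2 b2 m2 r2 a3 b3 m3 r3 a4 b4 m4 r4
    unfolding mult.assoc \<iota>_mult_\<kappa>[of p q "mu f"] unfolding \<iota>_mult gstring_gens_at eP by (rule ec)
  then show ?thesis
    unfolding t_el_def gen sum fused sum_distrib_left by (simp only:)
qed

end

section \<open>The norm factors\<close>

context elliptic_params
begin

text \<open>
  After passing to brackets, the shifted factorial in the numerator and the product over the \<open>k\<close>
  values of $F$ differ in their end factors only. What remains in the denominator is a product of
  $N + 1$ consecutive brackets.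
\<close>
lemma Gamma_eq:
  assumes "k \<le> N"
  shows "Gamma_coeff p q N k = mero (\<lambda>_. (- E 1) ^ N) * K.gram (N - k) k"
proof -
  define m where "m = N - k"
  have N: "N = m + k" using assms by (simp add: m_def)
  define C where "C = mero (\<lambda>_. - E 1)"
  let ?A = "bracket_ratio (2 - int k) (int m - int k + 2) k"
  have F: "E (- x) / theta p (E (- 2 * (x + 1))) = - E 1 / bracket (x + 1)" for x
  proof -
    have "theta p (E (- 2 * (x + 1))) = - (E (- (x + 1)) * bracket (x + 1))"
      using theta_E[of "- (x + 1)"] by (simp only: bracket_minus mult_minus_left mult_minus_right)
    moreover have "E (- (x + 1)) = E (- x) / E 1" by (simp flip: E_diff)
    ultimately have "theta p (E (- 2 * (x + 1))) = - (E (- x) / E 1 * bracket (x + 1))" by (simp only:)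
    then show ?thesis by simp
  qed
  have "Gamma_coeff p q N k = mero (\<lambda>x.
      (\<Prod>i<k. bracket (of_int (int (N - i))) / bracket (of_int (int (k - i))))
        * (\<Prod>i<k. bracket (x + of_int (2 - int k) + of_nat i) / bracket (x + of_int (int m - int k + 2) + of_nat i))
      * (\<Prod>i<m. (- E 1) / bracket (x + of_int (int m - int k - int i + 1)))
      * (\<Prod>i<k. (- E 1) / bracket (x + of_int (1 - int k + int i))))"
    unfolding Gamma_coeff_def Let_def
  proof (rule arg_cong[of _ _ mero], rule ext)
    fix x :: complex
    have e1: "x - of_nat k + 2 = x + of_int (2 - int k)"
      "x + of_nat N - 2 * of_nat k + 2 = x + of_int (int m - int k + 2)"
      by (simp_all add: N)
    have y: "x + of_int (int m - int k + 2) = (x + of_int (2 - int k)) + of_nat (N - k)"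
      by (simp add: N)
    have F1: "E (- (x + of_nat N - 2 * of_nat k - of_nat i)) / theta p (E (- 2 * (x + of_nat N - 2 * of_nat k - of_nat i + 1)))
      = - E 1 / bracket (x + of_int (int m - int k - int i + 1))" for i
      unfolding F by (rule arg_cong[of _ _ "\<lambda>z. - E 1 / bracket z"]) (simp add: N)
    have F2: "E (- (x - of_nat k + of_nat i)) / theta p (E (- 2 * (x - of_nat k + of_nat i + 1)))
      = - E 1 / bracket (x + of_int (1 - int k + int i))" for i
      unfolding F by (rule arg_cong[of _ _ "\<lambda>z. - E 1 / bracket z"]) simp
    show "ebinom p q N k * (epoch p q (E (2 * (x - of_nat k + 2))) k / epoch p q (E (2 * (x + of_nat N - 2 * of_nat k + 2))) k) *
      (\<Prod>i<N - k. E (- (x + of_nat N - 2 * of_nat k - of_nat i)) / theta p (E (- 2 * (x + of_nat N - 2 * of_nat k - of_nat i + 1)))) *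
      (\<Prod>i<k. E (- (x - of_nat k + of_nat i)) / theta p (E (- 2 * (x - of_nat k + of_nat i + 1))))
      = (\<Prod>i<k. bracket (of_int (int (N - i))) / bracket (of_int (int (k - i))))
        * (\<Prod>i<k. bracket (x + of_int (2 - int k) + of_nat i) / bracket (x + of_int (int m - int k + 2) + of_nat i))
      * (\<Prod>i<m. (- E 1) / bracket (x + of_int (int m - int k - int i + 1)))
      * (\<Prod>i<k. (- E 1) / bracket (x + of_int (1 - int k + int i)))"
      unfolding F1 F2 unfolding e1 ebinom_epoch[OF assms y] m_def[symmetric] ..
  qed
  also have "\<dots> = bracket_binomial N k * ?A * (\<Prod>i<m. C / dbracket (int m - int k - int i + 1)) * (\<Prod>i<k. C / dbracket (1 - int k + int i))"
    unfolding bracket_binomial_mero bracket_ratio_mero C_def dbracket_def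
    by (simp only: mero_mult mero_divide mero_prod meromorphic_bracket_binomial meromorphic_bracket_ratio meromorphic_bracket meromorphic_on_mult
        meromorphic_on_const meromorphic_on_divide meromorphic_on_prod)
  also have "\<dots> = C ^ N * (bracket_binomial N k * ?A / ((\<Prod>i<m. dbracket (int m - int k - int i + 1)) * (\<Prod>i<k. dbracket (1 - int k + int i))))"
    by (simp add: prod_dividef N power_add)
  also have "C ^ N = mero (\<lambda>_. (- E 1) ^ N)"
    unfolding C_def using mero_prod[of "{..<N}" "\<lambda>_ _. - E 1"] by (simp add: meromorphic_on_const)
  also have "(\<Prod>i<m. dbracket (int m - int k - int i + 1)) = (\<Prod>i<m. dbracket (2 - int k + int i))"
    by (rule prod.reindex_bij_witness[of _ "\<lambda>i. m - Suc i" "\<lambda>i. m - Suc i"]) (auto simp: of_nat_diff algebra_simps)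
  also have "bracket_binomial N k * ?A / ((\<Prod>i<m. dbracket (2 - int k + int i)) * (\<Prod>i<k. dbracket (1 - int k + int i))) = K.gram m k"
  proof -
    have B: "bracket_binomial N k = (\<Prod>i=1..k. cbracket (int (m + i)) / cbracket (int i))"
      unfolding bracket_binomial_def
      by (rule prod.reindex_bij_witness[of _ "\<lambda>i. k - i" "\<lambda>i. k - i"]) (auto simp: N of_nat_diff)
    have A: "?A = (\<Prod>i<k. dbracket (2 - int k + int i)) / (\<Prod>i<k. dbracket (int m - int k + 2 + int i))"
      unfolding bracket_ratio_def by (rule prod_dividef)
    have t: "(\<Prod>i<k. dbracket (2 - int k + int i)) * dbracket (1 - int k) = (\<Prod>i<k. dbracket (1 - int k + int i)) * dbracket 1"
    proof -
      have "(\<Prod>i<Suc k. dbracket (1 - int k + int i)) = dbracket (1 - int k) * (\<Prod>i<k. dbracket (2 - int k + int i))"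
        unfolding prod.lessThan_Suc_shift by (simp add: algebra_simps)
      then show ?thesis by (simp add: mult.commute)
    qed
    have D: "(\<Prod>i=1..m + k + 1. dbracket (int i - int k)) = dbracket (1 - int k) * ((\<Prod>i<m. dbracket (2 - int k + int i)) * (\<Prod>i<k. dbracket (int m - int k + 2 + int i)))"
    proof -
      have "(\<Prod>i=1..m + k + 1. dbracket (int i - int k)) = dbracket (1 - int k) * (\<Prod>i=1..m + k. dbracket (int (Suc i) - int k))"
        using K.prod_shift[of "\<lambda>i. dbracket (int i - int k)" "m + k"] by simp
      also have "(\<Prod>i=1..m + k. dbracket (int (Suc i) - int k)) = (\<Prod>i<m + k. dbracket (2 - int k + int i))"
        by (rule prod.reindex_bij_witness[of _ "Suc" "\<lambda>i. i - 1"]) (auto simp: of_nat_diff algebra_simps)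
      also have "(\<Prod>i<m + k. dbracket (2 - int k + int i)) = (\<Prod>i<m. dbracket (2 - int k + int i)) * (\<Prod>i<k. dbracket (int m - int k + 2 + int i))"
      proof -
        have "(\<Prod>i<m + k. h i) = (\<Prod>i<m. h i) * (\<Prod>i<k. h (m + i))" for h :: "nat \<Rightarrow> mero"
          by (induction k) (simp_all add: mult.assoc)
        from this[of "\<lambda>i. dbracket (2 - int k + int i)"] show ?thesis by (simp add: algebra_simps)
      qed
      finally show ?thesis .
    qed
    have nz: "(\<Prod>i<k. dbracket (1 - int k + int i)) \<noteq> 0" "(\<Prod>i<k. dbracket (int m - int k + 2 + int i)) \<noteq> 0" "(\<Prod>i<m. dbracket (2 - int k + int i)) \<noteq> 0"
      "dbracket (1 - int k) \<noteq> 0" "dbracket 1 \<noteq> 0" by (simp_all add: dbracket_nz)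
    define a b c d e' where "a = (\<Prod>i<k. dbracket (1 - int k + int i))" and "b = (\<Prod>i<k. dbracket (int m - int k + 2 + int i))"
      and "c = (\<Prod>i<m. dbracket (2 - int k + int i))" and "d = dbracket (1 - int k)" and "e' = (\<Prod>i<k. dbracket (2 - int k + int i))"
    have "bracket_binomial N k * (e' / b) / (c * a) = bracket_binomial N k * dbracket 1 / (d * (c * b))"
    proof -
      have "e' = a * dbracket 1 / d" using t nz by (simp add: a_def d_def e'_def nonzero_eq_divide_eq)
      then show ?thesis using nz by (simp add: a_def[symmetric] b_def[symmetric] c_def[symmetric] d_def[symmetric] mult_ac)
    qed
    then show ?thesis
      unfolding K.gram_def D A B[symmetric] a_def b_def c_def d_def e'_def .
  qed
  finally show ?thesis by (simp add: m_def)
qed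

lemma theta_cnj: "theta p (cnj z) = cnj (theta p z)"
proof -
  have "prodinf f = c \<Longrightarrow> convergent_prod f \<Longrightarrow> prodinf (\<lambda>i. cnj (f i)) = cnj c" for f :: "nat \<Rightarrow> complex" and c
  proof -
    assume f: "prodinf f = c" "convergent_prod f"
    have "(\<lambda>n. \<Prod>i\<le>n. cnj (f i)) \<longlonglongrightarrow> cnj c"
      using tendsto_cnj[OF convergent_prod_LIMSEQ[OF f(2)]] f(1) by simp
    moreover have "convergent_prod (\<lambda>i. cnj (f i))"
    proof -
      obtain M p where "(\<lambda>n. \<Prod>i\<le>n. f (i + M)) \<longlonglongrightarrow> p" "p \<noteq> 0"
        using f(2) by (auto simp: convergent_prod_def raw_has_prod_def)
      then have "(\<lambda>n. \<Prod>i\<le>n. cnj (f (i + M))) \<longlonglongrightarrow> cnj p" "cnj p \<noteq> 0"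
        using tendsto_cnj[of "\<lambda>n. \<Prod>i\<le>n. f (i + M)" p sequentially] by simp_all
      then show ?thesis by (auto simp: convergent_prod_def raw_has_prod_def)
    qed
    ultimately show ?thesis using convergent_prod_LIMSEQ LIMSEQ_unique by blast
  qed
  note * = this
  have "qpoch (cnj z) = cnj (qpoch z)" for z
    using *[OF refl convergent_factors[of z]] by (simp add: qpoch_def)
  from this[of z] this[of "of_real p / z"] show ?thesis
    by (simp add: theta_qpoch)
qed

lemma E_cnj: "E (cnj x) = cnj (E x)"
  by (simp add: qpow_def exp_cnj)

lemma bracket_cnj: "bracket (cnj x) = cnj (bracket x)"
proof -
  have "E (- cnj x) = cnj (E (- x))" "E (2 * cnj x) = cnj (E (2 * x))"
    using E_cnj[of "- x"] E_cnj[of "2 * x"] by simp_all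
  then show ?thesis by (simp add: bracket_def theta_cnj)
qed

lemma mero_bar_dbracket: "mero_bar (dbracket i) = dbracket i"
proof -
  have "cnj (bracket (cnj x + of_int i)) = bracket (x + of_int i)" for x
    using bracket_cnj[of "cnj x + of_int i"] by simp
  then show ?thesis unfolding dbracket_def mero_bar_mero[OF meromorphic_bracket] by simp
qed

lemma mero_bar_const: "mero_bar (mero (\<lambda>_. c)) = mero (\<lambda>_. cnj c)"
  by (simp add: mero_bar_mero meromorphic_on_const)

lemma Fmero_eq: "Fmero p q = mero (\<lambda>_. - E (- 1)) * dbracket 1"
proof -
  have "E x * theta p (E (- 2 * (x + 1))) = - E (- 1) * bracket (x + of_int 1)" for x
  proof -
    have "theta p (E (- 2 * (x + 1))) = - (E (- (x + 1)) * bracket (x + 1))"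
      using theta_E[of "- (x + 1)"] by (simp only: bracket_minus mult_minus_left mult_minus_right)
    moreover have "E x * E (- (x + 1)) = E (- 1)" by (simp flip: E_add)
    ultimately show ?thesis by (metis mult.assoc mult_minus_left mult_minus_right of_int_1)
  qed
  then have "Fmero p q = mero (\<lambda>x. - E (- 1) * bracket (x + of_int 1))"
    unfolding Fmero_def by presburger
  also have "\<dots> = mero (\<lambda>_. - E (- 1)) * dbracket 1"
    unfolding dbracket_def by (simp only: mero_mult meromorphic_on_const meromorphic_bracket)
  finally show ?thesis .
qed

lemma mero_bar_F: "mero_bar (Fmero p q) = Fmero p q"
proof -
  have "cnj (E (- 1)) = E (- 1)" using E_cnj[of "- 1"] by simp
  then show ?thesis by (simp add: Fmero_eq mero_bar_mult mero_bar_const mero_bar_dbracket)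
qed

lemma mero_bar_inverse: "mero_bar (inverse f) = inverse (mero_bar f)"
proof -
  have "mero_bar 1 = 1" using mero_bar_const[of 1] by (simp add: mero_1)
  then show ?thesis using mero_bar_divide[of 1 f] by (simp add: inverse_eq_divide)
qed

text \<open>
  The constant factor between $F$ and the bracket cancels because it is the same in both copies of the
  function field.
\<close>
lemma F_quotient: "\<kappa> (lam (inverse (Fmero p q))) * \<kappa> (mu (Fmero p q)) = \<kappa> (mu (dbracket 1)) * \<kappa> (lam (1 / dbracket 1))"
proof -
  define c where "c = mero (\<lambda>_. - E (- 1))"
  have c0: "c \<noteq> 0" unfolding c_def by (subst mero_eq_0_iff) (auto simp: meromorphic_on_const)
  have c: "\<kappa> (lam c) = \<kappa> (mu c)" unfolding c_def \<kappa>_lam_const \<kappa>_mu_const ..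
  have inv: "inverse (Fmero p q) = 1 / dbracket 1 * (1 / c)"
    unfolding Fmero_eq c_def[symmetric] by (simp add: inverse_eq_divide mult.commute)
  have "\<kappa> (lam (inverse (Fmero p q))) * \<kappa> (mu (Fmero p q))
     = \<kappa> (lam (1 / dbracket 1)) * (\<kappa> (lam (1 / c)) * \<kappa> (lam c)) * \<kappa> (mu (dbracket 1))"
    unfolding inv unfolding Fmero_eq c_def[symmetric] K.lam_mult K.mu_mult c by (simp only: mult.assoc)
  also have "\<kappa> (lam (1 / c)) * \<kappa> (lam c) = 1"
    using c0 by (simp add: K.lam_1 flip: K.lam_mult)
  finally show ?thesis by (simp add: K.lam_mu)
qed

end

section \<open>Antipode and star\<close>

lemma gen_single: "gen x * Poly_Mapping.single (Word xs) c = Poly_Mapping.single (Word (x # xs)) c"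
  by (simp add: gen_def mult_single plus_word_def)

lemma update_eq_add_single:
  "a \<notin> Poly_Mapping.keys f \<Longrightarrow> Poly_Mapping.update a b f = f + Poly_Mapping.single a b"
  by (rule poly_mapping_eqI) (auto simp: lookup_update lookup_add lookup_single when_def in_keys_iff)

text \<open>
  Centrality is imposed on the generators; it extends to words and then to linear combinations.
\<close>
lemma detinv_commutes:
  assumes "z \<noteq> 0"
  shows "detinv z * x - x * detinv z \<in> FR_ideal p q"
proof (induction x rule: Poly_Mapping.update_induct)
  case const
  show ?case by (simp add: FR_ideal_0)
next
  case (update f v c)
  obtain xs where v: "v = Word xs" by (cases v)
  have single: "detinv z * Poly_Mapping.single (Word xs) c - Poly_Mapping.single (Word xs) c * detinv z \<in> FR_ideal p q"
  proof (induction xs)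
    case Nil
    have "detinv z * Poly_Mapping.single (Word []) c = Poly_Mapping.single (Word []) c * detinv z"
      by (simp add: detinv_def gen_def mult_single flip: zero_word_def)
    then show ?case by (simp add: FR_ideal_0)
  next
    case (Cons x xs)
    let ?s = "Poly_Mapping.single (Word xs) c"
    have "(detinv z * gen x - gen x * detinv z) * ?s + gen x * (detinv z * ?s - ?s * detinv z) \<in> FR_ideal p q"
      using Cons FR_ideal_eqs[OF FR_eqs.detinv_central[OF assms]]
      by (intro FR_ideal_add FR_ideal_mult_left FR_ideal_mult_right)
    then show ?case by (simp add: algebra_simps flip: gen_single)
  qed
  have "(detinv z * f - f * detinv z) + (detinv z * Poly_Mapping.single v c - Poly_Mapping.single v c * detinv z) \<in> FR_ideal p q"
    using update single unfolding v by (intro FR_ideal_add)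
  then show ?case
    unfolding update_eq_add_single[OF update(1)] by (simp add: algebra_simps)
qed

lemma \<iota>_detinv_central:
  assumes "z \<noteq> 0"
  shows "\<iota> p q (detinv z) * x = x * \<iota> p q (detinv z)"
  unfolding \<iota>_def unit_at_def \<kappa>_def
  by (induction x rule: fr.abs_induct)
     (auto simp: times_fr.abs_eq fr.abs_eq_iff fr_rel_def detinv_commutes[OF assms] FR_ideal_0)

locale star_antipode = elliptic_params p q for p q +
  fixes S star :: "falg set \<Rightarrow> falg set"
  assumes S: "is_antipode p q S" and star: "is_star p q star"
begin

text \<open>
  Antipode and star act on classes. Relations between representatives make it possible to follow them
  through expressions in the free algebra.
\<close>
definition S_rel :: "falg \<Rightarrow> falg \<Rightarrow> bool" where
  "S_rel x y \<longleftrightarrow> S (cls p q x) = cls p q y"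

definition star_rel :: "falg \<Rightarrow> falg \<Rightarrow> bool" where
  "star_rel x y \<longleftrightarrow> star (cls p q x) = cls p q y"

lemma S_rel_add: "S_rel x y \<Longrightarrow> S_rel x' y' \<Longrightarrow> S_rel (x + x') (y + y')"
  and S_rel_mult: "S_rel x y \<Longrightarrow> S_rel x' y' \<Longrightarrow> S_rel (x * x') (y' * y)"
  and S_rel_scalar: "S_rel x y \<Longrightarrow> S_rel (scalar c * x) (scalar c * y)"
  and S_rel_1: "S_rel 1 1"
proof -
  have *: "\<forall>x\<in>carrier (FRU2 p q). \<forall>y\<in>carrier (FRU2 p q).
        S (x \<oplus>\<^bsub>FRU2 p q\<^esub> y) = S x \<oplus>\<^bsub>FRU2 p q\<^esub> S y \<and>
        S (x \<otimes>\<^bsub>FRU2 p q\<^esub> y) = S y \<otimes>\<^bsub>FRU2 p q\<^esub> S x"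
    "\<forall>c. \<forall>x\<in>carrier (FRU2 p q).
        S (cls p q (scalar c) \<otimes>\<^bsub>FRU2 p q\<^esub> x) = cls p q (scalar c) \<otimes>\<^bsub>FRU2 p q\<^esub> S x"
    "S \<one>\<^bsub>FRU2 p q\<^esub> = \<one>\<^bsub>FRU2 p q\<^esub>"
    using S unfolding is_antipode_def by blast+
  show "S_rel x y \<Longrightarrow> S_rel x' y' \<Longrightarrow> S_rel (x + x') (y + y')"
    "S_rel x y \<Longrightarrow> S_rel x' y' \<Longrightarrow> S_rel (x * x') (y' * y)"
    "S_rel x y \<Longrightarrow> S_rel (scalar c * x) (scalar c * y)" "S_rel 1 1"
    using *(1)[rule_format, OF cls_carrier cls_carrier, of x x'] *(2)[rule_format, OF cls_carrier, of c x] *(3)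
    unfolding S_rel_def by (simp_all add: cls_add cls_mult cls_one)
qed

lemma star_rel_add: "star_rel x y \<Longrightarrow> star_rel x' y' \<Longrightarrow> star_rel (x + x') (y + y')"
  and star_rel_mult: "star_rel x y \<Longrightarrow> star_rel x' y' \<Longrightarrow> star_rel (x * x') (y' * y)"
  and star_rel_scalar: "star_rel x y \<Longrightarrow> star_rel (scalar c * x) (scalar (cnj c) * y)"
proof -
  have *: "\<forall>x\<in>carrier (FRU2 p q). \<forall>y\<in>carrier (FRU2 p q).
        star (x \<oplus>\<^bsub>FRU2 p q\<^esub> y) = star x \<oplus>\<^bsub>FRU2 p q\<^esub> star y \<and>
        star (x \<otimes>\<^bsub>FRU2 p q\<^esub> y) = star y \<otimes>\<^bsub>FRU2 p q\<^esub> star x"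
    "\<forall>c. \<forall>x\<in>carrier (FRU2 p q).
        star (cls p q (scalar c) \<otimes>\<^bsub>FRU2 p q\<^esub> x) = cls p q (scalar (cnj c)) \<otimes>\<^bsub>FRU2 p q\<^esub> star x"
    by (rule star[unfolded is_star_def, THEN conjunct2, THEN conjunct1],
        rule star[unfolded is_star_def, THEN conjunct2, THEN conjunct2, THEN conjunct1])
  show "star_rel x y \<Longrightarrow> star_rel x' y' \<Longrightarrow> star_rel (x + x') (y + y')"
    "star_rel x y \<Longrightarrow> star_rel x' y' \<Longrightarrow> star_rel (x * x') (y' * y)"
    "star_rel x y \<Longrightarrow> star_rel (scalar c * x) (scalar (cnj c) * y)"
    using *(1)[rule_format, OF cls_carrier cls_carrier, of x x'] *(2)[rule_format, OF cls_carrier, of c x]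
    unfolding star_rel_def by (simp_all add: cls_add cls_mult)
qed

lemma star_rel_uminus: "star_rel x y \<Longrightarrow> star_rel (- x) (- y)"
proof -
  assume "star_rel x y"
  from star_rel_scalar[OF this, of "- 1"] show ?thesis
    by (simp add: scalar_def single_uminus)
qed

lemma star_rel_lam: "star_rel (lam f) (lam (mero_bar f))"
  and star_rel_mu: "star_rel (mu f) (mu (mero_bar f))"
  using star unfolding is_star_def star_rel_def by blast+

lemma star_rel_gens:
  assumes "z \<noteq> 0"
  shows "star_rel (alpha z) (delta (1 / cnj z))" "star_rel (beta z) (- gam (1 / cnj z))"
    "star_rel (gam z) (- beta (1 / cnj z))" "star_rel (delta z) (alpha (1 / cnj z))"
    "star_rel (detinv z) (detinv (of_real q powi (-2) / cnj z))"
  using star assms unfolding is_star_def star_rel_def by blast+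

lemma cls_lam_1: "cls p q (lam 1) = cls p q 1"
  using FR_ideal_eqs[OF FR_eqs.lam_const[of 1]] by (simp add: cls_eq_iff mero_1 scalar_1)

lemma star_rel_1: "star_rel 1 1"
proof -
  have "mero_bar 1 = 1" using mero_bar_const[of 1] by (simp add: mero_1)
  then show ?thesis using star_rel_lam[of 1] by (simp add: star_rel_def cls_lam_1)
qed

text \<open>
  The graph of star after antipode. Two antimultiplicative maps compose to a multiplicative one.
\<close>
definition \<phi>_rel :: "falg \<Rightarrow> falg \<Rightarrow> bool" where
  "\<phi>_rel x y \<longleftrightarrow> (\<exists>u. S_rel x u \<and> star_rel u y)"

lemma \<phi>_rel_add: "\<phi>_rel x y \<Longrightarrow> \<phi>_rel x' y' \<Longrightarrow> \<phi>_rel (x + x') (y + y')"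
  and \<phi>_rel_mult: "\<phi>_rel x y \<Longrightarrow> \<phi>_rel x' y' \<Longrightarrow> \<phi>_rel (x * x') (y * y')"
  and \<phi>_rel_1: "\<phi>_rel 1 1"
  unfolding \<phi>_rel_def by (blast intro: S_rel_add star_rel_add S_rel_mult star_rel_mult S_rel_1 star_rel_1)+

lemma \<phi>_rel_0: "\<phi>_rel 0 0"
proof -
  have "scalar 0 = 0" by (simp add: scalar_def)
  then have "S_rel 0 0" "star_rel 0 0"
    using S_rel_scalar[OF S_rel_1, of 0] star_rel_scalar[OF star_rel_1, of 0] by simp_all
  then show ?thesis unfolding \<phi>_rel_def by blast
qed

lemma S_rel_gens:
  assumes "z \<noteq> 0"
  defines "w \<equiv> of_real q powi (-2) * z"
  shows "S_rel (alpha z) (Fquot p q * detinv w * delta w)" "S_rel (beta z) (- (Fquot p q * detinv w * beta w))"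
    "S_rel (gam z) (- (Fquot p q * detinv w * gam w))" "S_rel (delta z) (Fquot p q * detinv w * alpha w)"
  using S assms unfolding is_antipode_def S_rel_def Let_def by blast+

text \<open>
  The antipode exchanges $\alpha$ and $\delta$, the star exchanges them back and exchanges $\beta$ and
  $\gamma$; the signs cancel. The result is the transposed matrix.
\<close>
lemma \<phi>_rel_matgen:
  assumes "z \<noteq> 0"
  shows "\<phi>_rel (matgen a b z) (matgen b a (of_real q ^ 2 / cnj z)
     * (detinv (1 / cnj z) * (lam (inverse (Fmero p q)) * mu (Fmero p q))))"
proof -
  define w where "w = of_real q powi (-2) * z"
  have w: "w \<noteq> 0" using assms q_pos by (simp add: w_def)
  have w1: "1 / cnj w = of_real q ^ 2 / cnj z" "of_real q powi (-2) / cnj w = 1 / cnj z"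
    using q_pos by (simp_all add: w_def power_int_minus field_simps)
  have D: "star_rel (Fquot p q * detinv w) (detinv (1 / cnj z) * (lam (inverse (Fmero p q)) * mu (Fmero p q)))"
    unfolding Fquot_def
    by (intro star_rel_mult star_rel_gens(5)[OF w, unfolded w1] star_rel_mu[of "Fmero p q", unfolded mero_bar_F]
        star_rel_lam[of "inverse (Fmero p q)", unfolded mero_bar_inverse mero_bar_F])
  note st = star_rel_mult[OF D star_rel_gens(1)[OF w, unfolded w1]] star_rel_uminus[OF star_rel_mult[OF D star_rel_gens(2)[OF w, unfolded w1]]]
    star_rel_uminus[OF star_rel_mult[OF D star_rel_gens(3)[OF w, unfolded w1]]] star_rel_mult[OF D star_rel_gens(4)[OF w, unfolded w1]]
  show ?thesis
    using S_rel_gens[OF assms, folded w_def] st unfolding \<phi>_rel_def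
    by (cases a; cases b) (auto simp: matgen_def)
qed

lemma \<phi>_rel_fused:
  assumes "\<And>a b i. \<phi>_rel (L a b i) (L' a b i)"
  shows "\<phi>_rel (fused L A k s) (fused L' A k s)"
  by (induction A arbitrary: k s) (auto intro!: \<phi>_rel_add \<phi>_rel_mult \<phi>_rel_0 \<phi>_rel_1 assms)

end

text \<open>
  The factor \<open>unit_at\<close> is needed for the empty product.
\<close>
lemma \<iota>_fused: "\<iota> p q (fused L A k s) = unit_at p q * fused (\<lambda>a b i. \<iota> p q (L a b i)) A k s"
proof (induction A arbitrary: k s)
  case (Cons a A)
  have "unit_at p q * (x * z) = x * (unit_at p q * z)" for x z
    using unit_at_central[of p q x] by (simp flip: mult.assoc)
  then show ?case using Cons by (simp add: \<iota>_add \<iota>_mult distrib_left)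
qed (auto simp: \<iota>_0 \<iota>_1)

lemma e_mult_assoc: "unit_at p q * x * (unit_at p q * y) = unit_at p q * (x * y)"
proof -
  have "unit_at p q * x * (unit_at p q * y) = (unit_at p q * x * unit_at p q) * y" by (simp add: mult.assoc)
  also have "unit_at p q * x * unit_at p q = unit_at p q * unit_at p q * x"
    by (simp only: mult.assoc unit_at_central[of p q x, symmetric])
  finally show ?thesis by (simp add: unit_at_idem mult.assoc)
qed

context star_antipode
begin

text \<open>
  The norm factors are constant multiples of \<open>gram\<close>, with a constant that depends on \<open>N\<close> only, so
  that the assertion reduces to \<open>fused_transpose\<close>.
\<close>
theorem star_antipode_t_el:
  assumes z: "z \<noteq> 0" and kj: "k \<le> N" "j \<le> N"
  shows "cls p q (mu (Gamma_coeff p q N k)) \<otimes>\<^bsub>FRU2 p q\<^esub> star (S (cls p q (t_el p q N k j z)))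
       = cls p q (lam (Gamma_coeff p q N j)
           * t_el p q N j k (of_real q powi (-2 * (int N - 2)) / cnj z)
           * prod_list (map (\<lambda>i. detinv (of_real q powi (-2 * int i) / cnj z)) [0..<N]))"
proof -
  define w where "w = of_real q powi (-2 * (int N - 2)) / cnj z"
  have w: "w \<noteq> 0" using z q_pos by (simp add: w_def)
  define d where "d = (\<lambda>i::int. \<iota>' (detinv (of_real q powi (-2 * i) / cnj z)))"
  interpret transposed_RLL "\<lambda>f. \<kappa> (lam f)" "\<lambda>f. \<kappa> (mu f)" "\<lambda>i. shift (of_int i)" dbracket cbracket "gens_at w" d "int N - 1"
  proof -
    interpret RLL_algebra "\<lambda>f. \<kappa> (lam f)" "\<lambda>f. \<kappa> (mu f)" "\<lambda>i. shift (of_int i)" dbracket cbracket "gens_at w"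
      by (rule RLL_algebra_gens_at[OF w])
    show "transposed_RLL (\<lambda>f. \<kappa> (lam f)) (\<lambda>f. \<kappa> (mu f)) (\<lambda>i. shift (of_int i)) dbracket cbracket (gens_at w) d"
      by unfold_locales (unfold d_def, rule \<iota>_detinv_central, use z q_pos in simp)
  qed
  let ?A = "replicate (N - k) False @ replicate k True"
  define Lz where "Lz = (\<lambda>a b i. matgen a b (of_real q powi (2 * i) * z))"
  define Lz' where "Lz' = (\<lambda>a b i. matgen b a (of_real q powi (2 * (int N - 1 - i)) * w)
     * (detinv (of_real q powi (-2 * i) / cnj z) * (lam (inverse (Fmero p q)) * mu (Fmero p q))))"
  have "cls p q (t_el p q N k j z) = cls p q (fused Lz ?A (int j) 0)"
    unfolding \<iota>_eq_iff[symmetric] t_el_fused[OF z kj] \<iota>_fused Lz_def gens_at_def[symmetric] ..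
  moreover have "\<phi>_rel (fused Lz ?A (int j) 0) (fused Lz' ?A (int j) 0)"
  proof (rule \<phi>_rel_fused)
    fix a b i
    have q1: "cnj (of_real q powi (2 * i) * z) = of_real q powi (2 * i) * cnj z" by simp
    have "of_real q ^ 2 / cnj (of_real q powi (2 * i) * z) = of_real q powi (2 * (int N - 1 - i)) * w"
    proof -
      have "of_real q powi (2 * (int N - 1 - i)) * (of_real q powi (-2 * (int N - 2)) :: complex)
          = of_real q powi (2 + - (2 * i))"
        using q_pos by (subst power_int_add[symmetric]) (simp_all add: algebra_simps)
      also have "\<dots> = of_real q ^ 2 / of_real q powi (2 * i)"
        using q_pos by (subst power_int_add) (simp_all add: power_int_minus divide_inverse)
      finally show ?thesis unfolding q1 w_def by (simp add: field_simps)
    qed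
    moreover have "1 / cnj (of_real q powi (2 * i) * z) = of_real q powi (-2 * i) / cnj z"
      unfolding q1 using q_pos by (simp add: power_int_minus field_simps)
    moreover have "of_real q powi (2 * i) * z \<noteq> 0" using z q_pos by simp
    ultimately show "\<phi>_rel (Lz a b i) (Lz' a b i)"
      using \<phi>_rel_matgen[of "of_real q powi (2 * i) * z" a b] unfolding Lz_def Lz'_def by simp
  qed
  ultimately have star: "star (S (cls p q (t_el p q N k j z))) = cls p q (fused Lz' ?A (int j) 0)"
    by (auto simp: \<phi>_rel_def S_rel_def star_rel_def)
  have L'_eq: "\<iota>' (Lz' a b i) = L' a b i" for a b i
  proof -
    have "\<iota>' (Lz' a b i) = gens_at w b a (int N - 1 - i) * (d i * (\<iota>' (lam (inverse (Fmero p q)) * mu (Fmero p q))))"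
      unfolding Lz'_def \<iota>_mult[of p q "matgen b a _"] \<iota>_mult[of p q "detinv _"] gens_at_def d_def ..
    also have "\<dots> = gens_at w b a (int N - 1 - i) * (d i * (e * (\<kappa> (mu (dbracket 1)) * \<kappa> (lam (1 / dbracket 1)))))"
      unfolding \<iota>_def[of p q "lam _ * mu _"] \<kappa>_mult F_quotient ..
    also have "\<dots> = e * gens_at w b a (int N - 1 - i) * (\<kappa> (mu (dbracket 1)) * \<kappa> (lam (1 / dbracket 1))) * d i"
      unfolding d_central[of i "e * _"] unit_at_central[of p q "gens_at _ _ _ _"] by (simp only: mult.assoc)
    also have "e * gens_at w b a (int N - 1 - i) = gens_at w b a (int N - 1 - i)"
      unfolding gens_at_def unit_at_\<iota> ..
    finally show ?thesis unfolding L'_def .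
  qed
  define cN where "cN = mero (\<lambda>_. (- E 1) ^ N)"
  have cN: "\<kappa> (lam cN) = \<kappa> (mu cN)" unfolding cN_def \<kappa>_lam_const \<kappa>_mu_const ..
  have G: "Gamma_coeff p q N i = cN * K.gram (N - i) i" if "i \<le> N" for i
    unfolding cN_def by (rule Gamma_eq[OF that])
  let ?D = "prod_list (map (\<lambda>i. detinv (of_real q powi (-2 * int i) / cnj z)) [0..<N])"
  have D: "\<iota>' ?D = e * prod_list (map (\<lambda>i. d (0 + int i)) [0..<N])"
    unfolding e_prod_list[symmetric] d_def by simp
  have M: "\<kappa> (mu (K.gram (N - k) k)) * fused L' ?A (int j) 0
    = \<kappa> (lam (K.gram (N - j) j)) * W (N - j) j (int k) 0 * prod_list (map (\<lambda>i. d (0 + int i)) [0..<N])"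
    using fused_transpose[of "N - j" j N "N - k" k 0] kj by simp
  have ec: "x * (e * y) = e * (x * y)" for x y
    using unit_at_central[of p q x] by (simp flip: mult.assoc)
  have "\<iota>' (mu (Gamma_coeff p q N k) * fused Lz' ?A (int j) 0) = \<kappa> (mu cN) * (e * (\<kappa> (mu (K.gram (N - k) k)) * fused L' ?A (int j) 0))"
    unfolding \<iota>_mult_\<kappa> \<iota>_fused L'_eq G[OF kj(1)] K.mu_mult ec[of "\<kappa> (mu (K.gram (N - k) k))", symmetric] mult.assoc ..
  also have "\<dots> = \<kappa> (lam (Gamma_coeff p q N j)) * (e * (W (N - j) j (int k) 0 * prod_list (map (\<lambda>i. d (0 + int i)) [0..<N])))"
    unfolding M G[OF kj(2)] K.lam_mult cN mult.assoc ec[of "\<kappa> (lam (K.gram (N - j) j))"] ..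
  also have "\<dots> = \<iota>' (lam (Gamma_coeff p q N j) * (t_el p q N j k w * ?D))"
    unfolding \<iota>_mult_\<kappa>[of p q "lam _"] unfolding \<iota>_mult D t_el_fused[OF w kj(2,1)] e_mult_assoc ..
  finally have "cls p q (mu (Gamma_coeff p q N k) * fused Lz' ?A (int j) 0) = cls p q (lam (Gamma_coeff p q N j) * (t_el p q N j k w * ?D))"
    by (simp only: \<iota>_eq_iff)
  then show ?thesis unfolding star cls_mult w_def[symmetric] by (simp only: mult.assoc)
qed

end

theorem proposition3p5:
  fixes p q :: real and N k j :: nat and z :: complex
    and S star :: "falg set \<Rightarrow> falg set"
  assumes "0 < p" "p < 1" "0 < q" "q < 1"
    and "alg_indep_Q p q"
    and "is_antipode p q S"
    and "is_star p q star"
    and "z \<noteq> 0"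
    and "k \<le> N" "j \<le> N"
  shows "cls p q (mu (Gamma_coeff p q N k)) \<otimes>\<^bsub>FRU2 p q\<^esub> star (S (cls p q (t_el p q N k j z)))
       = cls p q (lam (Gamma_coeff p q N j)
           * t_el p q N j k (of_real q powi (-2 * (int N - 2)) / cnj z)
           * prod_list (map (\<lambda>i. detinv (of_real q powi (-2 * int i) / cnj z)) [0..<N]))"
proof -
  interpret star_antipode p q S star
    using assms by unfold_locales
  show ?thesis using assms by (intro star_antipode_t_el)
qed

end
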